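(* Let $N_1,M_1\to+\infty$ with $M_1/N_1\to\alpha_{11}\in(0,+\infty)$, and let $\mathbf{H}_{11}$ be an $N_1\times M_1$ random matrix with i.i.d. circularly symmetric complex Gaussian entries of mean $0$ and variance $1/M_1$. Let $\sigma_1^2>0$, $p_{1,\max}>0$, and let $S=N_1-m_1$ be the number of transmit opportunities, where $m_1$ is the number of transmit dimensions used by the primary water-filling power allocation (see context). Put $$a=\left(1-\frac{1}{\sqrt{\alpha_{11}}}\right)^2,\qquad b=\left(1+\frac{1}{\sqrt{\alpha_{11}}}\right)^2,$$ and let $\beta_\infty$ be the unique solution $\beta>\sigma_1^2/b$ of $$\int_{\max(\sigma_1^2/\beta,\,a)}^{b}\left(\beta-\frac{\sigma_1^2}{\lambda}\right)\frac{\sqrt{(\lambda-a)(b-\lambda)}}{2\pi\lambda}\,\mathrm{d}\lambda-p_{1,\max}=0.$$ Then, almost surely, $S/M_1$ converges to $$S_\infty=\frac{1}{\alpha_{11}}-\int_{\max(a,\,\sigma_1^2/\beta_\infty)}^{b}\frac{\sqrt{(\lambda-a)(b-\lambda)}}{2\pi\lambda}\,\mathrm{d}\lambda.$$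
   Context: Primary water-filling: let $\lambda_1,\ldots,\lambda_{M_1}$ be the eigenvalues of $\mathbf{H}_{11}^H\mathbf{H}_{11}$ and $p_{1,n}=\left(\beta-\sigma_1^2/\lambda_n\right)^+$ for $n=1,\ldots,M_1$ (with $p_{1,n}=0$ if $\lambda_n=0$), where $(x)^+=\max(0,x)$ and the water-level $\beta$ is set so that $\sum_{n=1}^{M_1}p_{1,n}=M_1p_{1,\max}$. Then $m_1$ is the number of $n$ with $p_{1,n}>0$, equivalently the number of $n$ with $\lambda_n>\sigma_1^2/\beta$, and $S=N_1-m_1$ is called the number of transmit opportunities. *)

theory Defs
  imports "HOL-Probability.Probability" "Jordan_Normal_Form.Schur_Decomposition"
begin

text \<open>A circularly symmetric complex Gaussian of mean \<open>0\<close> and variance \<open>v\<close> (the variance being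
  the expectation of \<open>cmod Z ^ 2\<close>): real and imaginary parts are independent real Gaussians, each
  of variance \<open>v / 2\<close>. The second argument of \<^const>\<open>normal_density\<close> is a standard deviation.\<close>

definition circ_gaussian :: "'w measure \<Rightarrow> real \<Rightarrow> ('w \<Rightarrow> complex) \<Rightarrow> bool" where
  "circ_gaussian P v Z \<longleftrightarrow>
     prob_space.indep_var P borel (\<lambda>\<omega>. Re (Z \<omega>)) borel (\<lambda>\<omega>. Im (Z \<omega>)) \<and>
     distributed P lborel (\<lambda>\<omega>. Re (Z \<omega>)) (normal_density 0 (sqrt (v / 2))) \<and>
     distributed P lborel (\<lambda>\<omega>. Im (Z \<omega>)) (normal_density 0 (sqrt (v / 2)))"

definition iid_gaussian_matrix ::
    "'w measure \<Rightarrow> nat \<Rightarrow> nat \<Rightarrow> real \<Rightarrow> ('w \<Rightarrow> complex mat) \<Rightarrow> bool" where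
  "iid_gaussian_matrix P n m v H \<longleftrightarrow>
     (\<forall>\<omega>\<in>space P. H \<omega> \<in> carrier_mat n m) \<and>
     prob_space.indep_vars P (\<lambda>_. borel) (\<lambda>ij \<omega>. H \<omega> $$ ij) ({..<n} \<times> {..<m}) \<and>
     (\<forall>i<n. \<forall>j<m. circ_gaussian P v (\<lambda>\<omega>. H \<omega> $$ (i, j)))"

text \<open>Eigenvalues of the Gram matrix with algebraic multiplicity, so that there are
  \<^term>\<open>dim_col H\<close> of them. The Gram matrix is Hermitian, hence \<^const>\<open>Re\<close> only changes the type.\<close>

definition gram_eigenvalues :: "complex mat \<Rightarrow> real multiset" where
  "gram_eigenvalues H = image_mset Re (proots (char_poly (mat_adjoint H * H)))"

definition wf_power :: "real \<Rightarrow> real \<Rightarrow> real \<Rightarrow> real" where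
  "wf_power s \<beta> l = (if l = 0 then 0 else max 0 (\<beta> - s / l))"

text \<open>Here and below \<open>s\<close> is the noise variance and \<open>pmax\<close> the power budget per dimension. For
  \<open>s, pmax > 0\<close> the water level exists and is unique unless all eigenvalues are zero.\<close>

definition water_level :: "real \<Rightarrow> real \<Rightarrow> complex mat \<Rightarrow> real" where
  "water_level s pmax H =
     (THE \<beta>. (\<Sum>l\<in>#gram_eigenvalues H. wf_power s \<beta> l) = real (dim_col H) * pmax)"

definition used_dimensions :: "real \<Rightarrow> real \<Rightarrow> complex mat \<Rightarrow> nat" where
  "used_dimensions s pmax H =
     size {#l \<in># gram_eigenvalues H. wf_power s (water_level s pmax H) l > 0#}"

definition transmit_opportunities :: "real \<Rightarrow> real \<Rightarrow> complex mat \<Rightarrow> int" where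
  "transmit_opportunities s pmax H = int (dim_row H) - int (used_dimensions s pmax H)"

end

theory Submission
  imports Defs
begin

text \<open>
  With probability one the empirical spectral distribution of the Gram matrix converges to the
  Marchenko--Pastur law, and the number of used dimensions is a continuous functional of it.

  The spectral convergence uses only the resolvent \<open>Q = (H\<^sup>* H + x)\<^sup>-\<^sup>1\<close> at real \<open>x > 0\<close>. Removing one row
  changes \<open>H\<^sup>* H\<close> by a rank-one matrix, so by Sherman--Morrison \<open>h\<^sub>i Q h\<^sub>i\<^sup>* = q\<^sub>i / (1 + q\<^sub>i)\<close>, where
  \<open>q\<^sub>i = h\<^sub>i Q\<^sub>i h\<^sub>i\<^sup>*\<close> involves the resolvent \<open>Q\<^sub>i\<close> without row \<open>i\<close>. As \<open>h\<^sub>i\<close> and \<open>Q\<^sub>i\<close> are independent,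
  \<open>q\<^sub>i\<close> is close to \<open>G = tr Q / m\<close>, and summing over \<open>i\<close> gives \<open>1 - x G \<approx> (n / m) G / (1 + G)\<close>, whose
  unique nonnegative solution is the Stieltjes transform of the limit law. Replacing a row changes
  \<open>G\<close> by at most \<open>1 / (x m)\<close>, so the bounded differences inequality yields exponential concentration
  and Borel--Cantelli applies. The transforms at \<open>x \<rightarrow> 1\<close> determine all means of powers of
  \<open>1 / (1 + \<lambda>)\<close>, hence, by Weierstrass, of all continuous functions of it; the water-filling power
  \<open>max 0 (\<beta> - s / \<lambda>)\<close> is one of them.

  The number of used dimensions is the slope in \<open>\<beta>\<close> of the convex total power, whose limit is
  continuously differentiable; therefore the slopes converge as well, also at the converging
  random water levels.
\<close>

subsection \<open>Resolvents of Gram matrices\<close>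

text \<open>At real x > 0 the matrix W + x, with W the Gram matrix, is positive definite: the
  resolvent bounds all come from one quadratic form, 1 + q_i cannot vanish, and t \<mapsto> x t + c
  t / (1 + t) has slope at least x, so a small defect in the fixed-point equation forces a small
  error in G.

  The points x = 1 + h with h = 1 / (j + 1) are chosen because, for t = 1 / (1 + l), the function 1
  / (l + x) equals t / (1 + h t), whose geometric expansion releases the powers of t one after
  another as h tends to 0. The variable t lives in the compact interval [0, 1]; this takes the place
  of a bound on the largest eigenvalue.

  The obstacle at the end is that counting is a discontinuous functional of the spectrum, with a
  threshold that is itself random. Secants of the total power on both sides of the level enclose the
  count and deal with both at once.

  Gaussianity enters through second moments: E Z^2 = 0 and E |Z|^4 = 2 v^2 make the centred products
  of two entries of a row orthogonal with equal norms.\<close>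

definition shifted_gram :: "nat \<Rightarrow> real \<Rightarrow> nat set \<Rightarrow> (nat \<Rightarrow> nat \<Rightarrow> complex) \<Rightarrow> complex mat" where
  "shifted_gram m x S h =
     mat m m (\<lambda>(j, k). (\<Sum>i\<in>S. cnj (h i j) * h i k) + (if j = k then of_real x else 0))"

text \<open>Taking the set \<open>S\<close> of rows as an argument lets a row be dropped without
  renumbering. The adjugate formula expresses every entry by determinants, from which measurability
  can be read off.\<close>

definition resolvent :: "nat \<Rightarrow> real \<Rightarrow> nat set \<Rightarrow> (nat \<Rightarrow> nat \<Rightarrow> complex) \<Rightarrow> complex mat" where
  "resolvent m x S h =
     inverse (det (shifted_gram m x S h)) \<cdot>\<^sub>m adj_mat (shifted_gram m x S h)"

text \<open>Vectors are functions read only below \<open>m\<close>; sums over \<open>{..<m}\<close>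
  replace dimension side conditions.\<close>

definition apply_mat :: "nat \<Rightarrow> complex mat \<Rightarrow> (nat \<Rightarrow> complex) \<Rightarrow> nat \<Rightarrow> complex" where
  "apply_mat m A u j = (\<Sum>k<m. A $$ (j, k) * u k)"

definition quad_form :: "nat \<Rightarrow> complex mat \<Rightarrow> (nat \<Rightarrow> complex) \<Rightarrow> complex" where
  "quad_form m A u = (\<Sum>j<m. cnj (u j) * apply_mat m A u j)"

definition sq_norm :: "nat \<Rightarrow> (nat \<Rightarrow> complex) \<Rightarrow> real" where
  "sq_norm m u = (\<Sum>k<m. (cmod (u k))\<^sup>2)"

lemma sq_norm_nonneg: "sq_norm m u \<ge> 0"
  by (simp add: sq_norm_def sum_nonneg)

lemma sq_norm_cnj: "complex_of_real (sq_norm m u) = (\<Sum>k<m. cnj (u k) * u k)"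
  unfolding sq_norm_def of_real_sum by (intro sum.cong refl) (simp only: complex_norm_square mult.commute)

lemma shifted_gram_carrier [simp]: "shifted_gram m x S h \<in> carrier_mat m m"
  by (simp add: shifted_gram_def)

lemma shifted_gram_index [simp]:
  "j < m \<Longrightarrow> k < m \<Longrightarrow> shifted_gram m x S h $$ (j, k) =
     (\<Sum>i\<in>S. cnj (h i j) * h i k) + (if j = k then of_real x else 0)"
  by (simp add: shifted_gram_def)

lemma resolvent_carrier [simp]: "resolvent m x S h \<in> carrier_mat m m"
  unfolding resolvent_def using adj_mat(1)[OF shifted_gram_carrier] by simp

text \<open>The source of positivity: the form is |H v|^2 + x |v|^2. For x > 0 it makes the matrix
  invertible and bounds the inverse; for x = 0 it shows that Gram eigenvalues are real and
  nonnegative.\<close>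

lemma quad_form_shifted_gram:
  assumes "finite S"
  shows "quad_form m (shifted_gram m x S h) v =
     of_real ((\<Sum>i\<in>S. (cmod (\<Sum>k<m. h i k * v k))\<^sup>2) + x * sq_norm m v)"
proof -
  have 1: "apply_mat m (shifted_gram m x S h) v j =
      (\<Sum>i\<in>S. cnj (h i j) * (\<Sum>k<m. h i k * v k)) + x * v j" if "j < m" for j
  proof -
    have "apply_mat m (shifted_gram m x S h) v j =
       (\<Sum>k<m. (\<Sum>i\<in>S. cnj (h i j) * h i k) * v k) + (\<Sum>k<m. (if j = k then of_real x * v k else 0))"
      unfolding apply_mat_def sum.distrib[symmetric] using that
      by (intro sum.cong refl) (auto simp: ring_distribs)
    also have "(\<Sum>k<m. (if j = k then of_real x * v k else 0)) = x * v j"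
      using that by simp
    also have "(\<Sum>k<m. (\<Sum>i\<in>S. cnj (h i j) * h i k) * v k) = (\<Sum>i\<in>S. cnj (h i j) * (\<Sum>k<m. h i k * v k))"
      by (subst sum_distrib_right, subst sum.swap) (simp add: sum_distrib_left mult.assoc)
    finally show ?thesis .
  qed
  define z where "z i = (\<Sum>k<m. h i k * v k)" for i
  have "quad_form m (shifted_gram m x S h) v =
     (\<Sum>j<m. cnj (v j) * (\<Sum>i\<in>S. cnj (h i j) * z i)) + (\<Sum>j<m. cnj (v j) * (x * v j))"
    unfolding quad_form_def by (simp add: 1 z_def[symmetric] ring_distribs sum.distrib)
  also have "(\<Sum>j<m. cnj (v j) * (x * v j)) = of_real (x * sq_norm m v)"
    by (simp add: sq_norm_cnj sum_distrib_left mult_ac)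
  also have "(\<Sum>j<m. cnj (v j) * (\<Sum>i\<in>S. cnj (h i j) * z i)) =
      (\<Sum>i\<in>S. \<Sum>j<m. cnj (v j) * (cnj (h i j) * z i))"
    unfolding sum_distrib_left by (rule sum.swap)
  also have "\<dots> = (\<Sum>i\<in>S. cnj (z i) * z i)"
  proof (intro sum.cong refl)
    fix i
    have "(\<Sum>j<m. cnj (v j) * (cnj (h i j) * z i)) = (\<Sum>j<m. cnj (h i j * v j)) * z i"
      unfolding sum_distrib_right by (simp add: mult_ac)
    then show "(\<Sum>j<m. cnj (v j) * (cnj (h i j) * z i)) = cnj (z i) * z i"
      by (simp add: z_def)
  qed
  also have "\<dots> = of_real (\<Sum>i\<in>S. (cmod (z i))\<^sup>2)"
    unfolding of_real_sum complex_norm_square by (simp add: mult.commute)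
  finally show ?thesis by (simp add: z_def)
qed

lemma apply_mat_eq_mult_mat_vec:
  assumes "A \<in> carrier_mat m m" "j < m"
  shows "apply_mat m A u j = (A *\<^sub>v vec m u) $ j"
  using assms by (simp add: apply_mat_def scalar_prod_def lessThan_atLeast0)

text \<open>A kernel vector would annihilate the quadratic form, hence x times its squared
  norm.\<close>

lemma det_shifted_gram_nonzero:
  assumes "finite S" "x > 0"
  shows "det (shifted_gram m x S h) \<noteq> 0"
proof
  assume "det (shifted_gram m x S h) = 0"
  then obtain v where v: "v \<in> carrier_vec m" "v \<noteq> 0\<^sub>v m" "shifted_gram m x S h *\<^sub>v v = 0\<^sub>v m"
    using det_0_iff_vec_prod_zero[OF shifted_gram_carrier] by blast
  have "vec m (\<lambda>k. v $ k) = v" using v by auto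
  then have "apply_mat m (shifted_gram m x S h) (\<lambda>k. v $ k) j = 0" if "j < m" for j
    using that v by (simp add: apply_mat_eq_mult_mat_vec)
  then have "quad_form m (shifted_gram m x S h) (\<lambda>k. v $ k) = 0"
    by (simp add: quad_form_def)
  then have 0: "(\<Sum>i\<in>S. (cmod (\<Sum>k<m. h i k * v $ k))\<^sup>2) + x * sq_norm m (\<lambda>k. v $ k) = 0"
    by (simp only: quad_form_shifted_gram[OF assms(1)] of_real_eq_0_iff)
  have "(\<Sum>i\<in>S. (cmod (\<Sum>k<m. h i k * v $ k))\<^sup>2) \<ge> 0" by (simp add: sum_nonneg)
  moreover have "0 \<le> x * sq_norm m (\<lambda>k. v $ k)"
    using assms(2) sq_norm_nonneg[of m "\<lambda>k. v $ k"] by simp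
  ultimately have "x * sq_norm m (\<lambda>k. v $ k) = 0" using 0 by linarith
  then have "sq_norm m (\<lambda>k. v $ k) = 0" using assms(2) by simp
  then have "\<forall>k<m. v $ k = 0"
    unfolding sq_norm_def by (subst (asm) sum_nonneg_eq_0_iff) auto
  then show False using v by (auto intro: eq_vecI)
qed

lemma resolvent_inverse:
  assumes "finite S" "x > 0"
  shows "shifted_gram m x S h * resolvent m x S h = 1\<^sub>m m"
    and "resolvent m x S h * shifted_gram m x S h = 1\<^sub>m m"
proof -
  note adj = adj_mat[OF shifted_gram_carrier[of m x S h]]
  have nz: "det (shifted_gram m x S h) \<noteq> 0" by (rule det_shifted_gram_nonzero[OF assms])
  have "shifted_gram m x S h * resolvent m x S h =
     inverse (det (shifted_gram m x S h)) \<cdot>\<^sub>m (shifted_gram m x S h * adj_mat (shifted_gram m x S h))"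
    unfolding resolvent_def by (rule mult_smult_distrib[OF shifted_gram_carrier adj(1)])
  also have "\<dots> = 1\<^sub>m m" unfolding adj(2) using nz by (auto intro!: eq_matI)
  finally show "shifted_gram m x S h * resolvent m x S h = 1\<^sub>m m" .
  have "resolvent m x S h * shifted_gram m x S h =
     inverse (det (shifted_gram m x S h)) \<cdot>\<^sub>m (adj_mat (shifted_gram m x S h) * shifted_gram m x S h)"
    unfolding resolvent_def by (rule mult_smult_assoc_mat[OF adj(1) shifted_gram_carrier])
  also have "\<dots> = 1\<^sub>m m" unfolding adj(3) using nz by (auto intro!: eq_matI)
  finally show "resolvent m x S h * shifted_gram m x S h = 1\<^sub>m m" .
qed

lemma resolvent_unique:
  assumes "finite S" "x > 0" "R \<in> carrier_mat m m" "shifted_gram m x S h * R = 1\<^sub>m m"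
  shows "resolvent m x S h = R"
proof -
  have "resolvent m x S h = resolvent m x S h * (shifted_gram m x S h * R)"
    using assms(4) right_mult_one_mat[OF resolvent_carrier] by metis
  also have "\<dots> = (resolvent m x S h * shifted_gram m x S h) * R"
    by (rule assoc_mult_mat[symmetric, OF resolvent_carrier shifted_gram_carrier assms(3)])
  also have "\<dots> = R" using resolvent_inverse(2)[OF assms(1,2)] assms(3) by simp
  finally show ?thesis .
qed

lemma mult_mat_index:
  assumes "A \<in> carrier_mat m m" "B \<in> carrier_mat m m" "j < m" "l < m"
  shows "(A * B) $$ (j, l) = (\<Sum>k<m. A $$ (j, k) * B $$ (k, l))"
  using assms by (simp add: scalar_prod_def lessThan_atLeast0)

lemma resolvent_inverse_index:
  assumes "finite S" "x > 0" "j < m" "l < m"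
  shows "(\<Sum>k<m. shifted_gram m x S h $$ (j, k) * resolvent m x S h $$ (k, l)) = (if j = l then 1 else 0)"
  using resolvent_inverse(1)[OF assms(1,2), of m h] assms(3,4)
    mult_mat_index[OF shifted_gram_carrier resolvent_carrier assms(3,4), of x S h x S h] by simp

lemma apply_shifted_gram_resolvent:
  assumes "finite S" "x > 0" "j < m"
  shows "apply_mat m (shifted_gram m x S h) (apply_mat m (resolvent m x S h) u) j = u j"
proof -
  let ?B = "shifted_gram m x S h" and ?Q = "resolvent m x S h"
  have "apply_mat m ?B (apply_mat m ?Q u) j = (\<Sum>k<m. \<Sum>l<m. ?B $$ (j, k) * (?Q $$ (k, l) * u l))"
    by (simp add: apply_mat_def sum_distrib_left)
  also have "\<dots> = (\<Sum>l<m. (\<Sum>k<m. ?B $$ (j, k) * ?Q $$ (k, l)) * u l)"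
    by (subst sum.swap) (simp add: sum_distrib_right mult.assoc)
  also have "\<dots> = (\<Sum>l<m. (if j = l then u l else 0))"
    using assms by (intro sum.cong refl, subst resolvent_inverse_index) auto
  also have "\<dots> = u j" using assms by simp
  finally show ?thesis .
qed

text \<open>Substituting u = B w with w = Q u, where B is the shifted Gram matrix and Q its inverse,
  turns the inner product of w and u into the quadratic form of B at w, a sum of squares.\<close>

lemma sum_cnj_resolvent:
  assumes "finite S" "x > 0"
  shows "(\<Sum>j<m. cnj (apply_mat m (resolvent m x S h) u j) * u j) =
     of_real ((\<Sum>i\<in>S. (cmod (\<Sum>k<m. h i k * apply_mat m (resolvent m x S h) u k))\<^sup>2)
       + x * sq_norm m (apply_mat m (resolvent m x S h) u))"
proof -
  have "(\<Sum>j<m. cnj (apply_mat m (resolvent m x S h) u j) * u j) =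
     quad_form m (shifted_gram m x S h) (apply_mat m (resolvent m x S h) u)"
    unfolding quad_form_def using apply_shifted_gram_resolvent[OF assms] by simp
  then show ?thesis by (simp only: quad_form_shifted_gram[OF assms(1)])
qed

text \<open>With w = Q u the form of Q at u is the conjugate of the sum of squares above, hence
  real. Dropping the squares coming from the rows leaves x |Q u|^2 as a lower bound.\<close>

lemma quad_form_resolvent:
  assumes "finite S" "x > 0"
  shows "quad_form m (resolvent m x S h) u = of_real (Re (quad_form m (resolvent m x S h) u))"
    and "x * sq_norm m (apply_mat m (resolvent m x S h) u) \<le> Re (quad_form m (resolvent m x S h) u)"
    and "0 \<le> Re (quad_form m (resolvent m x S h) u)"
proof -
  let ?w = "apply_mat m (resolvent m x S h) u"
  let ?r = "(\<Sum>i\<in>S. (cmod (\<Sum>k<m. h i k * ?w k))\<^sup>2) + x * sq_norm m ?w"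
  have "quad_form m (resolvent m x S h) u = cnj (\<Sum>j<m. cnj (?w j) * u j)"
    unfolding quad_form_def by (simp add: mult.commute)
  also have "\<dots> = of_real ?r" unfolding sum_cnj_resolvent[OF assms] by (rule complex_cnj_complex_of_real)
  finally have *: "quad_form m (resolvent m x S h) u = of_real ?r" .
  then show "quad_form m (resolvent m x S h) u = of_real (Re (quad_form m (resolvent m x S h) u))"
    by (metis Re_complex_of_real)
  have "(\<Sum>i\<in>S. (cmod (\<Sum>k<m. h i k * ?w k))\<^sup>2) \<ge> 0" by (simp add: sum_nonneg)
  then show "x * sq_norm m ?w \<le> Re (quad_form m (resolvent m x S h) u)"
    unfolding * Re_complex_of_real by simp
  moreover have "0 \<le> x * sq_norm m ?w" using assms sq_norm_nonneg by simp
  ultimately show "0 \<le> Re (quad_form m (resolvent m x S h) u)" by linarith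
qed

lemma apply_mat_unit:
  assumes "k < m" shows "apply_mat m A (\<lambda>l. if l = k then 1 else 0) j = A $$ (j, k)"
proof -
  have "apply_mat m A (\<lambda>l. if l = k then 1 else 0) j = (\<Sum>l<m. if l = k then A $$ (j, l) else 0)"
    unfolding apply_mat_def by (intro sum.cong) auto
  then show ?thesis using assms by simp
qed

lemma sum_cnj_unit:
  fixes f :: "nat \<Rightarrow> complex"
  assumes "k < m" shows "(\<Sum>j<m. cnj (if j = k then 1 else 0) * f j) = f k"
proof -
  have "(\<Sum>j<m. cnj (if j = k then 1 else 0) * f j) = (\<Sum>j<m. if j = k then f j else 0)"
    by (intro sum.cong) auto
  then show ?thesis using assms by simp
qed

text \<open>With B Hermitian, the adjoint of Q equals its product with B Q = 1; regrouping moves B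
  onto the first factor and leaves Q.\<close>

lemma resolvent_hermitian:
  assumes "finite S" "x > 0" "j < m" "k < m"
  shows "cnj (resolvent m x S h $$ (j, k)) = resolvent m x S h $$ (k, j)"
proof -
  let ?B = "shifted_gram m x S h" and ?Q = "resolvent m x S h"
  have B: "cnj (?B $$ (a, b)) = ?B $$ (b, a)" if "a < m" "b < m" for a b
    using that by (simp add: mult.commute)
  have "cnj (?Q $$ (j, k)) = (\<Sum>a<m. cnj (?Q $$ (a, k)) * (if a = j then 1 else 0))"
    using assms by (simp add: if_distrib[of "(*) _"] cong: if_cong)
  also have "\<dots> = (\<Sum>a<m. cnj (?Q $$ (a, k)) * (\<Sum>b<m. ?B $$ (a, b) * ?Q $$ (b, j)))"
    using assms by (intro sum.cong refl) (subst resolvent_inverse_index, auto)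
  also have "\<dots> = (\<Sum>b<m. cnj (\<Sum>a<m. ?B $$ (b, a) * ?Q $$ (a, k)) * ?Q $$ (b, j))"
    by (simp add: sum_distrib_left sum_distrib_right B del: shifted_gram_index)
      (subst sum.swap, simp add: mult_ac)
  also have "\<dots> = (\<Sum>b<m. (if b = k then ?Q $$ (b, j) else 0))"
    using assms by (intro sum.cong refl) (subst resolvent_inverse_index, auto)
  also have "\<dots> = ?Q $$ (k, j)" using assms by simp
  finally show ?thesis .
qed

text \<open>An operator norm bound without spectral theory: for the squared norm s of column k, x s
  \<le> |Q_kk| by the quadratic form at a unit vector, and |Q_kk|^2 \<le> s because it is one of the
  summands. Together x^2 s^2 \<le> s.\<close>

lemma sq_norm_resolvent_column:
  assumes "finite S" "x > 0" "k < m"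
  shows "(\<Sum>j<m. (cmod (resolvent m x S h $$ (j, k)))\<^sup>2) \<le> 1 / x\<^sup>2"
proof -
  let ?Q = "resolvent m x S h" and ?e = "\<lambda>l. if l = k then 1 else (0::complex)"
  define s where "s = (\<Sum>j<m. (cmod (?Q $$ (j, k)))\<^sup>2)"
  have ap: "apply_mat m ?Q ?e = (\<lambda>j. ?Q $$ (j, k))"
    by (rule ext, rule apply_mat_unit[OF assms(3)])
  have q: "quad_form m ?Q ?e = ?Q $$ (k, k)"
    unfolding quad_form_def ap by (rule sum_cnj_unit[OF assms(3)])
  have "x * s \<le> Re (?Q $$ (k, k))"
    using quad_form_resolvent(2)[OF assms(1,2), of m h ?e] unfolding ap q by (simp add: sq_norm_def s_def)
  also have "\<dots> \<le> cmod (?Q $$ (k, k))" by (rule complex_Re_le_cmod)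
  finally have 1: "x * s \<le> cmod (?Q $$ (k, k))" .
  have s0: "s \<ge> 0" by (simp add: s_def sum_nonneg)
  have "(cmod (?Q $$ (k, k)))\<^sup>2 \<le> s"
    unfolding s_def using assms(3) by (intro member_le_sum) auto
  with 1 have "(x * s)\<^sup>2 \<le> s" using s0 assms(2)
    by (meson order_trans power_mono mult_nonneg_nonneg less_imp_le)
  then have "x\<^sup>2 * s * s \<le> 1 * s" by (simp add: power2_eq_square mult_ac)
  then have "x\<^sup>2 * s \<le> 1" using s0 by (cases "s = 0") (auto simp: mult_le_cancel_right)
  then show ?thesis using assms(2) unfolding s_def[symmetric] by (simp add: field_simps)
qed

lemma norm_resolvent_le:
  assumes "finite S" "x > 0" "j < m" "k < m"
  shows "cmod (resolvent m x S h $$ (j, k)) \<le> 1 / x"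
proof -
  have "(cmod (resolvent m x S h $$ (j, k)))\<^sup>2 \<le> (\<Sum>j<m. (cmod (resolvent m x S h $$ (j, k)))\<^sup>2)"
    using assms(3) by (intro member_le_sum) auto
  also have "\<dots> \<le> (1 / x)\<^sup>2" using sq_norm_resolvent_column[OF assms(1,2,4)] by (simp add: power_divide)
  finally show ?thesis using assms(2) by (rule_tac power2_le_imp_le) auto
qed

definition resolvent_trace :: "nat \<Rightarrow> real \<Rightarrow> nat set \<Rightarrow> (nat \<Rightarrow> nat \<Rightarrow> complex) \<Rightarrow> real" where
  "resolvent_trace m x S h = (\<Sum>k<m. Re (resolvent m x S h $$ (k, k)))"

lemma resolvent_diag:
  assumes "finite S" "x > 0" "k < m"
  shows "resolvent m x S h $$ (k, k) = of_real (Re (resolvent m x S h $$ (k, k)))"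
    and "0 \<le> Re (resolvent m x S h $$ (k, k))" "Re (resolvent m x S h $$ (k, k)) \<le> 1 / x"
proof -
  let ?Q = "resolvent m x S h" and ?e = "\<lambda>l. if l = k then 1 else (0::complex)"
  have ap: "apply_mat m ?Q ?e = (\<lambda>j. ?Q $$ (j, k))"
    by (rule ext, rule apply_mat_unit[OF assms(3)])
  have q: "quad_form m ?Q ?e = ?Q $$ (k, k)"
    unfolding quad_form_def ap by (rule sum_cnj_unit[OF assms(3)])
  show "?Q $$ (k, k) = of_real (Re (?Q $$ (k, k)))" "0 \<le> Re (?Q $$ (k, k))"
    using quad_form_resolvent(1,3)[OF assms(1,2), of m h ?e] unfolding q by simp_all
  show "Re (?Q $$ (k, k)) \<le> 1 / x"
    using norm_resolvent_le[OF assms(1,2,3,3)] complex_Re_le_cmod order_trans by blast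
qed

lemma resolvent_trace_bounds:
  assumes "finite S" "x > 0"
  shows "0 \<le> resolvent_trace m x S h" "resolvent_trace m x S h \<le> m / x"
proof -
  show "0 \<le> resolvent_trace m x S h" unfolding resolvent_trace_def
    using resolvent_diag[OF assms] by (intro sum_nonneg) auto
  have "resolvent_trace m x S h \<le> (\<Sum>k<m. 1 / x)" unfolding resolvent_trace_def
    using resolvent_diag[OF assms] by (intro sum_mono) auto
  then show "resolvent_trace m x S h \<le> m / x" by simp
qed

text \<open>Sherman--Morrison, checked by multiplying the candidate \<open>R\<close> with the
  enlarged matrix. The new row adds u u^H with u the conjugate of the row; that row times Q is the
  conjugate of \<open>w\<close> because Q is Hermitian. The denominator has positive real
  part.\<close>

lemma resolvent_insert:
  fixes h :: "nat \<Rightarrow> nat \<Rightarrow> complex" and m :: nat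
  assumes "finite T" "x > 0" "i \<notin> T" "j < m" "l < m"
  defines "w \<equiv> apply_mat m (resolvent m x T h) (\<lambda>k. cnj (h i k))"
  defines "q \<equiv> quad_form m (resolvent m x T h) (\<lambda>k. cnj (h i k))"
  shows "resolvent m x (insert i T) h $$ (j, l) = resolvent m x T h $$ (j, l) - w j * cnj (w l) / (1 + q)"
proof -
  let ?QT = "resolvent m x T h" and ?B = "shifted_gram m x T h"
  define R where "R = mat m m (\<lambda>(j, l). ?QT $$ (j, l) - w j * cnj (w l) / (1 + q))"
  note QT = quad_form_resolvent[OF assms(1,2), of m h "\<lambda>k. cnj (h i k)"]
  have "Re (1 + q) > 0" using QT(3) by (simp add: q_def)
  then have nz: "1 + q \<noteq> 0" by (metis less_irrefl zero_complex.simps(1))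
  have hw: "(\<Sum>k<m. h i k * w k) = q" by (simp add: q_def w_def quad_form_def)
  have hQ: "(\<Sum>k<m. h i k * ?QT $$ (k, l)) = cnj (w l)" if "l < m" for l
    unfolding w_def apply_mat_def cnj_sum using that
    by (intro sum.cong refl) (simp add: resolvent_hermitian[OF assms(1,2)])
  have Bw: "(\<Sum>k<m. ?B $$ (j, k) * w k) = cnj (h i j)" if "j < m" for j
    using apply_shifted_gram_resolvent[OF assms(1,2) that, of h "\<lambda>k. cnj (h i k)"]
    unfolding w_def[symmetric] by (simp add: apply_mat_def)
  have "shifted_gram m x (insert i T) h * R = 1\<^sub>m m"
  proof (rule eq_matI)
    fix j l assume "j < dim_row (1\<^sub>m m :: complex mat)" "l < dim_col (1\<^sub>m m :: complex mat)"
    then have jl: "j < m" "l < m" by auto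
    have BS: "shifted_gram m x (insert i T) h $$ (j, k) = ?B $$ (j, k) + cnj (h i j) * h i k" if "k < m" for k
      using jl that assms(1,3) by simp
    have "(shifted_gram m x (insert i T) h * R) $$ (j, l) =
       (\<Sum>k<m. (?B $$ (j, k) + cnj (h i j) * h i k) * (?QT $$ (k, l) - w k * cnj (w l) / (1 + q)))"
      using jl by (subst mult_mat_index[of _ m]) (auto simp: R_def BS simp del: shifted_gram_index)
    also have "\<dots> = (\<Sum>k<m. ?B $$ (j, k) * ?QT $$ (k, l)) - (\<Sum>k<m. ?B $$ (j, k) * w k) * (cnj (w l) / (1 + q))
       + cnj (h i j) * (\<Sum>k<m. h i k * ?QT $$ (k, l)) - cnj (h i j) * (\<Sum>k<m. h i k * w k) * (cnj (w l) / (1 + q))"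
      unfolding sum_distrib_left sum_distrib_right sum.distrib[symmetric] sum_subtractf[symmetric]
      by (intro sum.cong refl) (simp add: algebra_simps del: shifted_gram_index)
    also have "\<dots> = (if j = l then 1 else 0) - cnj (h i j) * (cnj (w l) / (1 + q)) + cnj (h i j) * cnj (w l)
        - cnj (h i j) * q * (cnj (w l) / (1 + q))"
      using jl by (simp only: resolvent_inverse_index[OF assms(1,2)] Bw hQ hw)
    also have "\<dots> = (if j = l then 1 else 0)"
    proof -
      define X where "X = cnj (w l) / (1 + q)"
      have e: "cnj (w l) = X * (1 + q)" using nz by (simp add: X_def)
      have "d - a * X + a * cnj (w l) - a * q * X = d" for d a :: complex
        unfolding e by (simp add: algebra_simps)
      then show ?thesis by (simp add: X_def)
    qed
    finally show "(shifted_gram m x (insert i T) h * R) $$ (j, l) = (1\<^sub>m m) $$ (j, l)" using jl by simp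
  qed (auto simp: R_def shifted_gram_def)
  then have "resolvent m x (insert i T) h = R"
    using assms(1,2) by (intro resolvent_unique) (auto simp: R_def)
  then show ?thesis using assms(4,5) by (simp add: R_def)
qed

text \<open>The trace drops by |w|^2 / (1 + q), and |w|^2 \<le> q / x, so the drop is at most 1 / x
  however large the row is. This uniformity makes bounded differences available for unbounded
  Gaussian entries.\<close>

lemma resolvent_trace_insert:
  assumes "finite T" "x > 0" "i \<notin> T"
  shows "resolvent_trace m x (insert i T) h \<le> resolvent_trace m x T h"
    and "resolvent_trace m x T h \<le> resolvent_trace m x (insert i T) h + 1 / x"
proof -
  define w where "w = apply_mat m (resolvent m x T h) (\<lambda>k. cnj (h i k))"
  define q where "q = Re (quad_form m (resolvent m x T h) (\<lambda>k. cnj (h i k)))"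
  note QT = quad_form_resolvent[OF assms(1,2), of m h "\<lambda>k. cnj (h i k)", folded w_def q_def]
  have "Re (resolvent m x (insert i T) h $$ (k, k)) =
     Re (resolvent m x T h $$ (k, k)) - (cmod (w k))\<^sup>2 / (1 + q)" if "k < m" for k
  proof -
    have eq: "w k * cnj (w k) / (1 + of_real q) = of_real ((cmod (w k))\<^sup>2 / (1 + q))"
      unfolding of_real_divide complex_norm_square by simp
    then show ?thesis
      unfolding resolvent_insert[OF assms that that] w_def[symmetric] QT(1) eq by simp
  qed
  then have eq: "resolvent_trace m x (insert i T) h = resolvent_trace m x T h - sq_norm m w / (1 + q)"
    by (simp add: resolvent_trace_def sq_norm_def sum_subtractf sum_divide_distrib)
  have "0 \<le> sq_norm m w / (1 + q)" using QT(3) sq_norm_nonneg by simp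
  then show "resolvent_trace m x (insert i T) h \<le> resolvent_trace m x T h" using eq by simp
  have "sq_norm m w \<le> q / x" using QT(2) assms(2) by (simp add: field_simps)
  also have "\<dots> \<le> (1 + q) / x" using assms(2) by (simp add: divide_right_mono)
  finally have "sq_norm m w / (1 + q) \<le> 1 / x" using QT(3) assms(2) by (simp add: field_simps)
  then show "resolvent_trace m x T h \<le> resolvent_trace m x (insert i T) h + 1 / x" using eq by simp
qed

text \<open>The rank-one correction evaluated at its own vector: q - q^2 / (1 + q). Row
  \<open>i\<close> is thereby separated from the resolvent it is paired with.\<close>

lemma quad_form_resolvent_insert:
  fixes h :: "nat \<Rightarrow> nat \<Rightarrow> complex" and m :: nat
  assumes "finite T" "x > 0" "i \<notin> T"
  defines "q \<equiv> Re (quad_form m (resolvent m x T h) (\<lambda>k. cnj (h i k)))"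
  shows "Re (quad_form m (resolvent m x (insert i T) h) (\<lambda>k. cnj (h i k))) = q / (1 + q)"
proof -
  define w where "w = apply_mat m (resolvent m x T h) (\<lambda>k. cnj (h i k))"
  let ?u = "\<lambda>k. cnj (h i k)"
  note QT = quad_form_resolvent[OF assms(1,2), of m h ?u, folded w_def q_def]
  have q1: "(\<Sum>k<m. h i k * w k) = of_real q"
    using QT(1) by (simp add: w_def quad_form_def)
  then have q2: "(\<Sum>k<m. cnj (w k) * ?u k) = of_real q"
    by (metis (no_types, lifting) cnj_sum complex_cnj_complex_of_real complex_cnj_mult mult.commute sum.cong)
  have ap: "apply_mat m (resolvent m x (insert i T) h) ?u j = w j - w j * of_real q / (1 + of_real q)"
    if "j < m" for j
  proof -
    have "apply_mat m (resolvent m x (insert i T) h) ?u j =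
        (\<Sum>k<m. resolvent m x T h $$ (j, k) * ?u k - w j * (cnj (w k) * ?u k) / (1 + of_real q))"
      unfolding apply_mat_def using that
      by (intro sum.cong refl) (simp add: resolvent_insert[OF assms(1-3)] QT(1) w_def[symmetric] algebra_simps)
    also have "\<dots> = w j - w j * (\<Sum>k<m. cnj (w k) * ?u k) / (1 + of_real q)"
      by (simp add: sum_subtractf w_def apply_mat_def sum_distrib_left sum_divide_distrib)
    finally show ?thesis unfolding q2 .
  qed
  have "quad_form m (resolvent m x (insert i T) h) ?u =
     (\<Sum>k<m. h i k * w k * (1 - of_real q / (1 + of_real q)))"
    unfolding quad_form_def by (intro sum.cong refl) (subst ap, auto simp: algebra_simps)
  also have "\<dots> = of_real (q * (1 - q / (1 + q)))"
    by (simp add: sum_distrib_right[symmetric] q1)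
  also have "q * (1 - q / (1 + q)) = q / (1 + q)" using QT(3) by (simp add: field_simps)
  finally show ?thesis by simp
qed

text \<open>The trace of (W + x) Q = 1, where the trace of W Q is rearranged cyclically into one
  quadratic form per row.\<close>

lemma sum_quad_form_resolvent:
  assumes "finite S" "x > 0"
  shows "(\<Sum>i\<in>S. Re (quad_form m (resolvent m x S h) (\<lambda>k. cnj (h i k)))) = m - x * resolvent_trace m x S h"
proof -
  let ?Q = "resolvent m x S h"
  have "of_nat m = (\<Sum>j<m. \<Sum>k<m. shifted_gram m x S h $$ (j, k) * ?Q $$ (k, j))"
    by (subst sum.cong[OF refl resolvent_inverse_index[OF assms]]) auto
  also have "\<dots> = (\<Sum>j<m. (\<Sum>k<m. (\<Sum>i\<in>S. cnj (h i j) * h i k) * ?Q $$ (k, j)) + of_real x * ?Q $$ (j, j))"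
  proof (intro sum.cong refl)
    fix j assume j: "j \<in> {..<m}"
    have "(\<Sum>k<m. shifted_gram m x S h $$ (j, k) * ?Q $$ (k, j)) =
       (\<Sum>k<m. (\<Sum>i\<in>S. cnj (h i j) * h i k) * ?Q $$ (k, j) + (if j = k then of_real x * ?Q $$ (k, j) else 0))"
      using j by (intro sum.cong refl) (auto simp: ring_distribs)
    also have "\<dots> = (\<Sum>k<m. (\<Sum>i\<in>S. cnj (h i j) * h i k) * ?Q $$ (k, j)) + of_real x * ?Q $$ (j, j)"
      using j by (simp add: sum.distrib)
    finally show "(\<Sum>k<m. shifted_gram m x S h $$ (j, k) * ?Q $$ (k, j)) = \<dots>" .
  qed
  also have "\<dots> = (\<Sum>j<m. \<Sum>k<m. \<Sum>i\<in>S. h i k * (?Q $$ (k, j) * cnj (h i j))) + of_real x * (\<Sum>j<m. ?Q $$ (j, j))"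
    by (simp add: sum.distrib sum_distrib_left sum_distrib_right mult_ac)
  also have "(\<Sum>j<m. \<Sum>k<m. \<Sum>i\<in>S. h i k * (?Q $$ (k, j) * cnj (h i j))) =
     (\<Sum>k<m. \<Sum>j<m. \<Sum>i\<in>S. h i k * (?Q $$ (k, j) * cnj (h i j)))"
    by (rule sum.swap)
  also have "\<dots> = (\<Sum>k<m. \<Sum>i\<in>S. \<Sum>j<m. h i k * (?Q $$ (k, j) * cnj (h i j)))"
    by (intro sum.cong refl sum.swap)
  also have "\<dots> = (\<Sum>i\<in>S. \<Sum>k<m. \<Sum>j<m. h i k * (?Q $$ (k, j) * cnj (h i j)))"
    by (rule sum.swap)
  also have "\<dots> = (\<Sum>i\<in>S. quad_form m ?Q (\<lambda>k. cnj (h i k)))"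
    by (simp add: quad_form_def apply_mat_def sum_distrib_left)
  finally have "Re (of_nat m) = Re ((\<Sum>i\<in>S. quad_form m ?Q (\<lambda>k. cnj (h i k))) + of_real x * (\<Sum>j<m. ?Q $$ (j, j)))"
    by simp
  then show ?thesis by (simp add: resolvent_trace_def)
qed

subsection \<open>Eigenvalues of the Gram matrix\<close>

lemma gram_eq_shifted_gram:
  fixes H :: "complex mat"
  assumes "H \<in> carrier_mat n m"
  shows "mat_adjoint H * H = shifted_gram m 0 {..<n} (\<lambda>i j. H $$ (i, j))"
proof (rule eq_matI)
  fix j k assume "j < dim_row (shifted_gram m 0 {..<n} (\<lambda>i j. H $$ (i, j)))"
    "k < dim_col (shifted_gram m 0 {..<n} (\<lambda>i j. H $$ (i, j)))"
  then have jk: "j < m" "k < m" by (simp_all add: shifted_gram_def)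
  have "mat_adjoint H $$ (j, i) = cnj (H $$ (i, j))" if "i < n" for i
    using assms jk that unfolding mat_adjoint_def
    by (subst mat_of_rows_index) (auto simp: conjugate_complex_def)
  then show "(mat_adjoint H * H) $$ (j, k) = shifted_gram m 0 {..<n} (\<lambda>i j. H $$ (i, j)) $$ (j, k)"
    using assms jk by (simp add: scalar_prod_def mat_adjoint_def lessThan_atLeast0)
qed (use assms in \<open>simp_all add: mat_adjoint_def shifted_gram_def\<close>)

lemma sum_diag_mult_commute:
  fixes X Y :: "complex mat"
  assumes "X \<in> carrier_mat m m" "Y \<in> carrier_mat m m"
  shows "(\<Sum>j<m. (X * Y) $$ (j, j)) = (\<Sum>j<m. (Y * X) $$ (j, j))"
proof -
  have "(\<Sum>j<m. (X * Y) $$ (j, j)) = (\<Sum>j<m. \<Sum>k<m. X $$ (j, k) * Y $$ (k, j))"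
    using assms by (intro sum.cong refl mult_mat_index) auto
  also have "\<dots> = (\<Sum>k<m. \<Sum>j<m. Y $$ (k, j) * X $$ (j, k))"
    by (subst sum.swap) (simp add: mult.commute)
  also have "\<dots> = (\<Sum>j<m. (Y * X) $$ (j, j))"
    using assms by (intro sum.cong refl mult_mat_index[symmetric]) auto
  finally show ?thesis .
qed

text \<open>Back substitution: column \<open>k\<close> of the inverse vanishes below the diagonal,
  by induction from the last row upwards. In row i the terms left of the diagonal vanish by
  triangularity and those right of it by induction, leaving a single product.\<close>

lemma diag_inverse_upper_triangular:
  fixes T R :: "complex mat"
  assumes T: "T \<in> carrier_mat m m" and R: "R \<in> carrier_mat m m" and TR: "T * R = 1\<^sub>m m"
    and tri: "\<And>i j. j < i \<Longrightarrow> i < m \<Longrightarrow> T $$ (i, j) = 0"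
    and nz: "\<And>i. i < m \<Longrightarrow> T $$ (i, i) \<noteq> 0"
    and k: "k < m"
  shows "R $$ (k, k) = 1 / T $$ (k, k)"
proof -
  have row: "(\<Sum>l<m. T $$ (i, l) * R $$ (l, k)) = (if i = k then 1 else 0)" if "i < m" for i
    using mult_mat_index[OF T R that k] TR that k by simp
  have z: "R $$ (i, k) = 0" if "k < i" "i < m" for i
    using that
  proof (induction "m - i" arbitrary: i rule: less_induct)
    case less
    have "(\<Sum>l<m. T $$ (i, l) * R $$ (l, k)) = (\<Sum>l\<in>{i}. T $$ (i, l) * R $$ (l, k))"
    proof (intro sum.mono_neutral_right ballI)
      fix l assume l: "l \<in> {..<m} - {i}"
      show "T $$ (i, l) * R $$ (l, k) = 0"
      proof (cases "l < i")
        case True then show ?thesis using tri less.prems by simp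
      next
        case False
        then have "R $$ (l, k) = 0" using l less.prems by (intro less.hyps) auto
        then show ?thesis by simp
      qed
    qed (use less.prems in auto)
    then show ?case using row[OF less.prems(2)] less.prems nz by auto
  qed
  have "(\<Sum>l<m. T $$ (k, l) * R $$ (l, k)) = (\<Sum>l\<in>{k}. T $$ (k, l) * R $$ (l, k))"
  proof (intro sum.mono_neutral_right ballI)
    fix l assume l: "l \<in> {..<m} - {k}"
    show "T $$ (k, l) * R $$ (l, k) = 0"
      using tri[of l k] z[of l] k l by (cases "l < k") auto
  qed (use k in auto)
  then show ?thesis using row[OF k] nz[OF k] by (simp add: field_simps)
qed

text \<open>An eigenvector inserted in the quadratic form gives e |v|^2 = |H v|^2, hence the sign.
  For the trace a Schur triangularisation is enough: only the diagonal of the inverse is needed, and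
  the trace is invariant under similarity.\<close>

lemma gram_eigenvalues_properties:
  fixes H :: "complex mat"
  assumes H: "H \<in> carrier_mat n m"
  shows "size (gram_eigenvalues H) = m"
    and "l \<in># gram_eigenvalues H \<Longrightarrow> l \<ge> 0"
    and "x > 0 \<Longrightarrow> (\<Sum>l\<in>#gram_eigenvalues H. 1 / (l + x)) = resolvent_trace m x {..<n} (\<lambda>i j. H $$ (i, j))"
proof -
  define h where "h = (\<lambda>i j. H $$ (i, j))"
  define W where "W = mat_adjoint H * H"
  have W_eq: "W = shifted_gram m 0 {..<n} h"
    unfolding W_def h_def by (rule gram_eq_shifted_gram[OF H])
  have Wc: "W \<in> carrier_mat m m" unfolding W_eq by simp
  obtain es where es: "char_poly W = (\<Prod>a\<leftarrow>es. [:- a, 1:])" "length es = m"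
    using char_poly_factorized[OF Wc] by blast
  have "proots (\<Prod>a\<leftarrow>es. [:- a, 1:]) = mset es"
  proof (induction es)
    case (Cons a es)
    have "(\<Prod>a\<leftarrow>es. [:- a, 1:]) \<noteq> (0 :: complex poly)" by (auto simp: prod_list_zero_iff)
    then show ?case using Cons by (simp add: proots_mult del: mult_pCons_left)
  qed simp
  then have ge: "gram_eigenvalues H = image_mset Re (mset es)"
    unfolding gram_eigenvalues_def W_def[symmetric] es(1) by simp
  then show "size (gram_eigenvalues H) = m" using es(2) by simp
  have ev: "Im e = 0 \<and> Re e \<ge> 0" if "e \<in> set es" for e
  proof -
    have "poly (char_poly W) e = 0" unfolding es(1) using that
      by (auto simp: poly_prod_list prod_list_zero_iff)
    then obtain v where v: "v \<in> carrier_vec m" "v \<noteq> 0\<^sub>v m" "W *\<^sub>v v = e \<cdot>\<^sub>v v"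
      using eigenvalue_root_char_poly[OF Wc] Wc unfolding eigenvalue_def eigenvector_def by auto
    have vv: "Matrix.vec m (\<lambda>k. v $ k) = v" using v by auto
    have ap: "apply_mat m W (\<lambda>k. v $ k) j = e * v $ j" if "j < m" for j
      using that v vv by (subst apply_mat_eq_mult_mat_vec[OF Wc]) auto
    have "quad_form m W (\<lambda>k. v $ k) = e * of_real (sq_norm m (\<lambda>k. v $ k))"
      unfolding quad_form_def sq_norm_cnj sum_distrib_left
      by (intro sum.cong refl) (subst ap, auto)
    then have eq: "e * of_real (sq_norm m (\<lambda>k. v $ k)) =
        of_real (\<Sum>i<n. (cmod (\<Sum>k<m. h i k * v $ k))\<^sup>2)"
      unfolding W_eq quad_form_shifted_gram[OF finite_lessThan] by simp
    have "sq_norm m (\<lambda>k. v $ k) \<noteq> 0"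
    proof
      assume "sq_norm m (\<lambda>k. v $ k) = 0"
      then have "\<forall>k<m. v $ k = 0"
        unfolding sq_norm_def by (subst (asm) sum_nonneg_eq_0_iff) auto
      then show False using v by (auto intro: eq_vecI)
    qed
    then have pos: "sq_norm m (\<lambda>k. v $ k) > 0" using sq_norm_nonneg[of m "\<lambda>k. v $ k"] by linarith
    define r where "r = (\<Sum>i<n. (cmod (\<Sum>k<m. h i k * v $ k))\<^sup>2)"
    have r: "r \<ge> 0" by (simp add: r_def sum_nonneg)
    have "e * of_real (sq_norm m (\<lambda>k. v $ k)) = of_real r" using eq unfolding r_def .
    then have "e = of_real (r / sq_norm m (\<lambda>k. v $ k))"
      using pos by (simp add: eq_divide_eq)
    then show ?thesis using r pos by simp
  qed
  show "l \<in># gram_eigenvalues H \<Longrightarrow> l \<ge> 0" using ev unfolding ge by auto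
  assume x: "x > 0"
  obtain B P Q where BPQ: "schur_decomposition W es = (B, P, Q)"
    by (cases "schur_decomposition W es") auto
  note sd = schur_decomposition[OF Wc es(1) BPQ]
  have diag: "diag_mat B = es" and tri: "upper_triangular B" using sd by auto
  note sim = similar_mat_witD2[OF Wc conjunct1[OF sd]]
  define Z where "Z = resolvent m x {..<n} h"
  define S where "S = shifted_gram m x {..<n} h"
  have Zc: "Z \<in> carrier_mat m m" and Sc: "S \<in> carrier_mat m m" by (simp_all add: Z_def S_def)
  note Bc = sim(5) and Pc = sim(6) and Qc = sim(7)
  define xI where "xI = of_real x \<cdot>\<^sub>m (1\<^sub>m m :: complex mat)"
  have xIc: "xI \<in> carrier_mat m m" by (simp add: xI_def)
  have S_eq: "S = W + xI"
    unfolding S_def W_eq xI_def by (intro eq_matI) (auto simp: shifted_gram_def)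
  define T where "T = B + xI"
  have Tc: "T \<in> carrier_mat m m" using Bc xIc by (simp add: T_def)
  \<comment> \<open>\<open>Q\<close> intertwines the shifted Gram matrix with its triangular form;
    hence \<open>Q * (Z * P)\<close> below is the inverse of \<open>T\<close>.\<close>
  have "Q * S = T * Q"
  proof -
    have "Q * W = Q * (P * B * Q)" using sim(3) by simp
    also have "\<dots> = Q * (P * (B * Q))" using Pc Bc Qc by (simp add: assoc_mult_mat[of _ m m _ m _ m])
    also have "\<dots> = (Q * P) * (B * Q)" using Pc Bc Qc by (subst assoc_mult_mat[of _ m m _ m _ m]) auto
    also have "\<dots> = B * Q" unfolding sim(2) using Bc Qc by simp
    finally have 1: "Q * W = B * Q" .
    have 2: "Q * xI = xI * Q" unfolding xI_def
      using Qc by (simp add: mult_smult_distrib[of _ m m _ m] mult_smult_assoc_mat[of _ m m _ m])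
    show ?thesis unfolding S_eq T_def
      using 1 2 Qc Wc xIc Bc by (simp add: mult_add_distrib_mat[of _ m m _ m] add_mult_distrib_mat[of _ m m _ _ m])
  qed
  note QS = this
  define R where "R = Q * (Z * P)"
  have Rc: "R \<in> carrier_mat m m" using Qc Zc Pc by (simp add: R_def)
  have "T * R = (T * Q) * (Z * P)" unfolding R_def
    using Tc Qc Zc Pc by (subst assoc_mult_mat[of _ m m _ m _ m]) auto
  also have "\<dots> = Q * (S * (Z * P))" unfolding QS[symmetric]
    using Sc Qc Zc Pc by (subst assoc_mult_mat[of _ m m _ m _ m]) auto
  also have "S * (Z * P) = (S * Z) * P"
    using Sc Zc Pc by (subst assoc_mult_mat[of _ m m _ m _ m]) auto
  also have "S * Z = 1\<^sub>m m" unfolding S_def Z_def using x by (intro resolvent_inverse) auto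
  also have "Q * (1\<^sub>m m * P) = 1\<^sub>m m" using Pc sim(2) by simp
  finally have TR: "T * R = 1\<^sub>m m" .
  have B_diag: "B $$ (k, k) = es ! k" if "k < m" for k
    using diag that Bc unfolding diag_mat_def by (auto simp: list_eq_iff_nth_eq)
  have T_diag: "T $$ (k, k) = of_real (Re (es ! k) + x)" if "k < m" for k
    using that Bc xIc B_diag ev[of "es ! k"] es(2) by (auto simp: T_def xI_def complex_eq_iff)
  have R_diag: "R $$ (k, k) = of_real (1 / (Re (es ! k) + x))" if "k < m" for k
  proof -
    have "R $$ (k, k) = 1 / T $$ (k, k)"
    proof (rule diag_inverse_upper_triangular[OF Tc Rc TR _ _ that])
      show "T $$ (i, j) = 0" if "j < i" "i < m" for i j
        using that upper_triangularD[OF tri that(1)] Bc by (simp add: T_def xI_def)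
      show "T $$ (i, i) \<noteq> 0" if "i < m" for i
      proof -
        have "Re (es ! i) + x > 0" using ev[of "es ! i"] es(2) that x by (simp add: add_nonneg_pos)
        then show ?thesis unfolding T_diag[OF that] by (metis less_irrefl of_real_eq_0_iff)
      qed
    qed
    then show ?thesis by (simp add: T_diag[OF that])
  qed
  have "(\<Sum>k<m. Z $$ (k, k)) = (\<Sum>k<m. ((Z * P) * Q) $$ (k, k))"
  proof -
    have "(Z * P) * Q = Z" using Zc Pc Qc sim(1) by (subst assoc_mult_mat[of _ m m _ m _ m]) auto
    then show ?thesis by simp
  qed
  also have "\<dots> = (\<Sum>k<m. R $$ (k, k))" unfolding R_def
    using Zc Pc Qc by (intro sum_diag_mult_commute) auto
  also have "\<dots> = of_real (\<Sum>k<m. 1 / (Re (es ! k) + x))"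
    unfolding of_real_sum by (intro sum.cong refl R_diag) auto
  finally have "Re (\<Sum>k<m. Z $$ (k, k)) = (\<Sum>k<m. 1 / (Re (es ! k) + x))" by simp
  then have "resolvent_trace m x {..<n} h = (\<Sum>k<m. 1 / (Re (es ! k) + x))"
    by (simp add: resolvent_trace_def Z_def)
  also have "\<dots> = (\<Sum>l\<leftarrow>es. 1 / (Re l + x))"
    using es(2) by (simp add: sum_list_sum_nth lessThan_atLeast0)
  also have "\<dots> = (\<Sum>l\<in>#gram_eigenvalues H. 1 / (l + x))"
    unfolding ge by (simp add: image_mset.compositionality comp_def sum_mset_sum_list flip: mset_map)
  finally show "(\<Sum>l\<in>#gram_eigenvalues H. 1 / (l + x)) = resolvent_trace m x {..<n} (\<lambda>i j. H $$ (i, j))"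
    by (simp add: h_def)
qed

subsection \<open>Convergence of means from convergence of Stieltjes transforms\<close>

definition bcont :: "(real \<Rightarrow> real) set" where
  "bcont = {f. continuous_on {0..} f \<and> bounded (f ` {0..})}"

text \<open>What empirical spectral averages and the limit law have in common: linearity and
  contraction for the supremum norm. Uniform approximation then transfers convergence, with no
  measures to construct. The norm sees only arguments \<ge> 0, where eigenvalues lie.\<close>

definition mean_functional :: "((real \<Rightarrow> real) \<Rightarrow> real) \<Rightarrow> bool" where
  "mean_functional \<Lambda> \<longleftrightarrow>
     (\<forall>f\<in>bcont. \<forall>g\<in>bcont. \<Lambda> (\<lambda>x. f x + g x) = \<Lambda> f + \<Lambda> g) \<and>
     (\<forall>f\<in>bcont. \<forall>c. \<Lambda> (\<lambda>x. c * f x) = c * \<Lambda> f) \<and>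
     (\<forall>f\<in>bcont. \<forall>e. (\<forall>x\<ge>0. \<bar>f x\<bar> \<le> e) \<longrightarrow> \<bar>\<Lambda> f\<bar> \<le> e)"

lemma mean_functionalD:
  assumes "mean_functional \<Lambda>" "f \<in> bcont"
  shows "g \<in> bcont \<Longrightarrow> \<Lambda> (\<lambda>x. f x + g x) = \<Lambda> f + \<Lambda> g"
    and "\<Lambda> (\<lambda>x. c * f x) = c * \<Lambda> f"
    and "(\<And>x. x \<ge> 0 \<Longrightarrow> \<bar>f x\<bar> \<le> e) \<Longrightarrow> \<bar>\<Lambda> f\<bar> \<le> e"
  using assms by (simp_all add: mean_functional_def)

lemma bcont_add: "f \<in> bcont \<Longrightarrow> g \<in> bcont \<Longrightarrow> (\<lambda>x. f x + g x) \<in> bcont"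
  unfolding bcont_def by (auto intro!: continuous_intros bounded_plus_comp)

lemma bcont_cmult: "f \<in> bcont \<Longrightarrow> (\<lambda>x. c * f x) \<in> bcont"
  unfolding bcont_def using bounded_scaling[of "f ` {0..}" c]
  by (auto intro!: continuous_intros simp: image_image)

lemma bcontI:
  assumes "continuous_on {0..} f" "\<And>x. x \<ge> 0 \<Longrightarrow> \<bar>f x\<bar> \<le> c"
  shows "f \<in> bcont"
  unfolding bcont_def using assms by (auto intro!: boundedI[of _ c])

text \<open>The map l \<mapsto> 1 / (1 + l) sends [0, \<infinity>) into the compact [0, 1], whose
  point 0 stands for l = \<infinity>; boundedness comes from there.\<close>

lemma bcont_comp_inverse:
  assumes "continuous_on {0..1} \<psi>"
  shows "(\<lambda>l. \<psi> (1 / (1 + l))) \<in> bcont"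
proof -
  have sub: "(\<lambda>l::real. 1 / (1 + l)) ` {0..} \<subseteq> {0..1}" by auto
  have "compact (\<psi> ` {0..1})" using assms by (intro compact_continuous_image) auto
  then have "bounded (\<psi> ` {0..1})" by (rule compact_imp_bounded)
  then have "bounded ((\<lambda>l. \<psi> (1 / (1 + l))) ` {0..})"
    by (rule bounded_subset) (use sub in \<open>auto simp: image_iff\<close>)
  moreover have "continuous_on {0..} (\<lambda>l. \<psi> (1 / (1 + l)))"
    using sub by (intro continuous_on_compose2[OF assms] continuous_intros) auto
  ultimately show ?thesis by (simp add: bcont_def)
qed

definition means_converge :: "(nat \<Rightarrow> (real \<Rightarrow> real) \<Rightarrow> real) \<Rightarrow> ((real \<Rightarrow> real) \<Rightarrow> real) \<Rightarrow> (real \<Rightarrow> real) \<Rightarrow> bool" where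
  "means_converge \<Lambda>s \<Lambda> f \<longleftrightarrow> f \<in> bcont \<and> (\<lambda>k. \<Lambda>s k f) \<longlonglongrightarrow> \<Lambda> f"

context
  fixes \<Lambda>s :: "nat \<Rightarrow> (real \<Rightarrow> real) \<Rightarrow> real" and \<Lambda> :: "(real \<Rightarrow> real) \<Rightarrow> real"
  assumes mf: "\<And>k. mean_functional (\<Lambda>s k)" "mean_functional \<Lambda>"
begin

lemma means_converge_add: "means_converge \<Lambda>s \<Lambda> f \<Longrightarrow> means_converge \<Lambda>s \<Lambda> g \<Longrightarrow> means_converge \<Lambda>s \<Lambda> (\<lambda>x. f x + g x)"
  using mf unfolding means_converge_def mean_functional_def by (auto intro!: bcont_add tendsto_add)

lemma means_converge_cmult: "means_converge \<Lambda>s \<Lambda> f \<Longrightarrow> means_converge \<Lambda>s \<Lambda> (\<lambda>x. c * f x)"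
  using mf unfolding means_converge_def mean_functional_def by (auto intro!: bcont_cmult tendsto_mult_left)

lemma means_converge_0: "means_converge \<Lambda>s \<Lambda> (\<lambda>_. 0)"
proof -
  have "(\<lambda>_. 0) \<in> bcont" by (rule bcontI[of _ 0]) auto
  moreover have "M (\<lambda>_. 0) = 0" if "mean_functional M" for M
  proof -
    have "\<bar>M (\<lambda>_. 0)\<bar> \<le> 0" by (rule mean_functionalD(3)[OF that calculation]) simp
    then show ?thesis by simp
  qed
  ultimately have "\<Lambda>s k (\<lambda>_. 0) = 0" "\<Lambda> (\<lambda>_. 0) = 0" for k using mf by blast+
  then show ?thesis using \<open>(\<lambda>_. 0) \<in> bcont\<close> by (simp add: means_converge_def)
qed

lemma means_converge_sum: "finite A \<Longrightarrow> (\<And>i. i \<in> A \<Longrightarrow> means_converge \<Lambda>s \<Lambda> (f i)) \<Longrightarrow> means_converge \<Lambda>s \<Lambda> (\<lambda>x. \<Sum>i\<in>A. f i x)"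
  by (induction A rule: finite_induct) (auto intro!: means_converge_0 means_converge_add)

text \<open>Contraction bounds the error of replacing \<open>f\<close> by \<open>g\<close> uniformly
  in the index, so the two replacements and the convergence for \<open>g\<close> add up to less than
  r.\<close>

lemma means_converge_limit:
  assumes f: "f \<in> bcont"
    and ap: "\<And>e. e > 0 \<Longrightarrow> \<exists>g. means_converge \<Lambda>s \<Lambda> g \<and> (\<forall>x\<ge>0. \<bar>f x - g x\<bar> \<le> e)"
  shows "means_converge \<Lambda>s \<Lambda> f"
  unfolding means_converge_def
proof
  show "(\<lambda>k. \<Lambda>s k f) \<longlonglongrightarrow> \<Lambda> f"
  proof (rule LIMSEQ_I)
    fix r :: real assume r: "r > 0"
    obtain g where g: "means_converge \<Lambda>s \<Lambda> g" "\<And>x. x \<ge> 0 \<Longrightarrow> \<bar>f x - g x\<bar> \<le> r / 4"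
      using ap[of "r / 4"] r by auto
    have gb: "g \<in> bcont" using g(1) by (simp add: means_converge_def)
    have diff: "\<bar>M f - M g\<bar> \<le> r / 4" if "mean_functional M" for M
    proof -
      define g' where "g' = (\<lambda>x. (-1) * g x)"
      have g': "g' \<in> bcont" unfolding g'_def by (rule bcont_cmult[OF gb])
      have "M (\<lambda>x. f x + g' x) = M f + M g'"
        by (rule mean_functionalD(1)[OF that f g'])
      also have "M g' = (-1) * M g"
        unfolding g'_def by (rule mean_functionalD(2)[OF that gb])
      finally have "M (\<lambda>x. f x + g' x) = M f - M g" by simp
      moreover have "\<bar>M (\<lambda>x. f x + g' x)\<bar> \<le> r / 4"
        using g(2) by (intro mean_functionalD(3)[OF that] bcont_add f g') (simp add: g'_def)
      ultimately show ?thesis by simp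
    qed
    obtain N where N: "\<And>k. k \<ge> N \<Longrightarrow> \<bar>\<Lambda>s k g - \<Lambda> g\<bar> < r / 4"
      using g(1) r LIMSEQ_D[of "\<lambda>k. \<Lambda>s k g" "\<Lambda> g" "r / 4"] unfolding means_converge_def by auto
    show "\<exists>no. \<forall>n\<ge>no. norm (\<Lambda>s n f - \<Lambda> f) < r"
    proof (intro exI allI impI)
      fix k assume "k \<ge> N"
      then show "norm (\<Lambda>s k f - \<Lambda> f) < r"
        unfolding real_norm_def using N[of k] diff[OF mf(1), of k] diff[OF mf(2)] r by linarith
    qed
  qed
qed (rule f)

text \<open>A finite geometric sum whose remainder isolates the next power of t up to the factor 1 /
  (1 + h t), which is close to 1 for small h.\<close>

lemma geometric_remainder:
  fixes h t :: real
  assumes "1 + h * t \<noteq> 0"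
  shows "t / (1 + h * t) = (\<Sum>j<k. (- h) ^ j * t ^ Suc j) + (- h) ^ k * t ^ Suc k / (1 + h * t)"
proof (induction k)
  case (Suc k)
  have "(- h) ^ k * t ^ Suc k / (1 + h * t) =
      (- h) ^ k * t ^ Suc k + (- h) ^ Suc k * t ^ Suc (Suc k) / (1 + h * t)"
    using assms by (simp add: field_simps)
  then show ?case using Suc by simp
qed simp

text \<open>For t = 1 / (1 + l) and h = 1 / (j + 1), the resolvent function at 1 + h is t / (1 + h
  t). Subtracting the lower powers, settled by induction, and rescaling by a power of -1 / h leaves
  t^k / (1 + h t), within h of t^k uniformly in l. Since h is fixed before the sequence index grows,
  dividing by its powers is harmless.\<close>

lemma means_converge_power:
  assumes one: "means_converge \<Lambda>s \<Lambda> (\<lambda>_. 1)"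
    and res: "\<And>j::nat. means_converge \<Lambda>s \<Lambda> (\<lambda>l. 1 / (l + (1 + 1 / (real j + 1))))"
  shows "means_converge \<Lambda>s \<Lambda> (\<lambda>l. (1 / (1 + l)) ^ k)"
proof (induction k rule: less_induct)
  case (less k)
  show ?case
  proof (cases k)
    case 0 then show ?thesis using one by simp
  next
    case (Suc k')
    show ?thesis
    proof (rule means_converge_limit)
      show "(\<lambda>l. (1 / (1 + l)) ^ k) \<in> bcont"
        by (rule bcont_comp_inverse[of "\<lambda>t. t ^ k"]) (intro continuous_intros)
      fix e :: real assume e: "e > 0"
      obtain j :: nat where j: "1 / e < real j" using reals_Archimedean2 by blast
      define h where "h = 1 / (real j + 1)"
      have h: "h > 0" by (simp add: h_def)
      have he: "h \<le> e" using j e by (simp add: h_def field_simps)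
      define g where "g = (\<lambda>l. (- 1 / h) ^ k' *
          (1 / (l + (1 + 1 / (real j + 1))) + (-1) * (\<Sum>i<k'. (- h) ^ i * (1 / (1 + l)) ^ Suc i)))"
      have "means_converge \<Lambda>s \<Lambda> g" unfolding g_def
      proof (intro means_converge_cmult means_converge_add res means_converge_sum)
        show "means_converge \<Lambda>s \<Lambda> (\<lambda>l. (1 / (1 + l)) ^ Suc i)" if "i \<in> {..<k'}" for i
          using that Suc by (intro less) auto
      qed auto
      moreover have "\<bar>(1 / (1 + l)) ^ k - g l\<bar> \<le> e" if l: "l \<ge> 0" for l
      proof -
        define t where "t = 1 / (1 + l)"
        have t: "0 < t" "t \<le> 1" using l by (auto simp: t_def)
        have ht: "1 + h * t > 0" using h t by (simp add: add_pos_pos)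
        have "1 / (l + (1 + 1 / (real j + 1))) = t / (1 + h * t)"
        proof -
          have "1 + h * t = (l + (1 + h)) * t" using l by (simp add: t_def field_simps)
          moreover have "l + (1 + h) > 0" using l h by simp
          ultimately show ?thesis using t unfolding h_def[symmetric] by simp
        qed
        then have "g l = (- 1 / h) ^ k' * ((- h) ^ k' * t ^ Suc k' / (1 + h * t))"
          unfolding g_def t_def[symmetric] using geometric_remainder[of h t k'] ht by simp
        also have "\<dots> = ((- 1 / h) * (- h)) ^ k' * (t ^ Suc k' / (1 + h * t))"
          unfolding power_mult_distrib by simp
        also have "(- 1 / h) * (- h) = 1" using h by simp
        finally have gl: "g l = t ^ k / (1 + h * t)" using Suc by simp
        have "t ^ k - g l = t ^ k * (h * t / (1 + h * t))"
          unfolding gl using ht by (simp add: field_simps)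
        moreover have "0 \<le> t ^ k" "t ^ k \<le> 1" using t by (auto simp: power_le_one)
        moreover have "0 \<le> h * t / (1 + h * t)" using h t ht by simp
        moreover have "h * t / (1 + h * t) \<le> h"
        proof -
          have "h * t \<le> h * 1" using h t by (intro mult_left_mono) auto
          also have "h * 1 \<le> h * (1 + h * t)" using h t by (intro mult_left_mono) auto
          finally show ?thesis using ht by (simp add: pos_divide_le_eq)
        qed
        ultimately have "\<bar>t ^ k - g l\<bar> \<le> 1 * h"
          by (simp only: abs_mult abs_of_nonneg) (intro mult_mono, auto)
        then show ?thesis using he by (simp add: t_def)
      qed
      ultimately show "\<exists>g. means_converge \<Lambda>s \<Lambda> g \<and> (\<forall>l\<ge>0. \<bar>(1 / (1 + l)) ^ k - g l\<bar> \<le> e)" by blast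
    qed
  qed
qed

lemma means_converge_comp_inverse:
  assumes "means_converge \<Lambda>s \<Lambda> (\<lambda>_. 1)"
    and "\<And>j::nat. means_converge \<Lambda>s \<Lambda> (\<lambda>l. 1 / (l + (1 + 1 / (real j + 1))))"
    and \<psi>: "continuous_on {0..1} \<psi>"
  shows "means_converge \<Lambda>s \<Lambda> (\<lambda>l. \<psi> (1 / (1 + l)))"
proof (rule means_converge_limit)
  fix e :: real assume "e > 0"
  then obtain p where p: "real_polynomial_function p" "\<And>t. t \<in> {0..1} \<Longrightarrow> \<bar>\<psi> t - p t\<bar> < e"
    using Stone_Weierstrass_real_polynomial_function[OF _ \<psi>, of e] by auto
  obtain a n where an: "p = (\<lambda>t. \<Sum>i\<le>n. a i * t ^ i)"
    using p(1) unfolding real_polynomial_function_iff_sum by auto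
  have "means_converge \<Lambda>s \<Lambda> (\<lambda>l. \<Sum>i\<le>n. a i * (1 / (1 + l)) ^ i)"
    by (intro means_converge_sum means_converge_cmult means_converge_power assms) auto
  moreover have "\<forall>l\<ge>0. \<bar>\<psi> (1 / (1 + l)) - (\<Sum>i\<le>n. a i * (1 / (1 + l)) ^ i)\<bar> \<le> e"
  proof (intro allI impI)
    fix l :: real assume "l \<ge> 0"
    then have "1 / (1 + l) \<in> {0..1}" by simp
    from p(2)[OF this] show "\<bar>\<psi> (1 / (1 + l)) - (\<Sum>i\<le>n. a i * (1 / (1 + l)) ^ i)\<bar> \<le> e"
      unfolding an by simp
  qed
  ultimately show "\<exists>g. means_converge \<Lambda>s \<Lambda> g \<and> (\<forall>l\<ge>0. \<bar>\<psi> (1 / (1 + l)) - g l\<bar> \<le> e)" by blast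
qed (rule bcont_comp_inverse[OF \<psi>])

end

subsection \<open>The Marchenko--Pastur law\<close>

text \<open>With R^2 = (u - A) (B - u), the integrand R / u = R^2 / (u R) splits into (A + B - 2 u)
  / (2 R), (A + B) / (2 R) and - A B / (u R). The first integrates to R, the others to arcsines of
  an affine and a fractional linear function of u. For A = 0 the last term is zero by its factor
  \<open>sqrt (A * B)\<close>.\<close>

lemma has_real_derivative_sqrt_primitive:
  fixes A B u :: real
  assumes A: "0 \<le> A" and u: "A < u" "u < B"
  defines "R \<equiv> sqrt ((u - A) * (B - u))"
  shows "((\<lambda>u. sqrt ((u - A) * (B - u)) + (A + B) / 2 * arcsin ((2 * u - A - B) / (B - A))
            - sqrt (A * B) * arcsin (((A + B) * u - 2 * A * B) / (u * (B - A))))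
          has_real_derivative (sqrt ((u - A) * (B - u)) / u)) (at u)"
proof -
  define D where "D = B - A"
  have D: "D > 0" using u by (simp add: D_def)
  have u0: "u > 0" using A u by simp
  have pos: "(u - A) * (B - u) > 0" using u by simp
  have R: "R > 0" "R\<^sup>2 = (u - A) * (B - u)" using pos by (simp_all add: R_def)
  have d1: "((\<lambda>u. sqrt ((u - A) * (B - u))) has_real_derivative (A + B - 2 * u) / (2 * R)) (at u)"
    using pos by (auto intro!: derivative_eq_intros simp: R_def field_simps)
  define y where "y = (2 * u - A - B) / D"
  have y: "1 - y\<^sup>2 = (2 * R / D)\<^sup>2"
    unfolding y_def power_divide power_mult_distrib R(2) using D
    by (simp add: field_simps) (simp add: D_def power2_eq_square algebra_simps)
  have y1: "\<bar>y\<bar> < 1"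
  proof -
    have "(2 * R / D)\<^sup>2 > 0" using R D by (intro zero_less_power divide_pos_pos) auto
    then have "y\<^sup>2 < 1" using y by linarith
    then show ?thesis by (simp only: abs_square_less_1)
  qed
  have sy: "sqrt (1 - y\<^sup>2) = 2 * R / D" unfolding y using R D by simp
  have d2: "((\<lambda>u. arcsin ((2 * u - A - B) / (B - A))) has_real_derivative 1 / R) (at u)"
  proof -
    have "((\<lambda>u. (2 * u - A - B) / (B - A)) has_real_derivative 2 / D) (at u)"
      unfolding D_def by (rule DERIV_cdivide) (auto intro!: derivative_eq_intros)
    moreover have "DERIV arcsin ((2 * u - A - B) / (B - A)) :> inverse (sqrt (1 - y\<^sup>2))"
      using DERIV_arcsin[of y] y1 unfolding abs_less_iff minus_less_iff[of y] by (simp only: y_def D_def)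
    ultimately have "((\<lambda>u. arcsin ((2 * u - A - B) / (B - A))) has_real_derivative
        inverse (sqrt (1 - y\<^sup>2)) * (2 / D)) (at u)"
      by (rule DERIV_chain2[rotated])
    then show ?thesis unfolding sy using R D by simp
  qed
  have d3: "((\<lambda>u. sqrt (A * B) * arcsin (((A + B) * u - 2 * A * B) / (u * (B - A))))
      has_real_derivative A * B / (u * R)) (at u)"
  proof (cases "A = 0")
    case False
    then have A0: "A > 0" using A by simp
    have AB: "A * B > 0" using A0 u by simp
    define s where "s = sqrt (A * B)"
    have s: "s > 0" "s\<^sup>2 = A * B" using AB by (simp_all add: s_def)
    define z where "z = ((A + B) * u - 2 * A * B) / (u * D)"
    have z: "1 - z\<^sup>2 = (2 * s * R / (u * D))\<^sup>2"
      unfolding z_def power_divide power_mult_distrib R(2) s(2) using D u0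
      by (simp add: field_simps) (simp add: D_def power2_eq_square algebra_simps)
    have z1: "\<bar>z\<bar> < 1"
    proof -
      have "(2 * s * R / (u * D))\<^sup>2 > 0" using R D s u0 by (intro zero_less_power divide_pos_pos) auto
      then have "z\<^sup>2 < 1" using z by linarith
      then show ?thesis by (simp only: abs_square_less_1)
    qed
    have sz: "sqrt (1 - z\<^sup>2) = 2 * s * R / (u * D)" unfolding z using R D s u0 by simp
    have "((\<lambda>u. ((A + B) * u - 2 * A * B) / (u * (B - A))) has_real_derivative 2 * A * B / (u\<^sup>2 * D)) (at u)"
    proof -
      have "((\<lambda>u. ((A + B) * u - 2 * A * B) / (u * (B - A))) has_real_derivative
          ((A + B) * (u * D) - ((A + B) * u - 2 * A * B) * D) / ((u * D) * (u * D))) (at u)"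
        unfolding D_def using D u0
        by (intro DERIV_divide) (auto intro!: derivative_eq_intros simp: D_def)
      moreover have "(A + B) * (u * D) - ((A + B) * u - 2 * A * B) * D = 2 * A * B * D"
        by (simp add: algebra_simps)
      moreover have "2 * A * B * D / ((u * D) * (u * D)) = 2 * A * B / (u\<^sup>2 * D)"
        using D u0 by (simp add: field_simps power2_eq_square)
      ultimately show ?thesis by simp
    qed
    moreover have "DERIV arcsin (((A + B) * u - 2 * A * B) / (u * (B - A))) :> inverse (sqrt (1 - z\<^sup>2))"
      using DERIV_arcsin[of z] z1 unfolding abs_less_iff minus_less_iff[of z] by (simp only: z_def D_def)
    ultimately have "((\<lambda>u. arcsin (((A + B) * u - 2 * A * B) / (u * (B - A)))) has_real_derivative
        inverse (sqrt (1 - z\<^sup>2)) * (2 * A * B / (u\<^sup>2 * D))) (at u)"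
      by (rule DERIV_chain2[rotated])
    then have "((\<lambda>u. sqrt (A * B) * arcsin (((A + B) * u - 2 * A * B) / (u * (B - A)))) has_real_derivative
        sqrt (A * B) * (inverse (sqrt (1 - z\<^sup>2)) * (2 * A * B / (u\<^sup>2 * D)))) (at u)"
      by (rule DERIV_cmult)
    moreover have "sqrt (A * B) * (inverse (sqrt (1 - z\<^sup>2)) * (2 * A * B / (u\<^sup>2 * D))) = A * B / (u * R)"
      unfolding sz s_def[symmetric] using s R D u0 by (simp add: field_simps power2_eq_square)
    ultimately show ?thesis by simp
  qed simp
  have "(A + B - 2 * u) / (2 * R) + (A + B) / 2 * (1 / R) - A * B / (u * R) = R\<^sup>2 / (u * R)"
    unfolding R(2) using R(1) u0 by (simp add: field_simps)
  also have "\<dots> = R / u" using R(1) by (simp add: power2_eq_square)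
  finally have eq: "(A + B - 2 * u) / (2 * R) + (A + B) / 2 * (1 / R) - A * B / (u * R) = R / u" .
  show ?thesis
    unfolding R_def[symmetric] eq[symmetric]
    by (intro DERIV_diff DERIV_add DERIV_cmult d1 d2 d3)
qed

text \<open>For a = x = 0 the integrand blows up like l^(-1/2) at the left edge. The fundamental
  theorem is therefore applied on the open interval in its nonnegative form, which gives
  integrability as well; the primitive extends continuously to the edges, where both arcsine
  arguments are -1 and 1 (for A = 0 the second arcsine has coefficient 0).\<close>

lemma integral_sqrt_quadratic_over_shifted:
  fixes a b x :: real
  assumes a: "0 \<le> a" "a < b" and x: "0 \<le> x"
  shows "set_integrable lborel {a..b} (\<lambda>l. sqrt ((l - a) * (b - l)) / (l + x))"
    and "(LBINT l:{a..b}. sqrt ((l - a) * (b - l)) / (l + x)) =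
       pi * ((a + b) / 2 + x - sqrt ((a + x) * (b + x)))"
proof -
  define A where "A = a + x"
  define B where "B = b + x"
  have A: "0 \<le> A" "A < B" using a x by (auto simp: A_def B_def)
  define F where "F = (\<lambda>u. sqrt ((u - A) * (B - u)) + (A + B) / 2 * arcsin ((2 * u - A - B) / (B - A))
            - sqrt (A * B) * arcsin (((A + B) * u - 2 * A * B) / (u * (B - A))))"
  let ?f = "\<lambda>l. sqrt ((l - a) * (b - l)) / (l + x)"
  have cont_F: "continuous_on {A..B} F"
  proof -
    have c1: "continuous_on {A..B} (\<lambda>u. sqrt (A * B) * arcsin (((A + B) * u - 2 * A * B) / (u * (B - A))))"
    proof (cases "A = 0")
      case False
      then have A0: "A > 0" using A by simp
      have "-1 \<le> ((A + B) * u - 2 * A * B) / (u * (B - A)) \<and> ((A + B) * u - 2 * A * B) / (u * (B - A)) \<le> 1"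
        if u: "u \<in> {A..B}" for u
      proof
        have p: "u * (B - A) > 0" using u A0 A by auto
        have "A * B \<le> u * B" "A * u \<le> A * B" using u A0 A by (auto intro: mult_right_mono mult_left_mono)
        then show "-1 \<le> ((A + B) * u - 2 * A * B) / (u * (B - A))"
          "((A + B) * u - 2 * A * B) / (u * (B - A)) \<le> 1"
          using p by (auto simp: pos_le_divide_eq pos_divide_le_eq algebra_simps)
      qed
      then show ?thesis using A0 A by (intro continuous_intros ballI) auto
    qed simp
    have c2: "continuous_on {A..B} (\<lambda>u. arcsin ((2 * u - A - B) / (B - A)))"
      using A by (intro continuous_intros ballI) (auto simp: pos_le_divide_eq pos_divide_le_eq)
    have c3: "continuous_on {A..B} (\<lambda>u. sqrt ((u - A) * (B - u)))"
      by (intro continuous_intros)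
    show ?thesis unfolding F_def
      by (rule continuous_on_diff[OF continuous_on_add[OF c3 continuous_on_mult[OF continuous_on_const c2]] c1])
  qed
  have cont: "continuous_on {a..b} (\<lambda>l. F (l + x))"
    by (intro continuous_on_compose2[OF cont_F] continuous_intros) (auto simp: A_def B_def)
  have deriv: "DERIV (\<lambda>l. F (l + x)) l :> ?f l" if "ereal a < ereal l" "ereal l < ereal b" for l
  proof -
    have "A < l + x" "l + x < B" using that by (auto simp: A_def B_def)
    from has_real_derivative_sqrt_primitive[OF A(1) this]
    have "DERIV F (l + x) :> sqrt ((l + x - A) * (B - (l + x))) / (l + x)" unfolding F_def .
    then show ?thesis by (simp add: DERIV_shift A_def B_def)
  qed
  have isc: "isCont ?f l" if "ereal a < ereal l" "ereal l < ereal b" for l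
    using that a x by (intro continuous_intros) auto
  have nn: "AE l in lborel. ereal a < ereal l \<longrightarrow> ereal l < ereal b \<longrightarrow> 0 \<le> ?f l"
    using a x by (intro AE_I2) auto
  have la: "(((\<lambda>l. F (l + x)) \<circ> real_of_ereal) \<longlongrightarrow> F (a + x)) (at_right (ereal a))"
    using continuous_on_Icc_at_rightD[OF cont a(2)] by (simp add: ereal_tendsto_simps)
  have lb: "(((\<lambda>l. F (l + x)) \<circ> real_of_ereal) \<longlongrightarrow> F (b + x)) (at_left (ereal b))"
    using continuous_on_Icc_at_leftD[OF cont a(2)] by (simp add: ereal_tendsto_simps)
  have ab: "ereal a < ereal b" using a by simp
  note ftc = interval_integral_FTC_nonneg[OF ab deriv isc nn la lb]
  have "set_integrable lborel {a<..<b} ?f"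
    using ftc(1) by (simp add: einterval_eq)
  then show "set_integrable lborel {a..b} ?f"
    unfolding set_integrable_def
    by (subst integrable_discrete_difference[where X = "{a, b}"]) (auto simp: indicator_def)
  have "(LBINT l:{a..b}. ?f l) = F (b + x) - F (a + x)"
    using ftc(2) a by (simp add: interval_integral_Icc)
  also have "F (b + x) = (A + B) / 2 * (pi / 2) - sqrt (A * B) * (pi / 2)"
  proof -
    have "(2 * B - A - B) / (B - A) = 1" using A by (simp add: field_simps)
    moreover have "sqrt (A * B) * arcsin (((A + B) * B - 2 * A * B) / (B * (B - A))) = sqrt (A * B) * (pi / 2)"
    proof -
      have "((A + B) * B - 2 * A * B) / (B * (B - A)) = 1" using A by (simp add: field_simps)
      then show ?thesis by simp
    qed
    ultimately show ?thesis by (simp add: F_def B_def[symmetric])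
  qed
  also have "F (a + x) = (A + B) / 2 * (- (pi / 2)) - sqrt (A * B) * (- (pi / 2))"
  proof -
    have "(2 * A - A - B) / (B - A) = -1" using A by (simp add: field_simps)
    moreover have "sqrt (A * B) * arcsin (((A + B) * A - 2 * A * B) / (A * (B - A))) = sqrt (A * B) * (- (pi / 2))"
    proof (cases "A = 0")
      case False
      then have "((A + B) * A - 2 * A * B) / (A * (B - A)) = -1" using A by (simp add: field_simps)
      then show ?thesis by simp
    qed simp
    ultimately show ?thesis by (simp add: F_def A_def[symmetric])
  qed
  finally show "(LBINT l:{a..b}. ?f l) = pi * ((a + b) / 2 + x - sqrt ((a + x) * (b + x)))"
    by (simp add: A_def B_def field_simps)
qed

definition mp_density :: "real \<Rightarrow> real \<Rightarrow> real \<Rightarrow> real" where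
  "mp_density a b l = sqrt ((l - a) * (b - l)) / (2 * pi * l)"

lemma mp_density_nonneg: "0 \<le> a \<Longrightarrow> l \<in> {a..b} \<Longrightarrow> mp_density a b l \<ge> 0"
  unfolding mp_density_def by simp

lemma mp_density_integrable:
  assumes "0 \<le> a" "a < b"
  shows "set_integrable lborel {a..b} (mp_density a b)"
    and "(LBINT l:{a..b}. mp_density a b l) = ((a + b) / 2 - sqrt (a * b)) / 2"
proof -
  have eq: "mp_density a b = (\<lambda>l. 1 / (2 * pi) * (sqrt ((l - a) * (b - l)) / (l + 0)))"
    by (simp add: mp_density_def fun_eq_iff)
  note I = integral_sqrt_quadratic_over_shifted[OF assms order_refl]
  show "set_integrable lborel {a..b} (mp_density a b)"
    unfolding eq by (intro set_integrable_mult_right I(1))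
  show "(LBINT l:{a..b}. mp_density a b l) = ((a + b) / 2 - sqrt (a * b)) / 2"
    unfolding eq set_integral_mult_right I(2) by simp
qed

text \<open>The partial fractions 1 / (l (l + x)) = (1 / l - 1 / (l + x)) / x reduce the transform
  to the previous integral at the shifts 0 and x.\<close>

lemma mp_density_stieltjes:
  assumes "0 \<le> a" "a < b" "x > 0"
  shows "(LBINT l:{a..b}. 1 / (l + x) * mp_density a b l) =
     (sqrt ((a + x) * (b + x)) - x - sqrt (a * b)) / (2 * x)"
proof -
  note I0 = integral_sqrt_quadratic_over_shifted[OF assms(1,2) order_refl]
  note Ix = integral_sqrt_quadratic_over_shifted[OF assms(1,2) less_imp_le[OF assms(3)]]
  have "(LBINT l:{a..b}. 1 / (l + x) * mp_density a b l) =
    (LBINT l:{a..b}. 1 / (2 * pi * x) *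
       (sqrt ((l - a) * (b - l)) / (l + 0) - sqrt ((l - a) * (b - l)) / (l + x)))"
  proof (intro set_lebesgue_integral_cong ballI allI impI)
    fix l assume l: "l \<in> {a..b}"
    show "1 / (l + x) * mp_density a b l = 1 / (2 * pi * x) *
       (sqrt ((l - a) * (b - l)) / (l + 0) - sqrt ((l - a) * (b - l)) / (l + x))"
    proof (cases "l = 0")
      case True then show ?thesis using l assms by (simp add: mp_density_def)
    next
      case False
      then have "l > 0" "l + x > 0" using l assms by auto
      then show ?thesis using assms(3) by (simp add: mp_density_def field_simps)
    qed
  qed simp
  also have "\<dots> = 1 / (2 * pi * x) * (pi * ((a + b) / 2 + 0 - sqrt ((a + 0) * (b + 0)))
       - pi * ((a + b) / 2 + x - sqrt ((a + x) * (b + x))))"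
    unfolding set_integral_mult_right set_integral_diff(2)[OF I0(1) Ix(1)] I0(2) Ix(2) ..
  also have "\<dots> = (sqrt ((a + x) * (b + x)) - x - sqrt (a * b)) / (2 * x)"
    using assms(3) by (simp add: field_simps)
  finally show ?thesis .
qed

lemma set_integrable_mult_continuous:
  fixes f d :: "real \<Rightarrow> real"
  assumes "continuous_on {a..b} f" "set_integrable lborel {a..b} d"
  shows "set_integrable lborel {a..b} (\<lambda>l. f l * d l)"
proof -
  have "compact (f ` {a..b})" using assms(1) by (intro compact_continuous_image) auto
  then obtain C where "\<forall>y\<in>f ` {a..b}. norm y \<le> C"
    using compact_imp_bounded bounded_iff by metis
  then have C: "\<bar>f l\<bar> \<le> C" if "l \<in> {a..b}" for l using that by simp
  have m: "(\<lambda>l. indicator {a..b} l *\<^sub>R f l) \<in> borel_measurable lborel"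
    using borel_measurable_continuous_on_indicator[OF _ assms(1)] by simp
  have "integrable lborel (\<lambda>l. C * (indicator {a..b} l *\<^sub>R d l))"
    using assms(2) unfolding set_integrable_def by (rule integrable_mult_right)
  then show ?thesis unfolding set_integrable_def
  proof (rule Bochner_Integration.integrable_bound)
    have "(\<lambda>l. (indicator {a..b} l *\<^sub>R f l) * (indicator {a..b} l *\<^sub>R d l)) \<in> borel_measurable lborel"
      using m assms(2) unfolding set_integrable_def by (intro borel_measurable_times) auto
    then show "(\<lambda>l. indicator {a..b} l *\<^sub>R (f l * d l)) \<in> borel_measurable lborel"
      by (rule measurable_cong[THEN iffD1, rotated]) (auto simp: indicator_def)
    show "AE l in lborel. norm (indicator {a..b} l *\<^sub>R (f l * d l)) \<le> norm (C * (indicator {a..b} l *\<^sub>R d l))"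
    proof (intro AE_I2)
      fix l
      show "norm (indicator {a..b} l *\<^sub>R (f l * d l)) \<le> norm (C * (indicator {a..b} l *\<^sub>R d l))"
      proof (cases "l \<in> {a..b}")
        case True
        then have "\<bar>f l\<bar> \<le> \<bar>C\<bar>" using C[OF True] by simp
        then show ?thesis using True by (simp add: abs_mult mult_right_mono)
      qed simp
    qed
  qed
qed

text \<open>The atom at \<open>0\<close> is the limit of the fraction of zero eigenvalues.\<close>

definition mp_mean :: "real \<Rightarrow> real \<Rightarrow> real \<Rightarrow> (real \<Rightarrow> real) \<Rightarrow> real" where
  "mp_mean c a b f = (LBINT l:{a..b}. f l * mp_density a b l) + max 0 (1 - c) * f 0"

context
  fixes c a b :: real
  assumes c: "c > 0" and a_def: "a = (1 - sqrt c)\<^sup>2" and b_def: "b = (1 + sqrt c)\<^sup>2"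
begin

lemma mp_edges: "0 \<le> a" "a < b" "a + b = 2 * (1 + c)" "a * b = (1 - c)\<^sup>2" "sqrt (a * b) = \<bar>1 - c\<bar>"
proof -
  have s: "(sqrt c)\<^sup>2 = c" "sqrt c > 0" using c by auto
  show "0 \<le> a" by (simp add: a_def)
  show "a < b" using s by (simp add: a_def b_def power2_eq_square algebra_simps)
  show "a + b = 2 * (1 + c)" using s by (simp add: a_def b_def power2_eq_square algebra_simps)
  have "a * b = ((1 - sqrt c) * (1 + sqrt c))\<^sup>2" by (simp add: a_def b_def power_mult_distrib)
  also have "(1 - sqrt c) * (1 + sqrt c) = 1 - c" using s by (simp add: power2_eq_square algebra_simps)
  finally show "a * b = (1 - c)\<^sup>2" .
  then show "sqrt (a * b) = \<bar>1 - c\<bar>" by simp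
qed

text \<open>The density has mass min 1 c. For c < 1 the matrix has fewer rows than columns in the
  limit, and the rank deficit 1 - c sits at 0.\<close>

lemma mp_mass: "(LBINT l:{a..b}. mp_density a b l) = 1 - max 0 (1 - c)"
  unfolding mp_density_integrable(2)[OF mp_edges(1,2)] mp_edges(3,5) by (auto simp: max_def abs_if field_simps)

lemma mp_integrable_bcont:
  assumes "f \<in> bcont"
  shows "set_integrable lborel {a..b} (\<lambda>l. f l * mp_density a b l)"
proof -
  have "continuous_on {a..b} f"
    using assms mp_edges(1) unfolding bcont_def by (auto intro: continuous_on_subset)
  then show ?thesis
    by (rule set_integrable_mult_continuous[OF _ mp_density_integrable(1)[OF mp_edges(1,2)]])
qed

lemma mean_functional_mp_mean: "mean_functional (mp_mean c a b)"
  unfolding mean_functional_def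
proof (intro conjI ballI allI impI)
  fix f g assume fg: "f \<in> bcont" "g \<in> bcont"
  show "mp_mean c a b (\<lambda>x. f x + g x) = mp_mean c a b f + mp_mean c a b g"
    unfolding mp_mean_def ring_distribs set_integral_add(2)[OF fg[THEN mp_integrable_bcont]] by simp
next
  fix f :: "real \<Rightarrow> real" and k :: real
  show "mp_mean c a b (\<lambda>x. k * f x) = k * mp_mean c a b f"
    unfolding mp_mean_def mult.assoc set_integral_mult_right by (simp add: algebra_simps)
next
  fix f e assume f: "f \<in> bcont" and e: "\<forall>x\<ge>0. \<bar>f x\<bar> \<le> e"
  note intd = mp_density_integrable(1)[OF mp_edges(1,2)]
  have "\<bar>LBINT l:{a..b}. f l * mp_density a b l\<bar> \<le> (LBINT l:{a..b}. e * mp_density a b l)"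
  proof -
    have "(LBINT l:{a..b}. f l * mp_density a b l) \<le> (LBINT l:{a..b}. e * mp_density a b l)"
      using e mp_edges(1) mp_density_nonneg[OF mp_edges(1)]
      by (intro set_integral_mono mp_integrable_bcont[OF f] set_integrable_mult_right intd mult_right_mono)
        (auto simp: abs_le_iff)
    moreover have "(LBINT l:{a..b}. (- e) * mp_density a b l) \<le> (LBINT l:{a..b}. f l * mp_density a b l)"
    proof (intro set_integral_mono mp_integrable_bcont[OF f] set_integrable_mult_right intd mult_right_mono)
      fix l assume "l \<in> {a..b}"
      then have "\<bar>f l\<bar> \<le> e" using e mp_edges(1) by auto
      then show "- e \<le> f l" by simp
    qed (use mp_density_nonneg[OF mp_edges(1)] in auto)
    ultimately show ?thesis
      unfolding set_integral_mult_right[of lborel _ "- e"] set_integral_mult_right[of lborel _ e] by simp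
  qed
  also have "\<dots> = e * (1 - max 0 (1 - c))" by (simp add: mp_mass)
  finally have 1: "\<bar>LBINT l:{a..b}. f l * mp_density a b l\<bar> \<le> e * (1 - max 0 (1 - c))" .
  have "\<bar>max 0 (1 - c) * f 0\<bar> \<le> max 0 (1 - c) * e"
    using e by (simp add: abs_mult mult_left_mono)
  with 1 show "\<bar>mp_mean c a b f\<bar> \<le> e"
    unfolding mp_mean_def by (simp add: algebra_simps)
qed

lemma mp_mean_one: "mp_mean c a b (\<lambda>_. 1) = 1"
  by (simp add: mp_mean_def mp_mass)

text \<open>Clearing denominators in the fixed-point equation gives x g^2 + (x + c - 1) g - 1 = 0,
  whose discriminant is (a + x) (b + x). The atom cancels the term |1 - c| of the integral and
  leaves the positive root.\<close>

lemma mp_mean_stieltjes: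
  assumes x: "x > 0"
  defines "g \<equiv> mp_mean c a b (\<lambda>l. 1 / (l + x))"
  shows "g \<ge> 0" and "(1 - x * g) - c * (g / (1 + g)) = 0"
proof -
  have p: "(a + x) * (b + x) = (x + c - 1)\<^sup>2 + 4 * x"
  proof -
    have "(a + x) * (b + x) = a * b + x * (a + b) + x\<^sup>2" by (simp add: power2_eq_square algebra_simps)
    then show ?thesis unfolding mp_edges(3,4) by (simp add: power2_eq_square algebra_simps)
  qed
  define r where "r = sqrt ((x + c - 1)\<^sup>2 + 4 * x)"
  have r2: "r\<^sup>2 = (x + c - 1)\<^sup>2 + 4 * x" using x by (simp add: r_def)
  have rb: "r > \<bar>x + c - 1\<bar>" unfolding r_def using x by (intro real_less_rsqrt) simp
  have "g = (r - x - \<bar>1 - c\<bar>) / (2 * x) + max 0 (1 - c) / x"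
    unfolding g_def mp_mean_def mp_density_stieltjes[OF mp_edges(1,2) x] p r_def mp_edges(5) by simp
  also have "\<dots> = (r - (x + c - 1)) / (2 * x)"
    using x by (auto simp: max_def abs_if field_simps)
  finally have g: "2 * x * g = r - (x + c - 1)" using x by (simp add: field_simps)
  have "2 * x * g > 0" using g rb by linarith
  then have g0: "g > 0" using x by (simp add: zero_less_mult_iff)
  then show "g \<ge> 0" by simp
  have "(2 * x * g + (x + c - 1))\<^sup>2 = (x + c - 1)\<^sup>2 + 4 * x" unfolding g using r2 by simp
  then have "4 * x * (x * g\<^sup>2 + (x + c - 1) * g - 1) = 0"
    by (simp add: power2_eq_square algebra_simps)
  then have "x * g\<^sup>2 + (x + c - 1) * g - 1 = 0" using x by simp
  then have "(1 - x * g) * (1 + g) = c * g" by (simp add: power2_eq_square algebra_simps)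
  then have "1 - x * g = c * g / (1 + g)" using g0 by (simp add: eq_divide_eq)
  then show "(1 - x * g) - c * (g / (1 + g)) = 0" by simp
qed

end

subsection \<open>Water-filling\<close>

text \<open>Clipping l at the cutoff s / \<beta> replaces both the positive part and the case l = 0;
  the denominator stays away from 0, so continuity on [0, \<infinity>) becomes visible.\<close>

lemma wf_power_eq:
  assumes "s > 0" "\<beta> > 0" "l \<ge> 0"
  shows "wf_power s \<beta> l = \<beta> - s / max l (s / \<beta>)"
proof (cases "l \<ge> s / \<beta>")
  case True
  have "s / \<beta> > 0" using assms by simp
  then have l: "l > 0" using True by linarith
  have "s / l \<le> \<beta>" using True l assms by (simp add: field_simps)
  then show ?thesis using True l by (simp add: wf_power_def)
next
  case False
  then have "l * \<beta> < s" using assms by (simp add: not_le pos_less_divide_eq)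
  then have "\<beta> \<le> s / l" if "l > 0" using that by (simp add: pos_le_divide_eq mult.commute)
  then have "l = 0 \<or> \<beta> \<le> s / l" using assms(3) by fastforce
  then show ?thesis using False assms by (auto simp: wf_power_def)
qed

lemma wf_power_nonneg: "wf_power s \<beta> l \<ge> 0"
  by (simp add: wf_power_def)

text \<open>Convexity in \<beta>, with the indicator of being used as a subgradient: the secant
  slope lies between its values at the two ends.\<close>

lemma wf_power_increment:
  assumes "s > 0" "\<beta> \<le> \<beta>'"
  shows "(\<beta>' - \<beta>) * of_bool (wf_power s \<beta> l > 0) \<le> wf_power s \<beta>' l - wf_power s \<beta> l"
    and "wf_power s \<beta>' l - wf_power s \<beta> l \<le> (\<beta>' - \<beta>) * of_bool (wf_power s \<beta>' l > 0)"
  using assms by (auto simp: wf_power_def max_def of_bool_def)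

text \<open>The variant with a closed threshold matches the interval of integration of the limit. At
  the kink l = s / \<beta> the slope to the left is 0 and to the right is 1, so either convention
  satisfies both bounds.\<close>

lemma wf_power_increment_ge:
  assumes "s > 0" "0 < \<beta>" "\<beta> \<le> \<beta>'" "l > 0"
  shows "(\<beta>' - \<beta>) * of_bool (s / \<beta> \<le> l) \<le> wf_power s \<beta>' l - wf_power s \<beta> l"
    and "wf_power s \<beta>' l - wf_power s \<beta> l \<le> (\<beta>' - \<beta>) * of_bool (s / \<beta>' \<le> l)"
proof -
  have iff: "s / \<gamma> \<le> l \<longleftrightarrow> s / l \<le> \<gamma>" if "\<gamma> > 0" for \<gamma>
    using that assms(4) by (simp add: field_simps)
  show "(\<beta>' - \<beta>) * of_bool (s / \<beta> \<le> l) \<le> wf_power s \<beta>' l - wf_power s \<beta> l"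
    using assms iff[of \<beta>] by (auto simp: wf_power_def max_def of_bool_def)
  show "wf_power s \<beta>' l - wf_power s \<beta> l \<le> (\<beta>' - \<beta>) * of_bool (s / \<beta>' \<le> l)"
    using assms iff[of \<beta>'] by (auto simp: wf_power_def max_def of_bool_def)
qed

definition total_power :: "real \<Rightarrow> real multiset \<Rightarrow> real \<Rightarrow> real" where
  "total_power s X \<beta> = (\<Sum>l\<in>#X. wf_power s \<beta> l)"

definition num_used :: "real \<Rightarrow> real multiset \<Rightarrow> real \<Rightarrow> nat" where
  "num_used s X \<beta> = size {#l \<in># X. wf_power s \<beta> l > 0#}"

lemma total_power_increment:
  assumes "s > 0" "\<beta> \<le> \<beta>'"
  shows "(\<beta>' - \<beta>) * num_used s X \<beta> \<le> total_power s X \<beta>' - total_power s X \<beta>"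
    and "total_power s X \<beta>' - total_power s X \<beta> \<le> (\<beta>' - \<beta>) * num_used s X \<beta>'"
proof -
  show "(\<beta>' - \<beta>) * num_used s X \<beta> \<le> total_power s X \<beta>' - total_power s X \<beta>"
  proof (induction X)
    case (add l X)
    then show ?case using wf_power_increment(1)[OF assms, of l]
      by (auto simp: total_power_def num_used_def of_bool_def algebra_simps split: if_splits)
  qed (simp add: total_power_def num_used_def)
  show "total_power s X \<beta>' - total_power s X \<beta> \<le> (\<beta>' - \<beta>) * num_used s X \<beta>'"
  proof (induction X)
    case (add l X)
    then show ?case using wf_power_increment(2)[OF assms, of l]
      by (auto simp: total_power_def num_used_def of_bool_def algebra_simps split: if_splits)
  qed (simp add: total_power_def num_used_def)
qed

lemma num_used_mono:
  assumes "s > 0" "\<beta> \<le> \<beta>'"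
  shows "num_used s X \<beta> \<le> num_used s X \<beta>'"
proof (induction X)
  case (add l X)
  have "wf_power s \<beta> l > 0 \<Longrightarrow> wf_power s \<beta>' l > 0"
    using wf_power_increment(1)[OF assms, of l] assms(2) by (auto simp: of_bool_def)
  with add show ?case by (auto simp: num_used_def)
qed (simp add: num_used_def)

lemma num_used_pos: "total_power s X \<beta> > 0 \<Longrightarrow> num_used s X \<beta> > 0"
proof (induction X)
  case (add l X)
  then show ?case using wf_power_nonneg[of s \<beta> l]
    by (cases "wf_power s \<beta> l > 0") (auto simp: total_power_def num_used_def)
qed (simp add: total_power_def)

lemma total_power_mono: "s > 0 \<Longrightarrow> \<beta> \<le> \<beta>' \<Longrightarrow> total_power s X \<beta> \<le> total_power s X \<beta>'"
  using total_power_increment(1)[of s \<beta> \<beta>' X] by (smt (verit) mult_nonneg_nonneg of_nat_0_le_iff)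

text \<open>From any point with positive total power at least one eigenvalue is in use, so the total
  is strictly increasing there; hence \<open>THE\<close> denotes the one solution, which the
  intermediate value theorem supplies.\<close>

lemma water_level_between:
  assumes s: "s > 0" and t: "t > 0" and 1: "total_power s X \<beta>1 < t" and 2: "t < total_power s X \<beta>2"
  shows "\<beta>1 < (THE \<beta>. total_power s X \<beta> = t)" "(THE \<beta>. total_power s X \<beta> = t) < \<beta>2"
proof -
  have cont: "continuous_on S (total_power s X)" for S
  proof (induction X)
    case (add l X)
    have "continuous_on S (\<lambda>\<beta>. wf_power s \<beta> l)"
      by (cases "l = 0") (auto simp: wf_power_def intro!: continuous_intros)
    then have "continuous_on S (\<lambda>\<beta>. wf_power s \<beta> l + total_power s X \<beta>)"
      by (intro continuous_on_add add)
    then show ?case by (simp add: total_power_def[abs_def])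
  qed (simp add: total_power_def[abs_def])
  have "\<beta>1 \<le> \<beta>2"
    using total_power_mono[OF s, of \<beta>2 \<beta>1 X] 1 2 by linarith
  then obtain \<beta> where \<beta>: "total_power s X \<beta> = t"
    using IVT'[of "total_power s X" \<beta>1 t \<beta>2] 1 2 cont by auto
  have uniq: "\<gamma> = \<beta>" if "total_power s X \<gamma> = t" for \<gamma>
  proof -
    have less: False if "x < y" "total_power s X x = t" "total_power s X y = t" for x y
    proof -
      have "num_used s X x > 0" using that t by (intro num_used_pos) simp
      then have "(y - x) * num_used s X x > 0" using that by simp
      then show False using total_power_increment(1)[OF s, of x y X] that by simp
    qed
    show ?thesis using less[of \<gamma> \<beta>] less[of \<beta> \<gamma>] \<beta> that by (cases \<gamma> \<beta> rule: linorder_cases) auto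
  qed
  have the: "(THE \<beta>. total_power s X \<beta> = t) = \<beta>" using \<beta> uniq by blast
  show "\<beta>1 < (THE \<beta>. total_power s X \<beta> = t)"
    unfolding the using total_power_mono[OF s, of \<beta> \<beta>1 X] \<beta> 1 by linarith
  show "(THE \<beta>. total_power s X \<beta> = t) < \<beta>2"
    unfolding the using total_power_mono[OF s, of \<beta>2 \<beta> X] \<beta> 2 by linarith
qed

text \<open>The number of used dimensions is the slope of the convex function \<^const>\<open>total_power\<close>, so
  its limit follows from convergence of \<^const>\<open>total_power\<close> to a continuously differentiable
  function.\<close>

lemma num_used_tendsto:
  fixes X :: "nat \<Rightarrow> real multiset" and F T :: "real \<Rightarrow> real" and m :: "nat \<Rightarrow> nat" and p :: real
  assumes s: "s > 0" and p: "p > 0" and m: "eventually (\<lambda>k. m k > 0) sequentially"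
    and conv: "\<And>\<beta>. \<beta> > \<beta>min \<Longrightarrow> (\<lambda>k. total_power s (X k) \<beta> / m k) \<longlonglongrightarrow> F \<beta>"
    and Finc: "\<And>\<beta> \<beta>'. \<beta>min < \<beta> \<Longrightarrow> \<beta> < \<beta>' \<Longrightarrow>
        (\<beta>' - \<beta>) * T \<beta> \<le> F \<beta>' - F \<beta> \<and> F \<beta>' - F \<beta> \<le> (\<beta>' - \<beta>) * T \<beta>'"
    and Tpos: "\<And>\<beta>. \<beta>min < \<beta> \<Longrightarrow> T \<beta> > 0"
    and Tcont: "isCont T \<beta>0"
    and \<beta>0: "\<beta>min < \<beta>0" "F \<beta>0 = p"
  shows "(\<lambda>k. num_used s (X k) (THE \<beta>. total_power s (X k) \<beta> = real (m k) * p) / m k) \<longlonglongrightarrow> T \<beta>0"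
proof (rule LIMSEQ_I)
  fix r :: real assume r: "r > 0"
  obtain d where d: "d > 0" "\<And>\<beta>. \<bar>\<beta> - \<beta>0\<bar> < d \<Longrightarrow> \<bar>T \<beta> - T \<beta>0\<bar> < r"
    using Tcont r unfolding isCont_def LIM_def
    by (metis abs_zero cancel_comm_monoid_add_class.diff_cancel dist_real_def)
  \<comment> \<open>A third of the admissible radius keeps \<beta>0 - 2 \<eta> and \<beta>0 + 2
    \<eta> inside the continuity window and above \<beta>min.\<close>
  define \<eta> where "\<eta> = min d (\<beta>0 - \<beta>min) / 3"
  have \<eta>0: "\<eta> > 0" using d(1) \<beta>0(1) by (simp add: \<eta>_def)
  have "3 * \<eta> \<le> d" "3 * \<eta> \<le> \<beta>0 - \<beta>min" by (simp_all add: \<eta>_def)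
  then have \<eta>: "\<eta> > 0" "2 * \<eta> < d" "\<beta>min < \<beta>0 - 2 * \<eta>" using \<eta>0 by linarith+
  define Fk where "Fk k \<beta> = total_power s (X k) \<beta> / m k" for k \<beta>
  have cv: "(\<lambda>k. Fk k \<beta>) \<longlonglongrightarrow> F \<beta>" if "\<beta> > \<beta>min" for \<beta>
    using conv[OF that] by (simp add: Fk_def)
  have "0 < \<eta> * T (\<beta>0 - \<eta>)" "0 < \<eta> * T \<beta>0" using Tpos \<eta> \<beta>0 by simp_all
  \<comment> \<open>Positive slope separates the limit power at \<beta>0 - \<eta> and \<beta>0 +
    \<eta> strictly from p; this will trap the random level.\<close>
  then have Fl: "F (\<beta>0 - \<eta>) < p" and Fu: "p < F (\<beta>0 + \<eta>)"
    using Finc[of "\<beta>0 - \<eta>" \<beta>0] Finc[of \<beta>0 "\<beta>0 + \<eta>"] \<eta> \<beta>0 by auto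
  have "F (\<beta>0 + 2 * \<eta>) - F (\<beta>0 + \<eta>) \<le> \<eta> * T (\<beta>0 + 2 * \<eta>)"
    using Finc[of "\<beta>0 + \<eta>" "\<beta>0 + 2 * \<eta>"] \<eta> \<beta>0 by simp
  also have "\<dots> < \<eta> * (T \<beta>0 + r)"
    using d(2)[of "\<beta>0 + 2 * \<eta>"] \<eta> by (intro mult_strict_left_mono) auto
  finally have up: "F (\<beta>0 + 2 * \<eta>) - F (\<beta>0 + \<eta>) < \<eta> * (T \<beta>0 + r)" .
  have "\<eta> * (T \<beta>0 - r) < \<eta> * T (\<beta>0 - 2 * \<eta>)"
    using d(2)[of "\<beta>0 - 2 * \<eta>"] \<eta> by (intro mult_strict_left_mono) auto
  also have "\<dots> \<le> F (\<beta>0 - \<eta>) - F (\<beta>0 - 2 * \<eta>)"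
    using Finc[of "\<beta>0 - 2 * \<eta>" "\<beta>0 - \<eta>"] \<eta> \<beta>0 by simp
  finally have lo: "\<eta> * (T \<beta>0 - r) < F (\<beta>0 - \<eta>) - F (\<beta>0 - 2 * \<eta>)" .
  have e1: "eventually (\<lambda>k. Fk k (\<beta>0 - \<eta>) < p) sequentially"
    using Fl by (intro order_tendstoD(2)[OF cv]) (use \<eta> in auto)
  have e2: "eventually (\<lambda>k. p < Fk k (\<beta>0 + \<eta>)) sequentially"
    using Fu by (intro order_tendstoD(1)[OF cv]) (use \<eta> \<beta>0 in auto)
  have e3: "eventually (\<lambda>k. Fk k (\<beta>0 + 2 * \<eta>) - Fk k (\<beta>0 + \<eta>) < \<eta> * (T \<beta>0 + r)) sequentially"
    using up by (intro order_tendstoD(2)[OF tendsto_diff[OF cv cv]]) (use \<eta> \<beta>0 in auto)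
  have e4: "eventually (\<lambda>k. \<eta> * (T \<beta>0 - r) < Fk k (\<beta>0 - \<eta>) - Fk k (\<beta>0 - 2 * \<eta>)) sequentially"
    using lo by (intro order_tendstoD(1)[OF tendsto_diff[OF cv cv]]) (use \<eta> \<beta>0 in auto)
  have "eventually (\<lambda>k. norm (num_used s (X k) (THE \<beta>. total_power s (X k) \<beta> = real (m k) * p) / m k - T \<beta>0) < r) sequentially"
    using m e1 e2 e3 e4
  proof eventually_elim
    case (elim k)
    define L where "L = (THE \<beta>. total_power s (X k) \<beta> = real (m k) * p)"
    have mk: "real (m k) > 0" using elim(1) by simp
    \<comment> \<open>The secants over [\<beta>0 - 2 \<eta>, \<beta>0 - \<eta>] and
      [\<beta>0 + \<eta>, \<beta>0 + 2 \<eta>] lie entirely on either side of the level L. By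
      monotonicity of the count, their slopes enclose the count at L without evaluating anything at
      L itself.\<close>
    have L: "\<beta>0 - \<eta> < L" "L < \<beta>0 + \<eta>" unfolding L_def
      using elim(2,3) mk p by (intro water_level_between[OF s]; simp add: Fk_def field_simps)+
    have "\<eta> * num_used s (X k) L \<le> \<eta> * num_used s (X k) (\<beta>0 + \<eta>)"
      using num_used_mono[OF s, of L "\<beta>0 + \<eta>"] L \<eta> by simp
    also have "\<dots> \<le> total_power s (X k) (\<beta>0 + 2 * \<eta>) - total_power s (X k) (\<beta>0 + \<eta>)"
      using total_power_increment(1)[OF s, of "\<beta>0 + \<eta>" "\<beta>0 + 2 * \<eta>"] \<eta> by simp
    also have "\<dots> = m k * (Fk k (\<beta>0 + 2 * \<eta>) - Fk k (\<beta>0 + \<eta>))"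
      using mk by (simp add: Fk_def field_simps)
    also have "\<dots> < m k * (\<eta> * (T \<beta>0 + r))" using elim(4) mk by (intro mult_strict_left_mono) auto
    finally have "\<eta> * num_used s (X k) L < \<eta> * (m k * (T \<beta>0 + r))" by (simp add: mult_ac)
    then have "num_used s (X k) L < m k * (T \<beta>0 + r)" using \<eta>(1) by simp
    then have u: "num_used s (X k) L / m k < T \<beta>0 + r" using mk by (simp add: field_simps)
    have "m k * (\<eta> * (T \<beta>0 - r)) < m k * (Fk k (\<beta>0 - \<eta>) - Fk k (\<beta>0 - 2 * \<eta>))"
      using elim(5) mk by (intro mult_strict_left_mono) auto
    also have "\<dots> = total_power s (X k) (\<beta>0 - \<eta>) - total_power s (X k) (\<beta>0 - 2 * \<eta>)"
      using mk by (simp add: Fk_def field_simps)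
    also have "\<dots> \<le> \<eta> * num_used s (X k) (\<beta>0 - \<eta>)"
      using total_power_increment(2)[OF s, of "\<beta>0 - 2 * \<eta>" "\<beta>0 - \<eta>"] \<eta> by simp
    also have "\<dots> \<le> \<eta> * num_used s (X k) L"
      using num_used_mono[OF s, of "\<beta>0 - \<eta>" L] L \<eta> by simp
    finally have "\<eta> * (m k * (T \<beta>0 - r)) < \<eta> * num_used s (X k) L" by (simp add: mult_ac)
    then have "m k * (T \<beta>0 - r) < num_used s (X k) L" using \<eta>(1) by simp
    then have l: "T \<beta>0 - r < num_used s (X k) L / m k" using mk by (simp add: field_simps)
    show ?case using u l unfolding L_def[symmetric] by (simp add: abs_less_iff)
  qed
  then show "\<exists>no. \<forall>n\<ge>no. norm (num_used s (X n) (THE \<beta>. total_power s (X n) \<beta> = real (m n) * p) / m n - T \<beta>0) < r"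
    unfolding eventually_sequentially .
qed

text \<open>Numerator and denominator of s / max l (s / \<beta>) are multiplied by t = 1 / (1 + l),
  using t l = 1 - t. In this form the power extends continuously to t = 0, with value
  \<beta>.\<close>

lemma wf_power_inverse_comp:
  assumes "s > 0" "\<beta> > 0" "l \<ge> 0"
  shows "wf_power s \<beta> l = (\<lambda>t. \<beta> - s * t / max (1 - t) (s / \<beta> * t)) (1 / (1 + l))"
proof -
  define t where "t = 1 / (1 + l)"
  have t: "t > 0" "1 - t = t * l" using assms by (auto simp: t_def field_simps)
  have "max (1 - t) (s / \<beta> * t) = t * max l (s / \<beta>)"
    unfolding t(2) using t(1) by (simp add: max_mult_distrib_left mult.commute)
  moreover have "s * t / (t * max l (s / \<beta>)) = s / max l (s / \<beta>)" using t(1) by simp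
  ultimately show ?thesis unfolding t_def[symmetric] wf_power_eq[OF assms] by simp
qed

lemma continuous_on_wf_inverse:
  fixes s \<beta> :: real
  assumes "s > 0" "\<beta> > 0"
  shows "continuous_on {0..1} (\<lambda>t. \<beta> - s * t / max (1 - t) (s / \<beta> * t))"
proof (intro continuous_on_diff continuous_on_divide continuous_on_max continuous_on_mult
    continuous_on_const continuous_on_id ballI)
  fix t :: real assume "t \<in> {0..1}"
  then have "1 - t > 0 \<or> s / \<beta> * t > 0" using assms by (cases "t = 1") auto
  then show "max (1 - t) (s / \<beta> * t) \<noteq> 0" by (auto simp: max_def)
qed (use assms in auto)

lemma wf_power_bcont:
  assumes "s > 0" "\<beta> > 0"
  shows "wf_power s \<beta> \<in> bcont"
proof (rule bcontI)
  have "continuous_on {0..} (\<lambda>l. \<beta> - s / max l (s / \<beta>))"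
  proof (intro continuous_intros ballI)
    fix l :: real
    have "s / \<beta> > 0" using assms by simp
    then show "max l (s / \<beta>) \<noteq> 0" by (auto simp: max_def)
  qed
  then show "continuous_on {0..} (wf_power s \<beta>)"
    by (rule continuous_on_cong[THEN iffD1, OF refl, rotated]) (simp add: wf_power_eq[OF assms])
  show "\<bar>wf_power s \<beta> l\<bar> \<le> \<beta>" if "l \<ge> 0" for l
    using that assms by (auto simp: wf_power_def max_def abs_if)
qed

section \<open>The limiting power and the limiting fraction of used dimensions\<close>

context
  fixes c a b s :: real
  assumes c: "c > 0" and a_def: "a = (1 - sqrt c)\<^sup>2" and b_def: "b = (1 + sqrt c)\<^sup>2" and s: "s > 0"
begin

definition mp_used :: "real \<Rightarrow> real" where
  "mp_used \<beta> = (LBINT l:{max a (s / \<beta>)..b}. mp_density a b l)"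

definition mp_power :: "real \<Rightarrow> real" where
  "mp_power \<beta> = (LBINT l:{max (s / \<beta>) a..b}. (\<beta> - s / l) * mp_density a b l)"

lemmas spectrum_edges = mp_edges[OF c a_def b_def]
lemmas spectrum_density_integrable = mp_density_integrable(1)[OF spectrum_edges(1,2)]

lemma upper_edge_pos: "b > 0" using spectrum_edges by linarith

text \<open>The atom contributes nothing because no power goes to l = 0, and eigenvalues below the
  cutoff receive none.\<close>

lemma mp_power_eq_mp_mean:
  assumes "\<beta> > 0" shows "mp_power \<beta> = mp_mean c a b (wf_power s \<beta>)"
proof -
  have pos: "s / \<beta> > 0" using s assms by simp
  have "mp_power \<beta> = (LBINT l:{a..b}. wf_power s \<beta> l * mp_density a b l)"
    unfolding mp_power_def set_lebesgue_integral_def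
  proof (intro Bochner_Integration.integral_cong refl)
    fix l
    show "indicat_real {max (s / \<beta>) a..b} l *\<^sub>R ((\<beta> - s / l) * mp_density a b l) =
          indicat_real {a..b} l *\<^sub>R (wf_power s \<beta> l * mp_density a b l)"
    proof (cases "l \<in> {a..b}")
      case True
      then have l0: "l \<ge> 0" using spectrum_edges(1) by auto
      show ?thesis
      proof (cases "s / \<beta> \<le> l")
        case 2: True
        then have "l > 0" using pos by linarith
        moreover from this have "s / l \<le> \<beta>"
          using 2 assms by (simp add: pos_divide_le_eq mult.commute)
        ultimately show ?thesis using True 2 by (simp add: wf_power_def)
      next
        case False
        then have "wf_power s \<beta> l = 0" using wf_power_eq[OF s assms l0] assms s by simp
        then show ?thesis using False by simp
      qed
    qed auto
  qed
  then show ?thesis by (simp add: mp_mean_def wf_power_def)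
qed

text \<open>Moving the cutoff from the domain into the integrand lets different levels be compared
  on one fixed interval.\<close>

lemma mp_used_eq:
  assumes "\<beta> > 0"
  shows "mp_used \<beta> = (LBINT l:{a..b}. of_bool (s / \<beta> \<le> l) * mp_density a b l)"
    and "set_integrable lborel {a..b} (\<lambda>l. of_bool (s / \<beta> \<le> l) * mp_density a b l)"
proof -
  have eq: "indicat_real {max a (s / \<beta>)..b} l *\<^sub>R mp_density a b l =
      indicat_real {a..b} l *\<^sub>R (of_bool (s / \<beta> \<le> l) * mp_density a b l)" for l
    by (auto simp: indicator_def)
  show "mp_used \<beta> = (LBINT l:{a..b}. of_bool (s / \<beta> \<le> l) * mp_density a b l)"
    unfolding mp_used_def set_lebesgue_integral_def eq ..
  have "set_integrable lborel {max a (s / \<beta>)..b} (mp_density a b)"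
    by (rule set_integrable_subset[OF spectrum_density_integrable]) auto
  then show "set_integrable lborel {a..b} (\<lambda>l. of_bool (s / \<beta> \<le> l) * mp_density a b l)"
    unfolding set_integrable_def eq .
qed

lemma mp_power_increment:
  assumes "0 < \<beta>" "\<beta> \<le> \<beta>'"
  shows "(\<beta>' - \<beta>) * mp_used \<beta> \<le> mp_power \<beta>' - mp_power \<beta>"
    and "mp_power \<beta>' - mp_power \<beta> \<le> (\<beta>' - \<beta>) * mp_used \<beta>'"
proof -
  have \<beta>': "\<beta>' > 0" using assms by simp
  have P: "mp_power \<gamma> = (LBINT l:{a..b}. wf_power s \<gamma> l * mp_density a b l)"
    "set_integrable lborel {a..b} (\<lambda>l. wf_power s \<gamma> l * mp_density a b l)" if "\<gamma> > 0" for \<gamma>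
    using mp_power_eq_mp_mean[OF that] mp_integrable_bcont[OF c a_def b_def wf_power_bcont[OF s that]]
    by (simp_all add: mp_mean_def wf_power_def)
  have D: "mp_power \<beta>' - mp_power \<beta> =
      (LBINT l:{a..b}. wf_power s \<beta>' l * mp_density a b l - wf_power s \<beta> l * mp_density a b l)"
    unfolding P(1)[OF \<beta>'] P(1)[OF assms(1)] set_integral_diff(2)[OF P(2)[OF \<beta>'] P(2)[OF assms(1)]] ..
  note iD = set_integral_diff(1)[OF P(2)[OF \<beta>'] P(2)[OF assms(1)]]
  \<comment> \<open>At l = 0 the density is 0 because division by zero gives 0; the pointwise
    bounds, available for l > 0, extend to the whole interval.\<close>
  have m0: "mp_density a b l = 0" if "l = 0" for l using that by (simp add: mp_density_def)
  have le1: "(\<beta>' - \<beta>) * (of_bool (s / \<beta> \<le> l) * mp_density a b l)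
      \<le> wf_power s \<beta>' l * mp_density a b l - wf_power s \<beta> l * mp_density a b l"
    and le2: "wf_power s \<beta>' l * mp_density a b l - wf_power s \<beta> l * mp_density a b l
      \<le> (\<beta>' - \<beta>) * (of_bool (s / \<beta>' \<le> l) * mp_density a b l)" if l: "l \<in> {a..b}" for l
  proof -
    have n: "mp_density a b l \<ge> 0" by (rule mp_density_nonneg[OF spectrum_edges(1) l])
    show "(\<beta>' - \<beta>) * (of_bool (s / \<beta> \<le> l) * mp_density a b l)
      \<le> wf_power s \<beta>' l * mp_density a b l - wf_power s \<beta> l * mp_density a b l"
    proof (cases "l = 0")
      case False
      then have "l > 0" using l spectrum_edges(1) by auto
      from mult_right_mono[OF wf_power_increment_ge(1)[OF s assms this] n]
      show ?thesis by (simp only: left_diff_distrib mult.assoc)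
    qed (simp add: m0)
    show "wf_power s \<beta>' l * mp_density a b l - wf_power s \<beta> l * mp_density a b l
      \<le> (\<beta>' - \<beta>) * (of_bool (s / \<beta>' \<le> l) * mp_density a b l)"
    proof (cases "l = 0")
      case False
      then have "l > 0" using l spectrum_edges(1) by auto
      from mult_right_mono[OF wf_power_increment_ge(2)[OF s assms this] n]
      show ?thesis by (simp only: left_diff_distrib mult.assoc)
    qed (simp add: m0)
  qed
  have "(\<beta>' - \<beta>) * mp_used \<beta> = (LBINT l:{a..b}. (\<beta>' - \<beta>) * (of_bool (s / \<beta> \<le> l) * mp_density a b l))"
    unfolding mp_used_eq(1)[OF assms(1)] set_integral_mult_right ..
  also have "\<dots> \<le> mp_power \<beta>' - mp_power \<beta>" unfolding D
    by (intro set_integral_mono iD le1 set_integrable_mult_right mp_used_eq(2) assms)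
  finally show "(\<beta>' - \<beta>) * mp_used \<beta> \<le> mp_power \<beta>' - mp_power \<beta>" .
  have "mp_power \<beta>' - mp_power \<beta> \<le> (LBINT l:{a..b}. (\<beta>' - \<beta>) * (of_bool (s / \<beta>' \<le> l) * mp_density a b l))"
    unfolding D by (intro set_integral_mono iD le2 set_integrable_mult_right mp_used_eq(2) \<beta>')
  also have "\<dots> = (\<beta>' - \<beta>) * mp_used \<beta>'"
    unfolding mp_used_eq(1)[OF \<beta>'] set_integral_mult_right ..
  finally show "mp_power \<beta>' - mp_power \<beta> \<le> (\<beta>' - \<beta>) * mp_used \<beta>'" .
qed

lemma mp_used_integral:
  assumes "y \<in> {a..b}"
  shows "(LBINT l:{y..b}. mp_density a b l) = integral {a..b} (mp_density a b) - integral {a..y} (mp_density a b)"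
proof -
  have sub: "set_integrable lborel {y..b} (mp_density a b)"
    by (rule set_integrable_subset[OF spectrum_density_integrable]) (use assms in auto)
  have "mp_density a b integrable_on {a..b}" using set_borel_integral_eq_integral(1)[OF spectrum_density_integrable] .
  then have "integral {a..y} (mp_density a b) + integral {y..b} (mp_density a b) = integral {a..b} (mp_density a b)"
    using assms by (intro Henstock_Kurzweil_Integration.integral_combine) auto
  then show ?thesis using set_borel_integral_eq_integral(2)[OF sub] by simp
qed

lemma water_level_cutoff: "\<beta> > s / b \<Longrightarrow> \<beta> > 0 \<and> s / \<beta> < b"
proof -
  assume "\<beta> > s / b"
  moreover have "s / b > 0" using s upper_edge_pos by simp
  ultimately have "\<beta> > 0" by linarith
  with \<open>\<beta> > s / b\<close> show ?thesis using upper_edge_pos by (auto simp: field_simps)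
qed

text \<open>Only the lower limit of integration moves, and it moves continuously inside [a, b] as
  long as \<beta> > s / b; indefinite integrals are continuous.\<close>

lemma isCont_mp_used:
  assumes "\<beta> > s / b" shows "isCont mp_used \<beta>"
proof -
  have int: "mp_density a b integrable_on {a..b}" using set_borel_integral_eq_integral(1)[OF spectrum_density_integrable] .
  have "continuous_on {s / b<..} (\<lambda>\<beta>. max a (s / \<beta>))"
    using water_level_cutoff by (intro continuous_intros) auto
  moreover have "max a (s / \<beta>) \<in> {a..b}" if "\<beta> \<in> {s / b<..}" for \<beta>
    using water_level_cutoff[of \<beta>] that spectrum_edges(2) by auto
  ultimately have "continuous_on {s / b<..} (\<lambda>\<beta>. integral {a..max a (s / \<beta>)} (mp_density a b))"
    by (intro continuous_on_compose2[OF indefinite_integral_continuous_1[OF int]]) auto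
  then have "continuous_on {s / b<..} (\<lambda>\<beta>. integral {a..b} (mp_density a b) - integral {a..max a (s / \<beta>)} (mp_density a b))"
    by (intro continuous_intros)
  moreover have "integral {a..b} (mp_density a b) - integral {a..max a (s / \<beta>)} (mp_density a b) = mp_used \<beta>"
    if "\<beta> \<in> {s / b<..}" for \<beta>
    using water_level_cutoff[of \<beta>] that spectrum_edges(2) mp_used_integral[of "max a (s / \<beta>)"] by (simp add: mp_used_def)
  ultimately have "continuous_on {s / b<..} mp_used"
    by (rule continuous_on_eq)
  then show ?thesis using assms by (simp add: continuous_on_eq_continuous_at)
qed

lemma mp_used_le_1: "\<beta> > 0 \<Longrightarrow> mp_used \<beta> \<le> 1"
proof -
  assume \<beta>: "\<beta> > 0"
  have "mp_used \<beta> \<le> (LBINT l:{a..b}. mp_density a b l)"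
    unfolding mp_used_eq(1)[OF \<beta>]
    using mp_density_nonneg[OF spectrum_edges(1)]
    by (intro set_integral_mono mp_used_eq(2) \<beta> spectrum_density_integrable) auto
  also have "\<dots> \<le> 1" unfolding mp_mass[OF c a_def b_def] by simp
  finally show ?thesis .
qed

text \<open>The middle third [p, q] of the interval above the cutoff avoids both edges; there the
  density is continuous and strictly positive, so its integral cannot vanish.\<close>

lemma mp_used_pos:
  assumes "\<beta> > s / b" shows "mp_used \<beta> > 0"
proof -
  define y where "y = max a (s / \<beta>)"
  have y: "a \<le> y" "y < b" using water_level_cutoff[OF assms] spectrum_edges(2) by (auto simp: y_def)
  have y0: "y > 0" using water_level_cutoff[OF assms] s by (auto simp: y_def less_max_iff_disj)
  define p where "p = (2 * y + b) / 3"
  define q where "q = (y + 2 * b) / 3"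
  have pq: "y < p" "p < q" "q < b" using y by (auto simp: p_def q_def)
  have int: "mp_density a b integrable_on {a..b}" using set_borel_integral_eq_integral(1)[OF spectrum_density_integrable] .
  have sub: "set_integrable lborel {y..b} (mp_density a b)"
    by (rule set_integrable_subset[OF spectrum_density_integrable]) (use y in auto)
  have eq: "mp_used \<beta> = integral {y..b} (mp_density a b)"
    using set_borel_integral_eq_integral(2)[OF sub] by (simp add: mp_used_def y_def)
  have int1: "mp_density a b integrable_on {y..b}" "mp_density a b integrable_on {p..q}"
    using int y pq by (auto intro: integrable_on_subinterval)
  have "integral {p..q} (mp_density a b) \<le> mp_used \<beta>"
    unfolding eq using pq y spectrum_edges(1) int1
    by (intro integral_subset_le) (auto intro!: mp_density_nonneg)
  moreover have "integral {p..q} (mp_density a b) \<ge> 0"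
    using pq y spectrum_edges(1) int1 by (intro Henstock_Kurzweil_Integration.integral_nonneg) (auto intro!: mp_density_nonneg)
  moreover have "integral {p..q} (mp_density a b) \<noteq> 0"
  proof
    assume 0: "integral {p..q} (mp_density a b) = 0"
    have "continuous_on (cbox p q) (mp_density a b)" unfolding mp_density_def
      using y0 pq by (intro continuous_intros) auto
    moreover have "(mp_density a b has_integral 0) (cbox p q)"
      using int1(2) 0 by (metis box_real(2) integrable_integral)
    moreover have "box p q \<noteq> {}" "p \<in> cbox p q" using pq by auto
    moreover have "0 \<le> mp_density a b x" if "x \<in> box p q" for x
      using that pq y spectrum_edges(1) by (intro mp_density_nonneg) auto
    ultimately have "mp_density a b p = 0"
      using has_integral_0_cbox_imp_0 by blast
    moreover have "mp_density a b p > 0" using pq y y0 by (simp add: mp_density_def)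
    ultimately show False by simp
  qed
  ultimately show ?thesis by linarith
qed

text \<open>At \<beta> = s / b the interval of integration degenerates to the point b, so the power
  starts from 0. It has slope \<open>mp_used\<close>, which is positive beyond that point
  (uniqueness) and at most 1 (Lipschitz continuity, hence existence by intermediate values).\<close>

lemma ex1_mp_power:
  assumes p: "p > 0"
  shows "\<exists>!\<beta>. \<beta> > s / b \<and> mp_power \<beta> = p"
proof -
  have sb: "s / b > 0" using s upper_edge_pos by simp
  have strict: "mp_power \<beta> < mp_power \<beta>'" if "s / b < \<beta>" "\<beta> < \<beta>'" for \<beta> \<beta>'
  proof -
    have "(\<beta>' - \<beta>) * mp_used \<beta> > 0" using that mp_used_pos by simp
    then show ?thesis using mp_power_increment(1)[of \<beta> \<beta>'] that water_level_cutoff[of \<beta>] by simp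
  qed
  have "s / (s / b) = b" using s by simp
  then have "max (s / (s / b)) a = b" using spectrum_edges(2) by simp
  then have P0: "mp_power (s / b) = 0"
    unfolding mp_power_def set_lebesgue_integral_def
    by (subst integral_discrete_difference[where X = "{b}" and g = "\<lambda>_. 0"]) (auto simp: indicator_def)
  define \<beta>1 where "\<beta>1 = 2 * s / b"
  have \<beta>1: "\<beta>1 > s / b" using sb by (simp add: \<beta>1_def)
  \<comment> \<open>By convexity the slope at \<beta>1 persists to the right, so this distance
    raises the power by at least p.\<close>
  define \<beta>2 where "\<beta>2 = \<beta>1 + p / mp_used \<beta>1"
  have u1: "mp_used \<beta>1 > 0" by (rule mp_used_pos[OF \<beta>1])
  have \<beta>2: "\<beta>2 > \<beta>1" using u1 p by (simp add: \<beta>2_def)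
  have P1: "mp_power \<beta>1 \<ge> 0"
  proof -
    have "(\<beta>1 - s / b) * mp_used (s / b) \<le> mp_power \<beta>1"
      using mp_power_increment(1)[OF sb, of \<beta>1] \<beta>1 P0 by simp
    moreover have "mp_used (s / b) \<ge> 0" unfolding mp_used_def set_lebesgue_integral_def
      using spectrum_edges(1) mp_density_nonneg[of a _ b]
      by (intro Bochner_Integration.integral_nonneg) (auto simp: indicator_def)
    ultimately show ?thesis using \<beta>1 by (smt (verit) mult_nonneg_nonneg)
  qed
  have "p = (\<beta>2 - \<beta>1) * mp_used \<beta>1" using u1 by (simp add: \<beta>2_def)
  also have "\<dots> \<le> mp_power \<beta>2 - mp_power \<beta>1"
    using mp_power_increment(1)[of \<beta>1 \<beta>2] \<beta>2 water_level_cutoff[OF \<beta>1] by simp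
  finally have P2: "p \<le> mp_power \<beta>2" using P1 by simp
  have cont: "continuous_on {s / b..\<beta>2} mp_power"
  proof (rule lipschitz_on_continuous_on[of 1], rule lipschitz_onI)
    fix x y assume xy: "x \<in> {s / b..\<beta>2}" "y \<in> {s / b..\<beta>2}"
    have *: "\<bar>mp_power v - mp_power u\<bar> \<le> v - u" if "s / b \<le> u" "u \<le> v" for u v
    proof -
      have u: "u > 0" "v > 0" using that sb by auto
      have "mp_used u \<ge> 0" unfolding mp_used_def set_lebesgue_integral_def
        using spectrum_edges(1) mp_density_nonneg[of a _ b]
        by (intro Bochner_Integration.integral_nonneg) (auto simp: indicator_def)
      then have "0 \<le> (v - u) * mp_used u" using that by simp
      moreover have "(v - u) * mp_used v \<le> (v - u) * 1"
        using that u mp_used_le_1 by (intro mult_left_mono) auto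
      ultimately show ?thesis using mp_power_increment[OF u(1) that(2)] by simp
    qed
    show "dist (mp_power x) (mp_power y) \<le> 1 * dist x y"
      using *[of x y] *[of y x] xy by (cases "x \<le> y") (auto simp: dist_real_def abs_minus_commute)
  qed simp
  obtain \<beta> where \<beta>: "s / b \<le> \<beta>" "mp_power \<beta> = p"
    using IVT'[OF _ P2 _ cont] P0 p \<beta>1 \<beta>2 by auto
  have "\<beta> \<noteq> s / b" using \<beta>(2) P0 p by auto
  then have "\<beta> > s / b" using \<beta>(1) by simp
  with \<beta>(2) show ?thesis
    by (intro ex1I[of _ \<beta>]) (metis strict less_irrefl linorder_neqE_linordered_idom)+
qed

end

subsection \<open>Moments of complex Gaussians\<close>

lemma borel_measurable_det:
  fixes B :: "'w \<Rightarrow> complex mat"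
  assumes "\<And>\<omega>. B \<omega> \<in> carrier_mat m m"
    and "\<And>i j. i < m \<Longrightarrow> j < m \<Longrightarrow> (\<lambda>\<omega>. B \<omega> $$ (i, j)) \<in> borel_measurable N"
  shows "(\<lambda>\<omega>. det (B \<omega>)) \<in> borel_measurable N"
proof -
  have "(\<lambda>\<omega>. \<Sum>p | p permutes {0..<m}. signof p * (\<Prod>i = 0..<m. B \<omega> $$ (i, p i))) \<in> borel_measurable N"
    using permutes_in_image
    by (intro borel_measurable_sum borel_measurable_times borel_measurable_const borel_measurable_prod assms(2))
      fastforce+
  then show ?thesis by (simp add: det_def'[OF assms(1)])
qed

lemma borel_measurable_resolvent:
  fixes h :: "'w \<Rightarrow> nat \<Rightarrow> nat \<Rightarrow> complex"
  assumes "\<And>i j. i \<in> S \<Longrightarrow> j < m \<Longrightarrow> (\<lambda>\<omega>. h \<omega> i j) \<in> borel_measurable N" "j < m" "k < m"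
  shows "(\<lambda>\<omega>. resolvent m x S (h \<omega>) $$ (j, k)) \<in> borel_measurable N"
proof -
  let ?B = "\<lambda>\<omega>. shifted_gram m x S (h \<omega>)"
  have cn: "(\<lambda>z. cnj z) \<in> borel_measurable borel"
    by (intro borel_measurable_continuous_onI continuous_intros)
  have B: "(\<lambda>\<omega>. ?B \<omega> $$ (i, l)) \<in> borel_measurable N" if "i < m" "l < m" for i l
    using that assms(1) by (auto intro!: borel_measurable_add borel_measurable_sum borel_measurable_times
      measurable_compose[OF _ cn])
  have del: "(\<lambda>\<omega>. det (mat_delete (?B \<omega>) k j)) \<in> borel_measurable N"
  proof (rule borel_measurable_det[of _ "m - 1"])
    show "mat_delete (?B \<omega>) k j \<in> carrier_mat (m - 1) (m - 1)" for \<omega>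
      by (rule mat_delete_carrier) simp
    show "(\<lambda>\<omega>. mat_delete (?B \<omega>) k j $$ (i, l)) \<in> borel_measurable N" if "i < m - 1" "l < m - 1" for i l
    proof -
      have "mat_delete (?B \<omega>) k j $$ (i, l) = ?B \<omega> $$ (if i < k then i else Suc i, if l < j then l else Suc l)" for \<omega>
        using that by (simp add: mat_delete_def carrier_matD[OF shifted_gram_carrier] del: shifted_gram_index)
      then show ?thesis using that by (simp only:) (rule B, auto)
    qed
  qed
  have dB: "(\<lambda>\<omega>. det (?B \<omega>)) \<in> borel_measurable N"
    using B by (intro borel_measurable_det[of _ m]) (auto simp del: shifted_gram_index)
  have "resolvent m x S (h \<omega>) $$ (j, k) = inverse (det (?B \<omega>)) * ((- 1) ^ (k + j) * det (mat_delete (?B \<omega>) k j))" for \<omega>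
    using assms(2,3) unfolding resolvent_def by (simp add: adj_mat_def cofactor_def shifted_gram_def)
  then show ?thesis using dB del by simp
qed

lemma borel_measurable_resolvent_trace:
  fixes h :: "'w \<Rightarrow> nat \<Rightarrow> nat \<Rightarrow> complex"
  assumes "\<And>i j. i \<in> S \<Longrightarrow> j < m \<Longrightarrow> (\<lambda>\<omega>. h \<omega> i j) \<in> borel_measurable N"
  shows "(\<lambda>\<omega>. resolvent_trace m x S (h \<omega>)) \<in> borel_measurable N"
proof -
  have re: "Re \<in> borel_measurable borel" by (intro borel_measurable_continuous_onI continuous_intros)
  show ?thesis unfolding resolvent_trace_def
    by (intro borel_measurable_sum measurable_compose[OF borel_measurable_resolvent re] assms) auto
qed

section \<open>Products of two entries of a Gaussian row\<close>

lemma prod_if_two: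
  fixes f g :: "nat \<Rightarrow> 'a :: comm_monoid_mult"
  assumes "j < m" "k < m" "j \<noteq> k"
  shows "(\<Prod>l<m. if l = j then f l else if l = k then g l else 1) = f j * g k"
proof -
  have "(\<Prod>l<m. if l = j then f l else if l = k then g l else 1) =
      (\<Prod>l<m. (if l = j then f l else 1) * (if l = k then g l else 1))"
    using assms by (intro prod.cong refl) auto
  also have "\<dots> = (\<Prod>l<m. if l = j then f l else 1) * (\<Prod>l<m. if l = k then g l else 1)"
    by (rule prod.distrib)
  finally show ?thesis using assms by simp
qed

text \<open>The factor contributed by coordinate l to z_j cnj z_k, centred when j = k. Written as a
  product over all coordinates, the expectation of two such expressions splits by independence into
  one-dimensional moments.\<close>

definition pair_factor :: "real \<Rightarrow> nat \<Rightarrow> nat \<Rightarrow> nat \<Rightarrow> complex \<Rightarrow> complex" where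
  "pair_factor v j k l z =
     (if j = k then (if l = j then of_real ((cmod z)\<^sup>2 - v) else 1)
      else if l = j then z else if l = k then cnj z else 1)"

lemma prod_pair_factor:
  assumes "j < m" "k < m"
  shows "(\<Prod>l<m. pair_factor v j k l (z l)) = z j * cnj (z k) - (if j = k then of_real v else 0)"
proof (cases "j = k")
  case True
  then have "(\<Prod>l<m. pair_factor v j k l (z l)) = (\<Prod>l<m. if l = j then of_real ((cmod (z l))\<^sup>2 - v) else 1)"
    by (simp add: pair_factor_def)
  also have "\<dots> = of_real ((cmod (z j))\<^sup>2 - v)" using assms by simp
  also have "\<dots> = z j * cnj (z j) - of_real v" unfolding of_real_diff complex_norm_square ..
  finally show ?thesis using True by simp
next
  case False
  then show ?thesis using prod_if_two[OF assms False, of z "\<lambda>l. cnj (z l)"] by (simp add: pair_factor_def)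
qed

lemma norm_pair_factor_le:
  assumes "v \<ge> 0" shows "cmod (pair_factor v j k l z) \<le> (1 + v) * (1 + (cmod z)\<^sup>2)"
proof -
  define r where "r = cmod z"
  have r: "r \<ge> 0" by (simp add: r_def)
  have r1: "r \<le> 1 + r\<^sup>2" using zero_le_power2[of "r - 1"] r by (simp add: power2_eq_square algebra_simps)
  have v1: "1 + r\<^sup>2 \<le> (1 + v) * (1 + r\<^sup>2)" using assms mult_right_mono[of 1 "1 + v" "1 + r\<^sup>2"] by simp
  have "\<bar>r\<^sup>2 - v\<bar> \<le> r\<^sup>2 + v" using assms by (simp add: abs_le_iff)
  also have "\<dots> \<le> (1 + v) * (1 + r\<^sup>2)" using assms by (simp add: algebra_simps)
  finally have 1: "\<bar>r\<^sup>2 - v\<bar> \<le> (1 + v) * (1 + r\<^sup>2)" .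
  have "1 \<le> 1 + r\<^sup>2" by simp
  then have 2: "1 \<le> (1 + v) * (1 + r\<^sup>2)" and 3: "r \<le> (1 + v) * (1 + r\<^sup>2)" using v1 r1 by linarith+
  show ?thesis using 1 2 3 by (auto simp: pair_factor_def r_def norm_of_real simp del: of_real_diff of_real_power)
qed

context prob_space
begin

lemma normal_moments:
  assumes D: "distributed M lborel W (normal_density 0 \<sigma>)" and \<sigma>: "\<sigma> > 0"
  shows "integrable M (\<lambda>\<omega>. W \<omega> ^ k)"
    and "expectation W = 0" "expectation (\<lambda>\<omega>. (W \<omega>)\<^sup>2) = \<sigma>\<^sup>2" "expectation (\<lambda>\<omega>. W \<omega> ^ 4) = 3 * \<sigma> ^ 4"
proof -
  have "integrable lborel (\<lambda>x. normal_density 0 \<sigma> x * x ^ k)"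
    using integrable_normal_moment[OF \<sigma>, of 0 k] by simp
  then show "integrable M (\<lambda>\<omega>. W \<omega> ^ k)"
    using distributed_integrable[OF D, of "\<lambda>x. x ^ k"] by simp
  have E: "expectation (\<lambda>\<omega>. W \<omega> ^ k) = (\<integral>x. normal_density 0 \<sigma> x * (x - 0) ^ k \<partial>lborel)" for k
    using distributed_integral[OF D, of "\<lambda>x. x ^ k"] by simp
  show "expectation W = 0"
    using E[of 1] integral_normal_moment_odd[OF \<sigma>, of 0 0] by simp
  show "expectation (\<lambda>\<omega>. (W \<omega>)\<^sup>2) = \<sigma>\<^sup>2"
    using E[of 2] integral_normal_moment_even[OF \<sigma>, of 0 1] \<sigma> by simp
  show "expectation (\<lambda>\<omega>. W \<omega> ^ 4) = 3 * \<sigma> ^ 4"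
    using E[of 4] integral_normal_moment_even[OF \<sigma>, of 0 2] \<sigma>
    by (simp add: fact_numeral power2_eq_square power4_eq_xxxx field_simps)
qed

text \<open>Equal variances and independence of real and imaginary part cancel E Z^2. The fourth
  moment is 3 v^2 / 4 + 2 v^2 / 4 + 3 v^2 / 4 = 2 v^2, so |Z|^2 has variance exactly v^2.\<close>

lemma circ_gaussian_moments:
  assumes g: "circ_gaussian M v Z" and v: "v > 0" and Z: "Z \<in> borel_measurable M"
  shows "integrable M (\<lambda>\<omega>. (1 + (cmod (Z \<omega>))\<^sup>2)\<^sup>2)"
    and "expectation Z = 0" "expectation (\<lambda>\<omega>. (Z \<omega>)\<^sup>2) = 0"
    and "expectation (\<lambda>\<omega>. (cmod (Z \<omega>))\<^sup>2) = v" "expectation (\<lambda>\<omega>. (cmod (Z \<omega>)) ^ 4) = 2 * v\<^sup>2"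
proof -
  define X Y \<sigma> where "X = (\<lambda>\<omega>. Re (Z \<omega>))" and "Y = (\<lambda>\<omega>. Im (Z \<omega>))" and "\<sigma> = sqrt (v / 2)"
  have \<sigma>: "\<sigma> > 0" and s2: "\<sigma>\<^sup>2 = v / 2" using v by (simp_all add: \<sigma>_def)
  have s4: "\<sigma> ^ 4 = v\<^sup>2 / 4"
  proof -
    have "\<sigma> ^ 4 = (\<sigma>\<^sup>2)\<^sup>2" by simp
    then show ?thesis unfolding s2 by (simp add: power_divide)
  qed
  have ind: "indep_var borel X borel Y" and DX: "distributed M lborel X (normal_density 0 \<sigma>)"
    and DY: "distributed M lborel Y (normal_density 0 \<sigma>)"
    using g by (simp_all add: circ_gaussian_def X_def Y_def \<sigma>_def)
  note mX = normal_moments[OF DX \<sigma>] and mY = normal_moments[OF DY \<sigma>]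
  have X1: "integrable M X" and Y1: "integrable M Y" using mX(1)[of 1] mY(1)[of 1] by simp_all
  have indsq: "indep_var borel (\<lambda>\<omega>. (X \<omega>)\<^sup>2) borel (\<lambda>\<omega>. (Y \<omega>)\<^sup>2)"
    using indep_var_compose[OF ind, of "\<lambda>x. x\<^sup>2" borel "\<lambda>x. x\<^sup>2" borel] by (simp add: comp_def)
  note XY = indep_var_lebesgue_integral[OF ind X1 Y1] indep_var_integrable[OF ind X1 Y1]
  note XXYY = indep_var_lebesgue_integral[OF indsq mX(1) mY(1)] indep_var_integrable[OF indsq mX(1) mY(1)]
  have n2: "(cmod (Z \<omega>))\<^sup>2 = (X \<omega>)\<^sup>2 + (Y \<omega>)\<^sup>2" for \<omega> by (simp add: cmod_power2 X_def Y_def)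
  have n4: "(cmod (Z \<omega>)) ^ 4 = X \<omega> ^ 4 + 2 * ((X \<omega>)\<^sup>2 * (Y \<omega>)\<^sup>2) + Y \<omega> ^ 4" for \<omega>
  proof -
    have "(cmod (Z \<omega>)) ^ 4 = ((cmod (Z \<omega>))\<^sup>2)\<^sup>2" by simp
    then show ?thesis unfolding n2 by (simp add: power2_eq_square power4_eq_xxxx algebra_simps)
  qed
  have i2: "integrable M (\<lambda>\<omega>. (cmod (Z \<omega>))\<^sup>2)" unfolding n2 using mX(1) mY(1) by simp
  have i4: "integrable M (\<lambda>\<omega>. (cmod (Z \<omega>)) ^ 4)" unfolding n4 using mX(1) mY(1) XXYY(2) by simp
  have "(1 + (cmod (Z \<omega>))\<^sup>2)\<^sup>2 = 1 + 2 * (cmod (Z \<omega>))\<^sup>2 + (cmod (Z \<omega>)) ^ 4" for \<omega>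
    by (simp add: power2_eq_square power4_eq_xxxx algebra_simps)
  then show "integrable M (\<lambda>\<omega>. (1 + (cmod (Z \<omega>))\<^sup>2)\<^sup>2)" using i2 i4 by simp
  show "expectation (\<lambda>\<omega>. (cmod (Z \<omega>))\<^sup>2) = v"
    unfolding n2 using mX mY s2 by simp
  show "expectation (\<lambda>\<omega>. (cmod (Z \<omega>)) ^ 4) = 2 * v\<^sup>2"
  proof -
    have "expectation (\<lambda>\<omega>. (cmod (Z \<omega>)) ^ 4) = 3 * \<sigma> ^ 4 + 2 * (\<sigma>\<^sup>2 * \<sigma>\<^sup>2) + 3 * \<sigma> ^ 4"
      unfolding n4 using mX mY XXYY by simp
    then show ?thesis unfolding s2 s4 by (simp add: power2_eq_square field_simps)
  qed
  have Zeq: "Z = (\<lambda>\<omega>. complex_of_real (X \<omega>) + \<i> * complex_of_real (Y \<omega>))"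
    by (auto simp: X_def Y_def fun_eq_iff complex_eq_iff)
  show "expectation Z = 0" unfolding Zeq using X1 Y1 mX(2) mY(2) by simp
  have "(Z \<omega>)\<^sup>2 = complex_of_real ((X \<omega>)\<^sup>2 - (Y \<omega>)\<^sup>2) + 2 * \<i> * complex_of_real (X \<omega> * Y \<omega>)" for \<omega>
    by (auto simp: X_def Y_def complex_eq_iff power2_eq_square)
  moreover have "expectation (\<lambda>\<omega>. complex_of_real ((X \<omega>)\<^sup>2 - (Y \<omega>)\<^sup>2) + 2 * \<i> * complex_of_real (X \<omega> * Y \<omega>)) = 0"
  proof -
    have "integrable M (\<lambda>\<omega>. complex_of_real ((X \<omega>)\<^sup>2 - (Y \<omega>)\<^sup>2))"
      "integrable M (\<lambda>\<omega>. complex_of_real (X \<omega> * Y \<omega>))"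
      using mX(1) mY(1) XY(2) by (intro integrable_of_real Bochner_Integration.integrable_diff; simp)+
    then have "expectation (\<lambda>\<omega>. complex_of_real ((X \<omega>)\<^sup>2 - (Y \<omega>)\<^sup>2) + 2 * \<i> * complex_of_real (X \<omega> * Y \<omega>)) =
       complex_of_real (expectation (\<lambda>\<omega>. (X \<omega>)\<^sup>2 - (Y \<omega>)\<^sup>2)) + 2 * \<i> * complex_of_real (expectation (\<lambda>\<omega>. X \<omega> * Y \<omega>))"
      by (simp only: Bochner_Integration.integral_add integrable_mult_right integral_mult_right_zero integral_complex_of_real)
    also have "expectation (\<lambda>\<omega>. (X \<omega>)\<^sup>2 - (Y \<omega>)\<^sup>2) = 0" using mX mY by simp
    also have "expectation (\<lambda>\<omega>. X \<omega> * Y \<omega>) = 0" using XY(1) mX(2) by simp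
    finally show ?thesis by simp
  qed
  ultimately show "expectation (\<lambda>\<omega>. (Z \<omega>)\<^sup>2) = 0" by simp
qed

text \<open>A one-dimensional moment vanishes in three ways: the coordinate occurs in just one of
  the pairs, as a single Z or its conjugate; it occurs as Z^2; or it occurs as the centred |Z|^2 - v
  alone.\<close>

lemma pair_factor_moments:
  assumes g: "circ_gaussian M v Z" and v: "v > 0" and Z: "Z \<in> borel_measurable M"
  defines "e \<equiv> \<lambda>j k j' k' l. expectation (\<lambda>\<omega>. pair_factor v j k l (Z \<omega>) * cnj (pair_factor v j' k' l (Z \<omega>)))"
  shows "integrable M (\<lambda>\<omega>. pair_factor v j k l (Z \<omega>) * cnj (pair_factor v j' k' l (Z \<omega>)))"
    and "e j k j k l = (if j = k then if l = j then of_real (v\<^sup>2) else 1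
            else if l = j then of_real v else if l = k then of_real v else 1)"
    and "l = j \<Longrightarrow> j \<noteq> k \<Longrightarrow> l \<noteq> j' \<Longrightarrow> l \<noteq> k' \<Longrightarrow> e j k j' k' l = 0"
    and "l = k \<Longrightarrow> j \<noteq> k \<Longrightarrow> l \<noteq> j' \<Longrightarrow> l \<noteq> k' \<Longrightarrow> e j k j' k' l = 0"
    and "l = j' \<Longrightarrow> j' \<noteq> k' \<Longrightarrow> l \<noteq> j \<Longrightarrow> l \<noteq> k \<Longrightarrow> e j k j' k' l = 0"
    and "l = k' \<Longrightarrow> j' \<noteq> k' \<Longrightarrow> l \<noteq> j \<Longrightarrow> l \<noteq> k \<Longrightarrow> e j k j' k' l = 0"
    and "l = j \<Longrightarrow> j \<noteq> k \<Longrightarrow> l = k' \<Longrightarrow> j' \<noteq> k' \<Longrightarrow> e j k j' k' l = 0"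
    and "j = k \<Longrightarrow> j' = k' \<Longrightarrow> j \<noteq> j' \<Longrightarrow> l = j \<Longrightarrow> e j k j' k' l = 0"
proof -
  note mom = circ_gaussian_moments[OF g v Z]
  have cn: "(\<lambda>z. cnj z) \<in> borel_measurable borel"
    by (intro borel_measurable_continuous_onI continuous_intros)
  have cZ: "(\<lambda>\<omega>. cnj (Z \<omega>)) \<in> borel_measurable M" by (rule measurable_compose[OF Z cn])
  have pm: "(\<lambda>\<omega>. pair_factor v j k l (Z \<omega>)) \<in> borel_measurable M" for j k l
  proof -
    have "(\<lambda>\<omega>. complex_of_real ((cmod (Z \<omega>))\<^sup>2 - v)) \<in> borel_measurable M" using Z by simp
    then show ?thesis using Z cZ unfolding pair_factor_def by (cases "j = k"; cases "l = j"; cases "l = k") simp_all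
  qed
  show "integrable M (\<lambda>\<omega>. pair_factor v j k l (Z \<omega>) * cnj (pair_factor v j' k' l (Z \<omega>)))"
  proof (rule Bochner_Integration.integrable_bound)
    show "integrable M (\<lambda>\<omega>. (1 + v)\<^sup>2 * (1 + (cmod (Z \<omega>))\<^sup>2)\<^sup>2)" using mom(1) by simp
    show "(\<lambda>\<omega>. pair_factor v j k l (Z \<omega>) * cnj (pair_factor v j' k' l (Z \<omega>))) \<in> borel_measurable M"
      by (intro borel_measurable_times pm measurable_compose[OF pm cn])
    show "AE \<omega> in M. norm (pair_factor v j k l (Z \<omega>) * cnj (pair_factor v j' k' l (Z \<omega>)))
        \<le> norm ((1 + v)\<^sup>2 * (1 + (cmod (Z \<omega>))\<^sup>2)\<^sup>2)"
    proof (intro AE_I2)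
      fix \<omega>
      have "cmod (pair_factor v j k l (Z \<omega>)) * cmod (pair_factor v j' k' l (Z \<omega>)) \<le>
        ((1 + v) * (1 + (cmod (Z \<omega>))\<^sup>2)) * ((1 + v) * (1 + (cmod (Z \<omega>))\<^sup>2))"
        using v by (intro mult_mono norm_pair_factor_le) auto
      then show "norm (pair_factor v j k l (Z \<omega>) * cnj (pair_factor v j' k' l (Z \<omega>)))
        \<le> norm ((1 + v)\<^sup>2 * (1 + (cmod (Z \<omega>))\<^sup>2)\<^sup>2)"
        by (simp add: norm_mult power2_eq_square mult_ac)
    qed
  qed
  have bd: "integrable M f" if "f \<in> borel_measurable M" "\<And>\<omega>. \<bar>f \<omega>\<bar> \<le> (1 + (cmod (Z \<omega>))\<^sup>2)\<^sup>2" for f :: "'a \<Rightarrow> real"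
    by (rule Bochner_Integration.integrable_bound[OF mom(1) that(1)]) (use that(2) in auto)
  have i2: "integrable M (\<lambda>\<omega>. (cmod (Z \<omega>))\<^sup>2)"
    by (rule bd) (use Z in \<open>auto simp: power2_eq_square algebra_simps add_nonneg_nonneg\<close>)
  have i4: "integrable M (\<lambda>\<omega>. (cmod (Z \<omega>)) ^ 4)"
    by (rule bd) (use Z in \<open>auto simp: power2_eq_square power4_eq_xxxx algebra_simps add_nonneg_nonneg\<close>)
  have Ecn: "expectation (\<lambda>\<omega>. cnj (f \<omega>)) = cnj (expectation f)" for f by simp
  have E2: "expectation (\<lambda>\<omega>. Z \<omega> * cnj (Z \<omega>)) = of_real v"
    unfolding complex_norm_square[symmetric] integral_complex_of_real mom(4) ..
  have E2': "expectation (\<lambda>\<omega>. cnj (Z \<omega>) * Z \<omega>) = of_real v" using E2 by (simp add: mult.commute)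
  have "expectation (\<lambda>\<omega>. ((cmod (Z \<omega>))\<^sup>2 - v)\<^sup>2) = expectation (\<lambda>\<omega>. (cmod (Z \<omega>)) ^ 4 - 2 * v * (cmod (Z \<omega>))\<^sup>2 + v\<^sup>2)"
    by (intro Bochner_Integration.integral_cong refl) (simp add: power2_eq_square power4_eq_xxxx algebra_simps)
  also have "\<dots> = 2 * v\<^sup>2 - 2 * v * v + v\<^sup>2" using i2 i4 mom(4,5) by (simp add: prob_space)
  finally have "expectation (\<lambda>\<omega>. ((cmod (Z \<omega>))\<^sup>2 - v)\<^sup>2) = v\<^sup>2" by (simp add: power2_eq_square)
  moreover have "complex_of_real ((cmod (Z \<omega>))\<^sup>2 - v) * cnj (complex_of_real ((cmod (Z \<omega>))\<^sup>2 - v)) =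
      complex_of_real (((cmod (Z \<omega>))\<^sup>2 - v)\<^sup>2)" for \<omega>
    unfolding complex_cnj_complex_of_real of_real_mult[symmetric] power2_eq_square ..
  ultimately have E4: "expectation (\<lambda>\<omega>. complex_of_real ((cmod (Z \<omega>))\<^sup>2 - v) * cnj (complex_of_real ((cmod (Z \<omega>))\<^sup>2 - v))) = of_real (v\<^sup>2)"
    by (simp only: integral_complex_of_real)
  have E1: "expectation (\<lambda>\<omega>. complex_of_real ((cmod (Z \<omega>))\<^sup>2 - v)) = 0"
    unfolding integral_complex_of_real using i2 mom(4) by (simp add: prob_space)
  show "e j k j k l = (if j = k then if l = j then of_real (v\<^sup>2) else 1
            else if l = j then of_real v else if l = k then of_real v else 1)"
    unfolding e_def pair_factor_def using E2 E2' E4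
    by (auto simp: prob_space simp del: of_real_diff of_real_power complex_cnj_complex_of_real)
  have E0': "expectation (\<lambda>\<omega>. cnj (Z \<omega>)) = 0" using Ecn[of Z] mom(2) by simp
  show "l = j \<Longrightarrow> j \<noteq> k \<Longrightarrow> l \<noteq> j' \<Longrightarrow> l \<noteq> k' \<Longrightarrow> e j k j' k' l = 0"
    "l = k \<Longrightarrow> j \<noteq> k \<Longrightarrow> l \<noteq> j' \<Longrightarrow> l \<noteq> k' \<Longrightarrow> e j k j' k' l = 0"
    "l = j' \<Longrightarrow> j' \<noteq> k' \<Longrightarrow> l \<noteq> j \<Longrightarrow> l \<noteq> k \<Longrightarrow> e j k j' k' l = 0"
    "l = k' \<Longrightarrow> j' \<noteq> k' \<Longrightarrow> l \<noteq> j \<Longrightarrow> l \<noteq> k \<Longrightarrow> e j k j' k' l = 0"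
    unfolding e_def pair_factor_def using mom(2) E0' by (cases "j = k"; cases "j' = k'"; auto)+
  show "l = j \<Longrightarrow> j \<noteq> k \<Longrightarrow> l = k' \<Longrightarrow> j' \<noteq> k' \<Longrightarrow> e j k j' k' l = 0"
    unfolding e_def pair_factor_def using mom(3) by (auto simp: power2_eq_square)
  show "j = k \<Longrightarrow> j' = k' \<Longrightarrow> j \<noteq> j' \<Longrightarrow> l = j \<Longrightarrow> e j k j' k' l = 0"
    unfolding e_def pair_factor_def using E1 by (auto simp del: of_real_diff of_real_power)
qed

text \<open>Circular symmetry separates the pair (j, k) from (k, j), whose moment contains E Z^2 =
  0. Diagonal and off-diagonal products have the same norm because the variance of |Z|^2 is v^2, so
  they can be treated as one orthogonal family.\<close>

lemma centred_products_orthogonal: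
  fixes z :: "nat \<Rightarrow> 'a \<Rightarrow> complex"
  assumes ind: "indep_vars (\<lambda>_. borel) z {..<m}" and g: "\<And>l. l < m \<Longrightarrow> circ_gaussian M v (z l)" and v: "v > 0"
    and lt: "j < m" "k < m" "j' < m" "k' < m"
  defines "Y \<equiv> \<lambda>j k \<omega>. z j \<omega> * cnj (z k \<omega>) - (if j = k then of_real v else 0)"
  shows "integrable M (\<lambda>\<omega>. Y j k \<omega> * cnj (Y j' k' \<omega>))"
    and "expectation (\<lambda>\<omega>. Y j k \<omega> * cnj (Y j' k' \<omega>)) = (if j = j' \<and> k = k' then of_real (v\<^sup>2) else 0)"
proof -
  have zm: "z l \<in> borel_measurable M" if "l < m" for l using ind that by (simp add: indep_vars_def)
  define W where "W l \<omega> = pair_factor v j k l (z l \<omega>) * cnj (pair_factor v j' k' l (z l \<omega>))" for l \<omega>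
  have Yeq: "Y j k \<omega> * cnj (Y j' k' \<omega>) = (\<Prod>l<m. W l \<omega>)" for \<omega>
    unfolding Y_def W_def prod.distrib prod_pair_factor[OF lt(1,2)] cnj_prod[symmetric] prod_pair_factor[OF lt(3,4)] ..
  have cn: "(\<lambda>z. cnj z) \<in> borel_measurable borel"
    by (intro borel_measurable_continuous_onI continuous_intros)
  have pm: "pair_factor v j k l \<in> borel_measurable borel" for j k l
  proof -
    have "(\<lambda>z. complex_of_real ((cmod z)\<^sup>2 - v)) \<in> borel_measurable borel" by simp
    then show ?thesis using cn unfolding pair_factor_def by (cases "j = k"; cases "l = j"; cases "l = k") simp_all
  qed
  have indW: "indep_vars (\<lambda>_. borel) W {..<m}"
    unfolding W_def
    by (rule indep_vars_compose2[OF ind]) (intro borel_measurable_times pm measurable_compose[OF pm cn])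
  have intW: "integrable M (W l)" if "l \<in> {..<m}" for l
    unfolding W_def using that by (intro pair_factor_moments(1)[OF g v zm]) auto
  show "integrable M (\<lambda>\<omega>. Y j k \<omega> * cnj (Y j' k' \<omega>))"
    unfolding Yeq by (rule indep_vars_integrable[OF finite_lessThan indW intW])
  have E: "expectation (\<lambda>\<omega>. Y j k \<omega> * cnj (Y j' k' \<omega>)) = (\<Prod>l<m. expectation (W l))"
    unfolding Yeq by (rule indep_vars_lebesgue_integral[OF finite_lessThan indW intW])
  show "expectation (\<lambda>\<omega>. Y j k \<omega> * cnj (Y j' k' \<omega>)) = (if j = j' \<and> k = k' then of_real (v\<^sup>2) else 0)"
  proof (cases "j = j' \<and> k = k'")
    case True
    have "(\<Prod>l<m. expectation (W l)) = (\<Prod>l<m. if j = k then if l = j then of_real (v\<^sup>2) else 1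
            else if l = j then of_real v else if l = k then of_real v else 1)"
      unfolding W_def using True by (intro prod.cong refl) (use pair_factor_moments(2)[OF g v zm] in auto)
    also have "\<dots> = of_real (v\<^sup>2)"
    proof (cases "j = k")
      case False
      then show ?thesis using prod_if_two[OF lt(1,2) False, of "\<lambda>_. complex_of_real v" "\<lambda>_. complex_of_real v"]
        by (simp add: power2_eq_square)
    qed (use lt in simp)
    finally show ?thesis using E True by simp
  next
    case False
    note pf = pair_factor_moments[OF g v zm, folded W_def]
    \<comment> \<open>The cases look for a coordinate of one pair that the other pair misses; if the
      pairs are swapped, the coordinate j yields E Z^2.\<close>
    have "\<exists>l<m. expectation (W l) = 0"
    proof (cases "j = k")
      case 1: True
      show ?thesis
      proof (cases "j' = k'")
        case True
        then show ?thesis using 1 False lt pf(8)[of j j k j' k'] unfolding W_def by auto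
      next
        case 2: False
        then have "j' \<noteq> j \<or> k' \<noteq> j" by auto
        then show ?thesis using 1 2 lt pf(5)[of j' j' j' k' j k] pf(6)[of k' k' k' j' j k] unfolding W_def by auto
      qed
    next
      case 1: False
      show ?thesis
      proof (cases "j' = k'")
        case True
        then have "j' \<noteq> j \<or> j' \<noteq> k" using 1 by auto
        then show ?thesis using 1 True lt pf(3)[of j j j k j' k'] pf(4)[of k k k j j' k'] unfolding W_def by auto
      next
        case 2: False
        show ?thesis
        proof (cases "j = k'")
          case True
          then show ?thesis using 1 2 lt pf(7)[of j j j k k' j'] unfolding W_def by auto
        next
          case 3: False
          show ?thesis
          proof (cases "j = j'")
            case True
            then have "k \<noteq> k'" using False by auto
            then show ?thesis using 1 2 True lt pf(4)[of k k k j j' k'] unfolding W_def by auto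
          next
            case False
            then show ?thesis using 1 2 3 lt pf(3)[of j j j k j' k'] unfolding W_def by auto
          qed
        qed
      qed
    qed
    then have "(\<Prod>l<m. expectation (W l)) = 0" by (simp add: prod_zero_iff) auto
    then show ?thesis unfolding E using False by (simp only: if_False)
  qed
qed

end

subsection \<open>Concentration\<close>

text \<open>Integrating out coordinate i gives a function \<open>g\<close> of the remaining
  coordinates with the same bound and the same differences, to which induction applies. The
  fluctuation of f around g along a fibre is controlled by Hoeffding's lemma, one factor per
  coordinate.\<close>

lemma bounded_differences_mgf:
  fixes N :: "'i \<Rightarrow> 'b measure" and f :: "('i \<Rightarrow> 'b) \<Rightarrow> real"
  assumes prob: "\<And>i. prob_space (N i)" and l: "l > 0" and d: "d \<ge> 0" and I: "finite I"
    and f: "f \<in> borel_measurable (PiM I N)"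
    and bnd: "\<And>x. x \<in> space (PiM I N) \<Longrightarrow> \<bar>f x\<bar> \<le> C"
    and diff: "\<And>x i y. x \<in> space (PiM I N) \<Longrightarrow> i \<in> I \<Longrightarrow> y \<in> space (N i) \<Longrightarrow> \<bar>f x - f (x(i := y))\<bar> \<le> d"
  shows "(\<integral>\<^sup>+x. exp (l * (f x - (\<integral>x. f x \<partial>PiM I N))) \<partial>PiM I N) \<le> exp (l\<^sup>2 * d\<^sup>2 / 2 * card I)"
  using I f bnd diff
proof (induction I arbitrary: f rule: finite_induct)
  case empty
  interpret product_prob_space N "{}" by (intro product_prob_spaceI prob)
  show ?case by (simp add: PiM_empty lebesgue_integral_count_space_finite nn_integral_count_space_finite)
next
  case (insert i I)
  interpret product_prob_space N "insert i I" by (intro product_prob_spaceI prob)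
  have Q': "finite_measure (PiM (insert i I) N)"
    by (intro prob_space.finite_measure prob_space_PiM prob)
  note I = insert.hyps and f = insert.prems(1) and bnd = insert.prems(2) and diff = insert.prems(3)
  have upd: "x(i := y) \<in> space (PiM (insert i I) N)" if "x \<in> space (PiM I N)" "y \<in> space (N i)" for x y
    using that by (auto simp: space_PiM PiE_iff extensional_def)
  have fm: "(\<lambda>(x, y). f (x(i := y))) \<in> borel_measurable (PiM I N \<Otimes>\<^sub>M N i)"
    using measurable_compose[OF measurable_add_dim f] by (simp add: case_prod_unfold fun_upd_def)
  have fm1: "(\<lambda>y. f (x(i := y))) \<in> borel_measurable (N i)" if "x \<in> space (PiM I N)" for x
    using measurable_compose[OF measurable_Pair1'[OF that] fm] by simp
  define g where "g x = (\<integral>y. f (x(i := y)) \<partial>N i)" for x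
  have gm: "g \<in> borel_measurable (PiM I N)"
    unfolding g_def using fm by (intro M.borel_measurable_lebesgue_integral)
  have int1: "integrable (N i) (\<lambda>y. f (x(i := y)))" if "x \<in> space (PiM I N)" for x
    by (rule M.integrable_const_bound[where B = C]) (use bnd upd that fm1 in \<open>auto intro!: AE_I2\<close>)
  have intf: "integrable (PiM (insert i I) N) f"
    by (rule finite_measure.integrable_const_bound[OF Q', where B = C]) (use bnd f in \<open>auto intro!: AE_I2\<close>)
  have Eg: "(\<integral>x. f x \<partial>PiM (insert i I) N) = (\<integral>x. g x \<partial>PiM I N)"
    unfolding g_def by (rule product_integral_insert[OF I intf])
  have gb: "\<bar>g x\<bar> \<le> C" if x: "x \<in> space (PiM I N)" for x
  proof -
    have "\<bar>g x\<bar> \<le> (\<integral>y. \<bar>f (x(i := y))\<bar> \<partial>N i)" unfolding g_def by (rule integral_abs_bound)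
    also have "\<dots> \<le> (\<integral>y. C \<partial>N i)" using int1[OF x] bnd upd[OF x]
      by (intro integral_mono) auto
    finally show ?thesis by (simp add: M.prob_space)
  qed
  have gd: "\<bar>g x - g (x(j := z))\<bar> \<le> d" if x: "x \<in> space (PiM I N)" and j: "j \<in> I" and z: "z \<in> space (N j)" for x j z
  proof -
    have x': "x(j := z) \<in> space (PiM I N)" using x j z by (auto simp: space_PiM PiE_iff extensional_def)
    have "g x - g (x(j := z)) = (\<integral>y. f (x(i := y)) - f (x(j := z, i := y)) \<partial>N i)"
      unfolding g_def using int1[OF x] int1[OF x'] by (rule Bochner_Integration.integral_diff[symmetric])
    also have "\<bar>\<dots>\<bar> \<le> (\<integral>y. \<bar>f (x(i := y)) - f (x(j := z, i := y))\<bar> \<partial>N i)" by (rule integral_abs_bound)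
    also have "\<dots> \<le> (\<integral>y. d \<partial>N i)"
    proof (rule integral_mono)
      show "integrable (N i) (\<lambda>y. \<bar>f (x(i := y)) - f (x(j := z, i := y))\<bar>)"
        using int1[OF x] int1[OF x'] by simp
      fix y assume y: "y \<in> space (N i)"
      have eq: "x(j := z, i := y) = x(i := y, j := z)" using j I by (auto simp: fun_upd_twist)
      have "j \<in> insert i I" using j by simp
      from diff[OF upd[OF x y] this z] show "\<bar>f (x(i := y)) - f (x(j := z, i := y))\<bar> \<le> d"
        unfolding eq .
    qed simp
    finally show ?thesis by (simp add: M.prob_space)
  qed
  define E where "E = (\<integral>x. g x \<partial>PiM I N)"
  have IH: "(\<integral>\<^sup>+x. exp (l * (g x - E)) \<partial>PiM I N) \<le> exp (l\<^sup>2 * d\<^sup>2 / 2 * card I)"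
    unfolding E_def by (rule insert.IH[OF gm gb gd])
  have inner: "(\<integral>\<^sup>+y. exp (l * (f (x(i := y)) - E)) \<partial>N i) \<le> ennreal (exp (l * (g x - E))) * ennreal (exp (l\<^sup>2 * d\<^sup>2 / 2))"
    if x: "x \<in> space (PiM I N)" for x
  proof -
    \<comment> \<open>Centring the fibre at a reference point gives an interval of width 2 d, which
      is where the factor exp (l^2 (2 d)^2 / 8) = exp (l^2 d^2 / 2) comes from.\<close>
    obtain y0 where y0: "y0 \<in> space (N i)" using M.not_empty by blast
    define c where "c = f (x(i := y0))"
    have "\<bar>f (x(i := y0)) - f (x(i := y))\<bar> \<le> d" if "y \<in> space (N i)" for y
      using diff[OF upd[OF x y0] insertI1 that] unfolding fun_upd_upd .
    then have rng: "AE y in N i. f (x(i := y)) \<in> {c - d..c + d}"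
      by (intro AE_I2) (auto simp: c_def abs_le_iff algebra_simps)
    interpret h: interval_bounded_random_variable "N i" "\<lambda>y. f (x(i := y))" "c - d" "c + d"
      by unfold_locales (use fm1[OF x] rng in auto)
    have "(\<integral>\<^sup>+y. exp (l * (f (x(i := y)) - E)) \<partial>N i) =
        (\<integral>\<^sup>+y. ennreal (exp (l * (g x - E))) * ennreal (exp (l * (f (x(i := y)) - g x))) \<partial>N i)"
      by (intro nn_integral_cong) (simp add: ennreal_mult[symmetric] exp_add[symmetric] algebra_simps)
    also have "\<dots> = ennreal (exp (l * (g x - E))) * (\<integral>\<^sup>+y. ennreal (exp (l * (f (x(i := y)) - g x))) \<partial>N i)"
      using fm1[OF x] by (intro nn_integral_cmult) measurable
    also have "\<dots> \<le> ennreal (exp (l * (g x - E))) * ennreal (exp (l\<^sup>2 * d\<^sup>2 / 2))"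
    proof (rule mult_left_mono)
      have "(\<integral>\<^sup>+y. ennreal (exp (l * (f (x(i := y)) - g x))) \<partial>N i) \<le> ennreal (exp (l\<^sup>2 * (c + d - (c - d))\<^sup>2 / 8))"
        unfolding g_def by (rule h.Hoeffdings_lemma_nn_integral[OF l])
      also have "l\<^sup>2 * (c + d - (c - d))\<^sup>2 / 8 = l\<^sup>2 * d\<^sup>2 / 2" by (simp add: power2_eq_square)
      finally show "(\<integral>\<^sup>+y. ennreal (exp (l * (f (x(i := y)) - g x))) \<partial>N i) \<le> ennreal (exp (l\<^sup>2 * d\<^sup>2 / 2))" .
    qed simp
    finally show ?thesis .
  qed
  have "(\<integral>\<^sup>+x. exp (l * (f x - E)) \<partial>PiM (insert i I) N) =
      (\<integral>\<^sup>+x. (\<integral>\<^sup>+y. exp (l * (f (x(i := y)) - E)) \<partial>N i) \<partial>PiM I N)"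
  proof (rule product_nn_integral_insert[OF I])
    show "(\<lambda>x. ennreal (exp (l * (f x - E)))) \<in> borel_measurable (PiM (insert i I) N)" using f by simp
  qed
  also have "\<dots> \<le> (\<integral>\<^sup>+x. ennreal (exp (l * (g x - E))) * ennreal (exp (l\<^sup>2 * d\<^sup>2 / 2)) \<partial>PiM I N)"
    by (intro nn_integral_mono inner)
  also have "\<dots> = (\<integral>\<^sup>+x. ennreal (exp (l * (g x - E))) \<partial>PiM I N) * ennreal (exp (l\<^sup>2 * d\<^sup>2 / 2))"
    using gm by (intro nn_integral_multc) simp
  also have "\<dots> \<le> ennreal (exp (l\<^sup>2 * d\<^sup>2 / 2 * card I)) * ennreal (exp (l\<^sup>2 * d\<^sup>2 / 2))"
    by (intro mult_right_mono IH) simp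
  also have "\<dots> = ennreal (exp (l\<^sup>2 * d\<^sup>2 / 2 * card (insert i I)))"
    using I by (simp add: ennreal_mult[symmetric] exp_add[symmetric] algebra_simps)
  finally show ?case unfolding Eg E_def .
qed

text \<open>Chernoff's method: Markov's inequality for the exponential moment just bounded.\<close>

lemma bounded_differences_upper_tail:
  fixes N :: "'i \<Rightarrow> 'b measure" and f :: "('i \<Rightarrow> 'b) \<Rightarrow> real"
  assumes prob: "\<And>i. prob_space (N i)" and d: "d > 0" and I: "finite I" "I \<noteq> {}"
    and f: "f \<in> borel_measurable (PiM I N)"
    and bnd: "\<And>x. x \<in> space (PiM I N) \<Longrightarrow> \<bar>f x\<bar> \<le> C"
    and diff: "\<And>x i y. x \<in> space (PiM I N) \<Longrightarrow> i \<in> I \<Longrightarrow> y \<in> space (N i) \<Longrightarrow> \<bar>f x - f (x(i := y))\<bar> \<le> d"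
    and e: "\<epsilon> > 0"
  shows "measure (PiM I N) {x \<in> space (PiM I N). \<epsilon> \<le> f x - (\<integral>x. f x \<partial>PiM I N)} \<le> exp (- \<epsilon>\<^sup>2 / (2 * d\<^sup>2 * card I))"
proof -
  interpret Q: prob_space "PiM I N" by (intro prob_space_PiM prob)
  define E where "E = (\<integral>x. f x \<partial>PiM I N)"
  define n where "n = real (card I)"
  have n: "n > 0" using I by (simp add: n_def card_gt_0_iff)
  \<comment> \<open>The minimiser of - l \<epsilon> + l^2 d^2 n / 2.\<close>
  define l where "l = \<epsilon> / (d\<^sup>2 * n)"
  have l: "l > 0" using e d n by (simp add: l_def)
  let ?A = "{x \<in> space (PiM I N). \<epsilon> \<le> f x - E}"
  have "emeasure (PiM I N) ?A \<le> emeasure (PiM I N) {x \<in> space (PiM I N). 1 \<le> ennreal (exp (- (l * \<epsilon>))) * ennreal (exp (l * (f x - E)))}"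
  proof (rule emeasure_mono)
    show "?A \<subseteq> {x \<in> space (PiM I N). 1 \<le> ennreal (exp (- (l * \<epsilon>))) * ennreal (exp (l * (f x - E)))}"
    proof safe
      fix x assume "\<epsilon> \<le> f x - E"
      then have "l * \<epsilon> \<le> l * (f x - E)" using l by (intro mult_left_mono) auto
      then show "1 \<le> ennreal (exp (- (l * \<epsilon>))) * ennreal (exp (l * (f x - E)))"
        by (simp add: ennreal_mult[symmetric] exp_add[symmetric])
    qed
    show "{x \<in> space (PiM I N). 1 \<le> ennreal (exp (- (l * \<epsilon>))) * ennreal (exp (l * (f x - E)))} \<in> sets (PiM I N)"
      using f by measurable
  qed
  also have "\<dots> \<le> ennreal (exp (- (l * \<epsilon>))) * (\<integral>\<^sup>+x. ennreal (exp (l * (f x - E))) * indicator (space (PiM I N)) x \<partial>PiM I N)"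
  proof -
    have "(\<lambda>x. ennreal (exp (l * (f x - E))) * indicator (space (PiM I N)) x) \<in> borel_measurable (PiM I N)"
      using f by measurable
    from nn_integral_Markov_inequality[OF this sets.top, of "ennreal (exp (- (l * \<epsilon>)))"]
    show ?thesis .
  qed
  also have "(\<integral>\<^sup>+x. ennreal (exp (l * (f x - E))) * indicator (space (PiM I N)) x \<partial>PiM I N) = (\<integral>\<^sup>+x. ennreal (exp (l * (f x - E))) \<partial>PiM I N)"
    by (intro nn_integral_cong) simp
  also have "\<dots> \<le> exp (l\<^sup>2 * d\<^sup>2 / 2 * card I)"
    unfolding E_def using d by (intro bounded_differences_mgf[OF prob l _ I(1) f bnd diff]) auto
  finally have "emeasure (PiM I N) ?A \<le> ennreal (exp (- (l * \<epsilon>))) * ennreal (exp (l\<^sup>2 * d\<^sup>2 / 2 * card I))"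
    by (simp add: mult_left_mono)
  also have "\<dots> = ennreal (exp (- (l * \<epsilon>) + l\<^sup>2 * d\<^sup>2 / 2 * n))"
    by (simp add: ennreal_mult[symmetric] exp_add[symmetric] n_def)
  also have "- (l * \<epsilon>) + l\<^sup>2 * d\<^sup>2 / 2 * n = - \<epsilon>\<^sup>2 / (2 * d\<^sup>2 * n)"
    using d n by (simp add: l_def field_simps power2_eq_square)
  finally show ?thesis
    unfolding E_def n_def Q.emeasure_eq_measure by simp
qed

lemma bounded_differences_inequality:
  fixes N :: "'i \<Rightarrow> 'b measure" and f :: "('i \<Rightarrow> 'b) \<Rightarrow> real"
  assumes prob: "\<And>i. prob_space (N i)" and d: "d > 0" and I: "finite I" "I \<noteq> {}"
    and f: "f \<in> borel_measurable (PiM I N)"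
    and bnd: "\<And>x. x \<in> space (PiM I N) \<Longrightarrow> \<bar>f x\<bar> \<le> C"
    and diff: "\<And>x i y. x \<in> space (PiM I N) \<Longrightarrow> i \<in> I \<Longrightarrow> y \<in> space (N i) \<Longrightarrow> \<bar>f x - f (x(i := y))\<bar> \<le> d"
    and e: "\<epsilon> > 0"
  shows "measure (PiM I N) {x \<in> space (PiM I N). \<epsilon> \<le> \<bar>f x - (\<integral>x. f x \<partial>PiM I N)\<bar>} \<le> 2 * exp (- \<epsilon>\<^sup>2 / (2 * d\<^sup>2 * card I))"
proof -
  interpret Q: prob_space "PiM I N" by (intro prob_space_PiM prob)
  define E where "E = (\<integral>x. f x \<partial>PiM I N)"
  define A where "A = {x \<in> space (PiM I N). \<epsilon> \<le> f x - E}"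
  define B where "B = {x \<in> space (PiM I N). \<epsilon> \<le> - f x - (- E)}"
  have fm: "(\<lambda>x. - f x) \<in> borel_measurable (PiM I N)" using f by simp
  have AB: "A \<in> sets (PiM I N)" "B \<in> sets (PiM I N)" unfolding A_def B_def using f by measurable
  have A: "measure (PiM I N) A \<le> exp (- \<epsilon>\<^sup>2 / (2 * d\<^sup>2 * card I))"
    unfolding A_def E_def by (rule bounded_differences_upper_tail[OF prob d I f bnd diff e])
  have bnd': "\<bar>- f x\<bar> \<le> C" if "x \<in> space (PiM I N)" for x using bnd[OF that] by simp
  have diff': "\<bar>- f x - - f (x(i := y))\<bar> \<le> d"
    if "x \<in> space (PiM I N)" "i \<in> I" "y \<in> space (N i)" for x i y
    using diff[OF that] by (simp add: abs_minus_commute)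
  have E': "(\<integral>x. - f x \<partial>PiM I N) = - E" by (simp add: E_def)
  have B: "measure (PiM I N) B \<le> exp (- \<epsilon>\<^sup>2 / (2 * d\<^sup>2 * card I))"
    unfolding B_def E'[symmetric] by (rule bounded_differences_upper_tail[OF prob d I fm bnd' diff' e])
  have "{x \<in> space (PiM I N). \<epsilon> \<le> \<bar>f x - E\<bar>} \<subseteq> A \<union> B"
    by (auto simp: A_def B_def abs_if split: if_splits)
  then have "measure (PiM I N) {x \<in> space (PiM I N). \<epsilon> \<le> \<bar>f x - E\<bar>} \<le> measure (PiM I N) (A \<union> B)"
    using AB by (intro Q.finite_measure_mono) auto
  also have "\<dots> \<le> measure (PiM I N) A + measure (PiM I N) B"
    using AB by (intro measure_Un_le)
  finally show ?thesis using A B by (simp add: E_def)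
qed

text \<open>Independence says that the joint law is the product of the marginal laws, so the
  product-space inequality is transported along the joint map.\<close>

lemma (in prob_space) bounded_differences_indep_vars:
  fixes N :: "'i \<Rightarrow> 'b measure" and R :: "'i \<Rightarrow> 'a \<Rightarrow> 'b" and f :: "('i \<Rightarrow> 'b) \<Rightarrow> real"
  assumes ind: "indep_vars N R I" and d: "d > 0" and I: "finite I" "I \<noteq> {}"
    and f: "f \<in> borel_measurable (PiM I N)"
    and bnd: "\<And>x. x \<in> space (PiM I N) \<Longrightarrow> \<bar>f x\<bar> \<le> C"
    and diff: "\<And>x i y. x \<in> space (PiM I N) \<Longrightarrow> i \<in> I \<Longrightarrow> y \<in> space (N i) \<Longrightarrow> \<bar>f x - f (x(i := y))\<bar> \<le> d"
    and e: "\<epsilon> > 0"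
  defines "F \<equiv> \<lambda>\<omega>. f (\<lambda>i\<in>I. R i \<omega>)"
  shows "F \<in> borel_measurable M"
    and "prob {\<omega> \<in> space M. \<epsilon> \<le> \<bar>F \<omega> - expectation F\<bar>} \<le> 2 * exp (- \<epsilon>\<^sup>2 / (2 * d\<^sup>2 * card I))"
proof -
  obtain i0 where i0: "i0 \<in> I" using I by blast
  \<comment> \<open>The product-space inequality asks for a probability measure at every index;
    outside \<open>I\<close> the marginal at \<open>i0\<close> is used as a filler.\<close>
  define D where "D i = (if i \<in> I then distr M (N i) (R i) else distr M (N i0) (R i0))" for i
  have rv: "random_variable (N i) (R i)" if "i \<in> I" for i using ind that by (simp add: indep_vars_def)
  have D: "prob_space (D i)" for i unfolding D_def using rv i0 by (auto intro!: prob_space_distr)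
  have setsD: "sets (PiM I D) = sets (PiM I N)" by (intro sets_PiM_cong) (auto simp: D_def)
  have spD: "space (PiM I D) = space (PiM I N)" by (rule sets_eq_imp_space_eq[OF setsD])
  have "distr M (PiM I N) (\<lambda>\<omega>. \<lambda>i\<in>I. R i \<omega>) = PiM I (\<lambda>i. distr M (N i) (R i))"
    using indep_vars_iff_distr_eq_PiM'[OF I(2) rv] ind by simp
  also have "\<dots> = PiM I D" by (intro PiM_cong) (auto simp: D_def)
  finally have dist: "distr M (PiM I N) (\<lambda>\<omega>. \<lambda>i\<in>I. R i \<omega>) = PiM I D" .
  have Rm: "(\<lambda>\<omega>. \<lambda>i\<in>I. R i \<omega>) \<in> measurable M (PiM I N)" using rv by (intro measurable_restrict)
  show Fm: "F \<in> borel_measurable M" unfolding F_def by (rule measurable_compose[OF Rm f])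
  have E: "(\<integral>x. f x \<partial>PiM I D) = expectation F"
    unfolding dist[symmetric] F_def by (rule integral_distr[OF Rm f])
  have fD: "f \<in> borel_measurable (PiM I D)" using f measurable_cong_sets[OF setsD refl] by blast
  have "measure (PiM I D) {x \<in> space (PiM I D). \<epsilon> \<le> \<bar>f x - (\<integral>x. f x \<partial>PiM I D)\<bar>} \<le> 2 * exp (- \<epsilon>\<^sup>2 / (2 * d\<^sup>2 * card I))"
    by (rule bounded_differences_inequality[OF D d I fD _ _ e]) (use bnd diff spD in \<open>auto simp: D_def\<close>)
  moreover have "measure (PiM I D) {x \<in> space (PiM I D). \<epsilon> \<le> \<bar>f x - (\<integral>x. f x \<partial>PiM I D)\<bar>} =
      prob {\<omega> \<in> space M. \<epsilon> \<le> \<bar>F \<omega> - expectation F\<bar>}"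
  proof -
    have "{x \<in> space (PiM I N). \<epsilon> \<le> \<bar>f x - expectation F\<bar>} \<in> sets (PiM I N)" using f by measurable
    then have "measure (distr M (PiM I N) (\<lambda>\<omega>. \<lambda>i\<in>I. R i \<omega>)) {x \<in> space (PiM I N). \<epsilon> \<le> \<bar>f x - expectation F\<bar>} =
      prob ((\<lambda>\<omega>. \<lambda>i\<in>I. R i \<omega>) -` {x \<in> space (PiM I N). \<epsilon> \<le> \<bar>f x - expectation F\<bar>} \<inter> space M)"
      by (intro measure_distr Rm)
    also have "(\<lambda>\<omega>. \<lambda>i\<in>I. R i \<omega>) -` {x \<in> space (PiM I N). \<epsilon> \<le> \<bar>f x - expectation F\<bar>} \<inter> space M =
        {\<omega> \<in> space M. \<epsilon> \<le> \<bar>F \<omega> - expectation F\<bar>}"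
      using measurable_space[OF Rm] by (auto simp: F_def)
    finally show ?thesis unfolding E spD dist .
  qed
  ultimately show "prob {\<omega> \<in> space M. \<epsilon> \<le> \<bar>F \<omega> - expectation F\<bar>} \<le> 2 * exp (- \<epsilon>\<^sup>2 / (2 * d\<^sup>2 * card I))"
    by simp
qed

subsection \<open>Leave-one-out estimate for the resolvent trace\<close>

lemma shifted_gram_cong:
  assumes "\<And>i j. i \<in> S \<Longrightarrow> j < m \<Longrightarrow> h i j = h' i j"
  shows "shifted_gram m x S h = shifted_gram m x S h'"
  using assms by (intro eq_matI) (auto simp: shifted_gram_def intro!: sum.cong)

lemma resolvent_cong:
  assumes "\<And>i j. i \<in> S \<Longrightarrow> j < m \<Longrightarrow> h i j = h' i j"
  shows "resolvent m x S h = resolvent m x S h'" "resolvent_trace m x S h = resolvent_trace m x S h'"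
  unfolding resolvent_trace_def resolvent_def using shifted_gram_cong[of S m h h' x] assms by simp_all

text \<open>Expanding the square and factoring by independence, orthogonality of Y leaves the
  diagonal terms w E |A_p|^2. The random coefficients thus enter only through their Frobenius
  norm.\<close>

lemma (in prob_space) second_moment_orthogonal:
  fixes A Y :: "'p \<Rightarrow> 'a \<Rightarrow> complex"
  assumes fin: "finite I"
    and ind: "\<And>p q. p \<in> I \<Longrightarrow> q \<in> I \<Longrightarrow> indep_var borel (\<lambda>\<omega>. A p \<omega> * cnj (A q \<omega>)) borel (\<lambda>\<omega>. Y p \<omega> * cnj (Y q \<omega>))"
    and intA: "\<And>p q. p \<in> I \<Longrightarrow> q \<in> I \<Longrightarrow> integrable M (\<lambda>\<omega>. A p \<omega> * cnj (A q \<omega>))"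
    and intY: "\<And>p q. p \<in> I \<Longrightarrow> q \<in> I \<Longrightarrow> integrable M (\<lambda>\<omega>. Y p \<omega> * cnj (Y q \<omega>))"
    and EY: "\<And>p q. p \<in> I \<Longrightarrow> q \<in> I \<Longrightarrow> expectation (\<lambda>\<omega>. Y p \<omega> * cnj (Y q \<omega>)) = (if p = q then of_real w else 0)"
    and w: "w \<ge> 0"
    and bnd: "\<And>\<omega>. \<omega> \<in> space M \<Longrightarrow> (\<Sum>p\<in>I. (cmod (A p \<omega>))\<^sup>2) \<le> K"
  shows "integrable M (\<lambda>\<omega>. (cmod (\<Sum>p\<in>I. A p \<omega> * Y p \<omega>))\<^sup>2)"
    and "expectation (\<lambda>\<omega>. (cmod (\<Sum>p\<in>I. A p \<omega> * Y p \<omega>))\<^sup>2) \<le> w * K"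
proof -
  define S where "S \<omega> = (cmod (\<Sum>p\<in>I. A p \<omega> * Y p \<omega>))\<^sup>2" for \<omega>
  have Seq: "complex_of_real (S \<omega>) = (\<Sum>p\<in>I. \<Sum>q\<in>I. (A p \<omega> * cnj (A q \<omega>)) * (Y p \<omega> * cnj (Y q \<omega>)))" for \<omega>
    unfolding S_def complex_norm_square cnj_sum sum_product
    by (intro sum.cong refl) (simp add: mult_ac)
  note int = indep_var_integrable[OF ind intA intY]
  have intS: "integrable M (\<lambda>\<omega>. complex_of_real (S \<omega>))"
    unfolding Seq by (intro Bochner_Integration.integrable_sum int)
  then show "integrable M (\<lambda>\<omega>. (cmod (\<Sum>p\<in>I. A p \<omega> * Y p \<omega>))\<^sup>2)"
    unfolding S_def[symmetric] by (simp only: complex_of_real_integrable_eq)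
  have cn: "complex_of_real ((cmod (A p \<omega>))\<^sup>2) = A p \<omega> * cnj (A p \<omega>)" for p \<omega>
    by (rule complex_norm_square)
  have intA2: "integrable M (\<lambda>\<omega>. (cmod (A p \<omega>))\<^sup>2)" if "p \<in> I" for p
    using intA[OF that that] unfolding cn[symmetric] by (simp only: complex_of_real_integrable_eq)
  have "complex_of_real (expectation S) = expectation (\<lambda>\<omega>. complex_of_real (S \<omega>))" by simp
  also have "\<dots> = (\<Sum>p\<in>I. \<Sum>q\<in>I. expectation (\<lambda>\<omega>. (A p \<omega> * cnj (A q \<omega>)) * (Y p \<omega> * cnj (Y q \<omega>))))"
    unfolding Seq by (subst Bochner_Integration.integral_sum) (auto intro!: int sum.cong Bochner_Integration.integral_sum)
  also have "\<dots> = (\<Sum>p\<in>I. \<Sum>q\<in>I. expectation (\<lambda>\<omega>. A p \<omega> * cnj (A q \<omega>)) * (if p = q then of_real w else 0))"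
    by (intro sum.cong refl) (simp only: indep_var_lebesgue_integral[OF ind intA intY] EY)
  also have "\<dots> = (\<Sum>p\<in>I. \<Sum>q\<in>I. if p = q then expectation (\<lambda>\<omega>. A p \<omega> * cnj (A q \<omega>)) * of_real w else 0)"
    by (intro sum.cong refl) auto
  also have "\<dots> = (\<Sum>p\<in>I. expectation (\<lambda>\<omega>. A p \<omega> * cnj (A p \<omega>)) * of_real w)"
    using fin by (intro sum.cong refl) simp
  also have "\<dots> = complex_of_real ((\<Sum>p\<in>I. expectation (\<lambda>\<omega>. (cmod (A p \<omega>))\<^sup>2)) * w)"
    unfolding cn[symmetric] integral_complex_of_real by (simp add: sum_distrib_right)
  finally have eq: "expectation S = (\<Sum>p\<in>I. expectation (\<lambda>\<omega>. (cmod (A p \<omega>))\<^sup>2)) * w"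
    by (simp only: of_real_eq_iff)
  have "(\<Sum>p\<in>I. expectation (\<lambda>\<omega>. (cmod (A p \<omega>))\<^sup>2)) = expectation (\<lambda>\<omega>. \<Sum>p\<in>I. (cmod (A p \<omega>))\<^sup>2)"
    by (intro Bochner_Integration.integral_sum[symmetric] intA2)
  also have "\<dots> \<le> expectation (\<lambda>\<omega>. K)"
    by (intro integral_mono Bochner_Integration.integrable_sum intA2 bnd) auto
  finally have "(\<Sum>p\<in>I. expectation (\<lambda>\<omega>. (cmod (A p \<omega>))\<^sup>2)) \<le> K" by (simp add: prob_space)
  then have "expectation S \<le> K * w" unfolding eq using w by (rule mult_right_mono)
  then show "expectation (\<lambda>\<omega>. (cmod (\<Sum>p\<in>I. A p \<omega> * Y p \<omega>))\<^sup>2) \<le> w * K"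
    by (simp add: S_def[abs_def] mult.commute)
qed

lemma abs_ratio_diff_le:
  fixes p q :: real
  assumes "p \<ge> 0" "q \<ge> 0"
  shows "\<bar>p / (1 + p) - q / (1 + q)\<bar> \<le> \<bar>p - q\<bar>"
proof -
  have "p / (1 + p) - q / (1 + q) = (p - q) / ((1 + p) * (1 + q))"
    using assms by (simp add: field_simps)
  moreover have "1 \<le> (1 + p) * (1 + q)" using assms by (simp add: algebra_simps)
  moreover from this have "\<bar>p - q\<bar> / ((1 + p) * (1 + q)) \<le> \<bar>p - q\<bar> / 1"
    by (intro divide_left_mono) auto
  ultimately show ?thesis using assms by simp
qed

lemma ratio_mono:
  fixes p q :: real
  assumes "0 \<le> p" "p \<le> q" shows "p / (1 + p) \<le> q / (1 + q)"
  using assms by (simp add: field_simps)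

text \<open>Stability of the fixed point: t \<mapsto> x t + c t / (1 + t) is a sum of increasing
  maps, so its increments dominate those of x t. Exchanging c0 for c costs |c - c0| because g / (1 +
  g) \<le> 1.\<close>

lemma fixed_point_distance:
  fixes G g x c c0 :: real
  assumes "x > 0" "c \<ge> 0" "G \<ge> 0" "g \<ge> 0" and g: "(1 - x * g) - c0 * (g / (1 + g)) = 0"
  shows "\<bar>G - g\<bar> \<le> (\<bar>(1 - x * G) - c * (G / (1 + G))\<bar> + \<bar>c - c0\<bar>) / x"
proof -
  let ?\<phi> = "\<lambda>t::real. t / (1 + t)"
  have mono: "(G - g) * (?\<phi> G - ?\<phi> g) \<ge> 0"
    using assms ratio_mono[of G g] ratio_mono[of g G] by (cases "G \<le> g") (auto simp: mult_nonpos_nonpos)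
  have phi: "0 \<le> ?\<phi> g" "?\<phi> g \<le> 1" using assms by (auto simp: field_simps)
  have eq: "(1 - x * G) - c * ?\<phi> G - (1 - x * g - c * ?\<phi> g) = - (x * (G - g) + c * (?\<phi> G - ?\<phi> g))"
    by (simp add: algebra_simps)
  have "x * \<bar>G - g\<bar> \<le> \<bar>x * (G - g) + c * (?\<phi> G - ?\<phi> g)\<bar>"
  proof (cases "G \<le> g")
    case True
    then have "?\<phi> G \<le> ?\<phi> g" using assms ratio_mono[of G g] by simp
    then have "c * (?\<phi> G - ?\<phi> g) \<le> 0" using assms(2) by (simp add: mult_nonneg_nonpos)
    moreover have "x * (G - g) \<le> 0" using True assms(1) by (simp add: mult_nonneg_nonpos)
    moreover have "x * \<bar>G - g\<bar> = - (x * (G - g))" using True by (simp add: abs_if algebra_simps)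
    ultimately show ?thesis by linarith
  next
    case False
    then have "?\<phi> g \<le> ?\<phi> G" using assms ratio_mono[of g G] by simp
    then have "c * (?\<phi> G - ?\<phi> g) \<ge> 0" using assms(2) by simp
    moreover have "x * (G - g) \<ge> 0" using False assms(1) by simp
    moreover have "x * \<bar>G - g\<bar> = x * (G - g)" using False by simp
    ultimately show ?thesis by linarith
  qed
  also have "\<dots> = \<bar>(1 - x * G) - c * ?\<phi> G - (1 - x * g - c * ?\<phi> g)\<bar>" unfolding eq by (rule abs_minus_cancel[symmetric])
  also have "1 - x * g - c * ?\<phi> g = (c0 - c) * ?\<phi> g"
  proof -
    have "1 - x * g - c * t = (c0 - c) * t" if "(1 - x * g) - c0 * t = 0" for t
      using that by (simp add: algebra_simps)
    from this[OF g] show ?thesis .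
  qed
  also have "\<bar>(1 - x * G) - c * ?\<phi> G - (c0 - c) * ?\<phi> g\<bar> \<le> \<bar>(1 - x * G) - c * ?\<phi> G\<bar> + \<bar>(c0 - c) * ?\<phi> g\<bar>"
    by (rule abs_triangle_ineq4)
  also have "\<bar>(c0 - c) * ?\<phi> g\<bar> = \<bar>c0 - c\<bar> * ?\<phi> g"
    unfolding abs_mult abs_of_nonneg[OF phi(1)] ..
  also have "\<dots> \<le> \<bar>c - c0\<bar> * 1"
    unfolding abs_minus_commute[of c0 c] by (rule mult_left_mono[OF phi(2) abs_ge_zero])
  finally show ?thesis using assms(1) by (simp add: field_simps)
qed

definition entry :: "('a \<Rightarrow> complex mat) \<Rightarrow> 'a \<Rightarrow> nat \<Rightarrow> nat \<Rightarrow> complex" where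
  "entry H \<omega> i j = H \<omega> $$ (i, j)"

definition empirical_stieltjes :: "nat \<Rightarrow> nat \<Rightarrow> ('a \<Rightarrow> complex mat) \<Rightarrow> real \<Rightarrow> 'a \<Rightarrow> real" where
  "empirical_stieltjes n m H x \<omega> = resolvent_trace m x {..<n} (entry H \<omega>) / m"

context prob_space
begin

context
  fixes n m :: nat and H :: "'a \<Rightarrow> complex mat" and x :: real
  assumes iid: "iid_gaussian_matrix M n m (1 / real m) H" and m: "m > 0" and x: "x > 0"
begin

lemma entries_indep: "indep_vars (\<lambda>_. borel) (\<lambda>p \<omega>. entry H \<omega> (fst p) (snd p)) ({..<n} \<times> {..<m})"
  using iid by (simp add: iid_gaussian_matrix_def entry_def)

lemma entry_measurable: "i < n \<Longrightarrow> j < m \<Longrightarrow> (\<lambda>\<omega>. entry H \<omega> i j) \<in> borel_measurable M"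
  using entries_indep by (force simp: indep_vars_def)

lemma entry_gaussian: "i < n \<Longrightarrow> j < m \<Longrightarrow> circ_gaussian M (1 / real m) (\<lambda>\<omega>. entry H \<omega> i j)"
  using iid by (simp add: iid_gaussian_matrix_def entry_def)

text \<open>The deviation is the real part of a sum of resolvent entries times centred products of
  row i. The resolvent omits that row, hence is independent of it; the second moment is at most
  (1/m)^2 times the Frobenius bound m / x^2.\<close>

lemma quad_form_deviation:
  assumes i: "i < n"
  defines "T \<equiv> {..<n} - {i}"
  defines "D \<equiv> \<lambda>\<omega>. Re (quad_form m (resolvent m x T (entry H \<omega>)) (\<lambda>k. cnj (entry H \<omega> i k)))
      - resolvent_trace m x T (entry H \<omega>) / m"
  shows "integrable M (\<lambda>\<omega>. \<bar>D \<omega>\<bar>)" "expectation (\<lambda>\<omega>. \<bar>D \<omega>\<bar>) \<le> 1 / (x * sqrt m)"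
proof -
  define I where "I = {..<m} \<times> {..<m}"
  define A where "A p \<omega> = resolvent m x T (entry H \<omega>) $$ p" for p \<omega>
  define Y where "Y p \<omega> = entry H \<omega> i (fst p) * cnj (entry H \<omega> i (snd p)) - (if fst p = snd p then of_real (1 / m) else 0)" for p \<omega>
  have finT: "finite T" by (simp add: T_def)
  have cn: "(\<lambda>z. cnj z) \<in> borel_measurable borel"
    by (intro borel_measurable_continuous_onI continuous_intros)
  have Am: "A p \<in> borel_measurable M" if "p \<in> I" for p
    unfolding A_def using that by (cases p) (auto simp: I_def T_def intro!: borel_measurable_resolvent entry_measurable)
  have Ab: "cmod (A p \<omega>) \<le> 1 / x" if "p \<in> I" for p \<omega>
    unfolding A_def using that by (cases p) (auto simp: I_def intro!: norm_resolvent_le finT x)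
  \<comment> \<open>Singleton blocks of entries serve to reindex the independent family from
    positions (i, l) to column numbers l.\<close>
  have rowm: "indep_vars (\<lambda>_. borel) (\<lambda>l \<omega>. entry H \<omega> i l) {..<m}"
  proof -
    have "indep_vars (\<lambda>l. PiM {(i, l)} (\<lambda>_. borel)) (\<lambda>l \<omega>. restrict (\<lambda>p. entry H \<omega> (fst p) (snd p)) {(i, l)}) {..<m}"
      by (rule indep_vars_restrict[OF entries_indep]) (use i in \<open>auto simp: disjoint_family_on_def\<close>)
    from indep_vars_compose2[OF this, of "\<lambda>l u. u (i, l)" "\<lambda>_. borel"] show ?thesis
      by (simp add: measurable_component_singleton)
  qed
  have v: "1 / real m > 0" using m by simp
  have orth1: "integrable M (\<lambda>\<omega>. Y p \<omega> * cnj (Y q \<omega>))"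
    and orth2: "expectation (\<lambda>\<omega>. Y p \<omega> * cnj (Y q \<omega>)) = (if p = q then of_real ((1 / real m)\<^sup>2) else 0)"
    if "p \<in> I" "q \<in> I" for p q
    using centred_products_orthogonal[OF rowm entry_gaussian[OF i] v, of "fst p" "snd p" "fst q" "snd q"] that
    by (auto simp: Y_def I_def prod_eq_iff)
  have ind: "indep_var borel (\<lambda>\<omega>. A p \<omega> * cnj (A q \<omega>)) borel (\<lambda>\<omega>. Y p \<omega> * cnj (Y q \<omega>))"
    if pq: "p \<in> I" "q \<in> I" for p q
  proof -
    let ?A = "T \<times> {..<m}" and ?B = "{i} \<times> {..<m}"
    let ?N1 = "PiM ?A (\<lambda>_. borel :: complex measure)" and ?N2 = "PiM ?B (\<lambda>_. borel :: complex measure)"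
    define \<phi> where "\<phi> p u = resolvent m x T (\<lambda>i j. u (i, j)) $$ p" for p and u :: "nat \<times> nat \<Rightarrow> complex"
    define \<psi> where "\<psi> p u = u (i, fst p) * cnj (u (i, snd p)) - (if fst p = snd p then of_real (1 / m) else 0)"
      for p :: "nat \<times> nat" and u :: "nat \<times> nat \<Rightarrow> complex"
    have \<phi>m: "\<phi> p \<in> borel_measurable ?N1" if "p \<in> I" for p
      unfolding \<phi>_def using that
      by (cases p) (auto simp: I_def intro!: borel_measurable_resolvent measurable_component_singleton)
    have \<psi>m: "\<psi> p \<in> borel_measurable ?N2" if "p \<in> I" for p
    proof -
      have "(\<lambda>u. u (i, fst p)) \<in> borel_measurable ?N2" "(\<lambda>u. u (i, snd p)) \<in> borel_measurable ?N2"
        using that by (auto simp: I_def intro!: measurable_component_singleton)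
      then show ?thesis unfolding \<psi>_def
        by (intro borel_measurable_diff borel_measurable_times measurable_compose[OF _ cn] borel_measurable_const)
    qed
    have ind0: "indep_var ?N1 (\<lambda>\<omega>. restrict (\<lambda>p. entry H \<omega> (fst p) (snd p)) ?A) ?N2 (\<lambda>\<omega>. restrict (\<lambda>p. entry H \<omega> (fst p) (snd p)) ?B)"
      by (rule indep_var_restrict[OF entries_indep]) (use i in \<open>auto simp: T_def\<close>)
    have "indep_var borel ((\<lambda>u. \<phi> p u * cnj (\<phi> q u)) \<circ> (\<lambda>\<omega>. restrict (\<lambda>p. entry H \<omega> (fst p) (snd p)) ?A))
        borel ((\<lambda>u. \<psi> p u * cnj (\<psi> q u)) \<circ> (\<lambda>\<omega>. restrict (\<lambda>p. entry H \<omega> (fst p) (snd p)) ?B))"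
      using pq by (intro indep_var_compose[OF ind0] borel_measurable_times \<phi>m \<psi>m measurable_compose[OF \<phi>m cn] measurable_compose[OF \<psi>m cn])
    moreover have "\<phi> p (restrict (\<lambda>p. entry H \<omega> (fst p) (snd p)) ?A) = A p \<omega>" for p \<omega>
      unfolding \<phi>_def A_def by (subst resolvent_cong(1)[of T m _ "entry H \<omega>"]) auto
    moreover have "\<psi> p (restrict (\<lambda>p. entry H \<omega> (fst p) (snd p)) ?B) = Y p \<omega>" if "p \<in> I" for p \<omega>
      using that unfolding \<psi>_def Y_def by (auto simp: I_def)
    ultimately show ?thesis using pq by (simp add: comp_def)
  qed
  have intA: "integrable M (\<lambda>\<omega>. A p \<omega> * cnj (A q \<omega>))" if "p \<in> I" "q \<in> I" for p q
  proof (rule integrable_const_bound[where B = "(1 / x) * (1 / x)"])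
    show "AE \<omega> in M. norm (A p \<omega> * cnj (A q \<omega>)) \<le> 1 / x * (1 / x)"
      using Ab that x by (intro AE_I2) (simp only: norm_mult complex_mod_cnj, intro mult_mono, auto)
    show "(\<lambda>\<omega>. A p \<omega> * cnj (A q \<omega>)) \<in> borel_measurable M"
      using that by (intro borel_measurable_times Am measurable_compose[OF Am cn])
  qed
  have frob: "(\<Sum>p\<in>I. (cmod (A p \<omega>))\<^sup>2) \<le> m / x\<^sup>2" for \<omega>
  proof -
    have "(\<Sum>p\<in>I. (cmod (A p \<omega>))\<^sup>2) = (\<Sum>k<m. \<Sum>j<m. (cmod (resolvent m x T (entry H \<omega>) $$ (j, k)))\<^sup>2)"
      unfolding I_def A_def by (subst sum.swap) (simp add: sum.cartesian_product case_prod_unfold)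
    also have "\<dots> \<le> (\<Sum>k<m. 1 / x\<^sup>2)" by (intro sum_mono sq_norm_resolvent_column finT x) auto
    finally show ?thesis by simp
  qed
  have finI: "finite I" by (simp add: I_def)
  note sm = second_moment_orthogonal[OF finI ind intA orth1 orth2 zero_le_power2 frob]
  define S where "S \<omega> = (\<Sum>p\<in>I. A p \<omega> * Y p \<omega>)" for \<omega>
  have DS: "D \<omega> = Re (S \<omega>)" for \<omega>
  proof -
    have "S \<omega> = (\<Sum>j<m. \<Sum>k<m. resolvent m x T (entry H \<omega>) $$ (j, k) * (entry H \<omega> i j * cnj (entry H \<omega> i k)))
       - (\<Sum>j<m. \<Sum>k<m. if j = k then resolvent m x T (entry H \<omega>) $$ (j, k) * of_real (1 / m) else 0)"
      unfolding S_def A_def Y_def I_def sum_subtractf[symmetric] sum.cartesian_product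
      by (intro sum.cong refl) (auto simp: algebra_simps)
    also have "(\<Sum>j<m. \<Sum>k<m. resolvent m x T (entry H \<omega>) $$ (j, k) * (entry H \<omega> i j * cnj (entry H \<omega> i k))) =
        quad_form m (resolvent m x T (entry H \<omega>)) (\<lambda>k. cnj (entry H \<omega> i k))"
      by (simp add: quad_form_def apply_mat_def sum_distrib_left mult_ac)
    also have "(\<Sum>j<m. \<Sum>k<m. if j = k then resolvent m x T (entry H \<omega>) $$ (j, k) * of_real (1 / m) else 0) =
        (\<Sum>j<m. resolvent m x T (entry H \<omega>) $$ (j, j)) * of_real (1 / m)"
      by (simp add: sum_distrib_right sum_divide_distrib)
    finally show ?thesis
      by (simp add: D_def resolvent_trace_def Re_divide_of_nat)
  qed
  have Sm: "S \<in> borel_measurable M"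
  proof -
    have "Y p \<in> borel_measurable M" if "p \<in> I" for p
      unfolding Y_def using that i
      by (intro borel_measurable_diff borel_measurable_times measurable_compose[OF _ cn] borel_measurable_const entry_measurable)
        (auto simp: I_def)
    then show ?thesis unfolding S_def[abs_def] by (intro borel_measurable_sum borel_measurable_times Am)
  qed
  have Dm: "D \<in> borel_measurable M"
  proof -
    have "Re \<in> borel_measurable borel" by (intro borel_measurable_continuous_onI continuous_intros)
    from measurable_compose[OF Sm this] show ?thesis by (simp add: DS[abs_def])
  qed
  have S2: "integrable M (\<lambda>\<omega>. (cmod (S \<omega>))\<^sup>2)" "expectation (\<lambda>\<omega>. (cmod (S \<omega>))\<^sup>2) \<le> 1 / (m * x\<^sup>2)"
    using sm m x by (auto simp: S_def power2_eq_square field_simps)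
  \<comment> \<open>The root of the second moment bound. The inequality |S| \<le> \<delta> / 2 +
    |S|^2 / (2 \<delta>) then plays the part of Cauchy--Schwarz in passing to the first
    moment.\<close>
  define \<delta> where "\<delta> = 1 / (x * sqrt m)"
  have \<delta>: "\<delta> > 0" "\<delta>\<^sup>2 = 1 / (m * x\<^sup>2)" using x m by (auto simp: \<delta>_def power_divide power_mult_distrib mult.commute)
  have le: "\<bar>D \<omega>\<bar> \<le> \<delta> / 2 + (cmod (S \<omega>))\<^sup>2 / (2 * \<delta>)" for \<omega>
  proof -
    have "0 \<le> (cmod (S \<omega>) - \<delta>)\<^sup>2" by simp
    then have "2 * \<delta> * cmod (S \<omega>) \<le> \<delta>\<^sup>2 + (cmod (S \<omega>))\<^sup>2" by (simp add: power2_eq_square algebra_simps)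
    then have "cmod (S \<omega>) \<le> \<delta> / 2 + (cmod (S \<omega>))\<^sup>2 / (2 * \<delta>)" using \<delta>(1) by (simp add: field_simps power2_eq_square)
    then show ?thesis using abs_Re_le_cmod[of "S \<omega>"] unfolding DS by linarith
  qed
  have intR: "integrable M (\<lambda>\<omega>. \<delta> / 2 + (cmod (S \<omega>))\<^sup>2 / (2 * \<delta>))" using S2(1) by simp
  show intD: "integrable M (\<lambda>\<omega>. \<bar>D \<omega>\<bar>)"
  proof (rule Bochner_Integration.integrable_bound[OF intR])
    show "(\<lambda>\<omega>. \<bar>D \<omega>\<bar>) \<in> borel_measurable M" using Dm by simp
    show "AE \<omega> in M. norm \<bar>D \<omega>\<bar> \<le> norm (\<delta> / 2 + (cmod (S \<omega>))\<^sup>2 / (2 * \<delta>))"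
      using order_trans[OF le abs_ge_self] by (intro AE_I2) simp
  qed
  have "expectation (\<lambda>\<omega>. \<bar>D \<omega>\<bar>) \<le> expectation (\<lambda>\<omega>. \<delta> / 2 + (cmod (S \<omega>))\<^sup>2 / (2 * \<delta>))"
    by (intro integral_mono intD intR le)
  also have "\<dots> = \<delta> / 2 + expectation (\<lambda>\<omega>. (cmod (S \<omega>))\<^sup>2) / (2 * \<delta>)" using S2(1) by (simp add: prob_space)
  also have "\<dots> \<le> \<delta> / 2 + \<delta>\<^sup>2 / (2 * \<delta>)"
    using S2(2) \<delta> by (intro add_left_mono divide_right_mono) auto
  also have "\<dots> = \<delta>" using \<delta>(1) by (simp add: power2_eq_square)
  finally show "expectation (\<lambda>\<omega>. \<bar>D \<omega>\<bar>) \<le> 1 / (x * sqrt m)" by (simp add: \<delta>_def)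
qed

abbreviation "emp_st \<equiv> empirical_stieltjes n m H x"

lemma empirical_stieltjes_bounds: "0 \<le> emp_st \<omega>" "emp_st \<omega> \<le> 1 / x"
  using resolvent_trace_bounds[OF finite_lessThan x, of m n "entry H \<omega>"] m
  by (auto simp: empirical_stieltjes_def field_simps)

lemma empirical_stieltjes_measurable: "emp_st \<in> borel_measurable M"
proof -
  have "(\<lambda>\<omega>. resolvent_trace m x {..<n} (entry H \<omega>)) \<in> borel_measurable M"
    by (intro borel_measurable_resolvent_trace entry_measurable) auto
  then show ?thesis unfolding empirical_stieltjes_def[abs_def] by simp
qed

lemma empirical_stieltjes_integrable: "integrable M emp_st"
  by (rule integrable_const_bound[where B = "1 / x"])
    (use empirical_stieltjes_bounds empirical_stieltjes_measurable in \<open>auto intro!: AE_I2\<close>)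

text \<open>In the trace identity each term q_i / (1 + q_i) is replaced by G / (1 + G). The map is
  1-Lipschitz on [0, \<infinity>), so the error is the deviation of q_i plus 1 / (x m) for restoring
  row i in the trace.\<close>

lemma fixed_point_defect:
  defines "\<Delta> \<equiv> \<lambda>\<omega>. (1 - x * emp_st \<omega>) -
     real n / m * (emp_st \<omega> / (1 + emp_st \<omega>))"
  shows "integrable M (\<lambda>\<omega>. \<bar>\<Delta> \<omega>\<bar>)"
    and "expectation (\<lambda>\<omega>. \<bar>\<Delta> \<omega>\<bar>) \<le> real n / m * (1 / (x * sqrt m) + 1 / (x * m))"
proof -
  let ?G = emp_st
  define D where "D i \<omega> = Re (quad_form m (resolvent m x ({..<n} - {i}) (entry H \<omega>)) (\<lambda>k. cnj (entry H \<omega> i k)))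
      - resolvent_trace m x ({..<n} - {i}) (entry H \<omega>) / m" for i \<omega>
  have intD: "integrable M (\<lambda>\<omega>. \<bar>D i \<omega>\<bar>)" and ED: "expectation (\<lambda>\<omega>. \<bar>D i \<omega>\<bar>) \<le> 1 / (x * sqrt m)" if "i < n" for i
    using quad_form_deviation[OF that] by (simp_all add: D_def)
  have ptw: "\<bar>\<Delta> \<omega>\<bar> \<le> (\<Sum>i<n. \<bar>D i \<omega>\<bar> + 1 / (x * m)) / m" for \<omega>
  proof -
    define q where "q i = Re (quad_form m (resolvent m x ({..<n} - {i}) (entry H \<omega>)) (\<lambda>k. cnj (entry H \<omega> i k)))" for i
    have q0: "q i \<ge> 0" for i unfolding q_def by (rule quad_form_resolvent(3)) (use x in auto)
    have row: "Re (quad_form m (resolvent m x {..<n} (entry H \<omega>)) (\<lambda>k. cnj (entry H \<omega> i k))) = q i / (1 + q i)"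
      if "i < n" for i
    proof -
      have "insert i ({..<n} - {i}) = {..<n}" using that by auto
      then show ?thesis
        using quad_form_resolvent_insert[of "{..<n} - {i}" x i m "entry H \<omega>"] x by (simp add: q_def)
    qed
    have dist: "\<bar>q i - ?G \<omega>\<bar> \<le> \<bar>D i \<omega>\<bar> + 1 / (x * m)" if "i < n" for i
    proof -
      have ins: "insert i ({..<n} - {i}) = {..<n}" using that by auto
      define t where "t = resolvent_trace m x ({..<n} - {i}) (entry H \<omega>)"
      define t' where "t' = resolvent_trace m x {..<n} (entry H \<omega>)"
      have "t' \<le> t" "t \<le> t' + 1 / x"
        using resolvent_trace_insert[of "{..<n} - {i}" x i m "entry H \<omega>"] x unfolding ins t_def t'_def by auto
      then have "\<bar>t - t'\<bar> / m \<le> (1 / x) / m" by (intro divide_right_mono) auto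
      then have "\<bar>t / m - t' / m\<bar> \<le> 1 / (x * m)"
        using m by (simp add: abs_divide diff_divide_distrib[symmetric])
      moreover have "q i - ?G \<omega> = D i \<omega> + (t / m - t' / m)"
        by (simp add: D_def q_def t_def t'_def empirical_stieltjes_def)
      ultimately show ?thesis by linarith
    qed
    have "(\<Sum>i<n. q i / (1 + q i)) = m - x * resolvent_trace m x {..<n} (entry H \<omega>)"
      using sum_quad_form_resolvent[OF finite_lessThan x, of m n "entry H \<omega>"] row by simp
    then have "m * (1 - x * ?G \<omega>) = (\<Sum>i<n. q i / (1 + q i))"
      using m by (simp add: empirical_stieltjes_def right_diff_distrib)
    then have "m * \<Delta> \<omega> = (\<Sum>i<n. q i / (1 + q i) - ?G \<omega> / (1 + ?G \<omega>))"
      using m by (simp add: \<Delta>_def sum_subtractf right_diff_distrib)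
    then have "m * \<bar>\<Delta> \<omega>\<bar> = \<bar>\<Sum>i<n. q i / (1 + q i) - ?G \<omega> / (1 + ?G \<omega>)\<bar>"
      by (metis abs_mult abs_of_nat)
    also have "\<dots> \<le> (\<Sum>i<n. \<bar>q i / (1 + q i) - ?G \<omega> / (1 + ?G \<omega>)\<bar>)" by (rule sum_abs)
    also have "\<dots> \<le> (\<Sum>i<n. \<bar>D i \<omega>\<bar> + 1 / (x * m))"
      using abs_ratio_diff_le[OF q0 empirical_stieltjes_bounds(1)] dist
      by (intro sum_mono) (meson lessThan_iff order_trans)
    finally show ?thesis using m by (simp add: field_simps)
  qed
  have intS: "integrable M (\<lambda>\<omega>. (\<Sum>i<n. \<bar>D i \<omega>\<bar> + 1 / (x * m)) / m)"
    by (intro integrable_divide Bochner_Integration.integrable_sum Bochner_Integration.integrable_add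
        intD integrable_const) auto
  have \<Delta>m: "\<Delta> \<in> borel_measurable M"
    unfolding \<Delta>_def using empirical_stieltjes_measurable by simp
  show int\<Delta>: "integrable M (\<lambda>\<omega>. \<bar>\<Delta> \<omega>\<bar>)"
  proof (rule Bochner_Integration.integrable_bound[OF intS])
    show "(\<lambda>\<omega>. \<bar>\<Delta> \<omega>\<bar>) \<in> borel_measurable M" using \<Delta>m by simp
    show "AE \<omega> in M. norm \<bar>\<Delta> \<omega>\<bar> \<le> norm ((\<Sum>i<n. \<bar>D i \<omega>\<bar> + 1 / (x * m)) / m)"
      using order_trans[OF ptw abs_ge_self] by (intro AE_I2) simp
  qed
  have "expectation (\<lambda>\<omega>. \<bar>\<Delta> \<omega>\<bar>) \<le> expectation (\<lambda>\<omega>. (\<Sum>i<n. \<bar>D i \<omega>\<bar> + 1 / (x * m)) / m)"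
    by (intro integral_mono int\<Delta> intS ptw)
  also have "\<dots> = (\<Sum>i<n. expectation (\<lambda>\<omega>. \<bar>D i \<omega>\<bar> + 1 / (x * m))) / m"
    by (subst integral_divide_zero, subst Bochner_Integration.integral_sum)
      (auto intro!: Bochner_Integration.integrable_add intD)
  also have "\<dots> = (\<Sum>i<n. expectation (\<lambda>\<omega>. \<bar>D i \<omega>\<bar>) + 1 / (x * m)) / m"
    by (intro arg_cong[where f = "\<lambda>t. t / _"] sum.cong refl)
      (subst Bochner_Integration.integral_add, auto intro: intD simp: prob_space)
  also have "\<dots> \<le> (\<Sum>i<n. 1 / (x * sqrt m) + 1 / (x * m)) / m"
    using ED by (intro divide_right_mono sum_mono add_right_mono) auto
  also have "\<dots> = real n / m * (1 / (x * sqrt m) + 1 / (x * m))" by simp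
  finally show "expectation (\<lambda>\<omega>. \<bar>\<Delta> \<omega>\<bar>) \<le> real n / m * (1 / (x * sqrt m) + 1 / (x * m))" .
qed

text \<open>The stability estimate is applied to the random G pointwise and averaged afterwards, so
  the expectation never has to pass through the nonlinear map t / (1 + t).\<close>

lemma expectation_empirical_stieltjes:
  assumes g: "g \<ge> 0" "(1 - x * g) - c * (g / (1 + g)) = 0"
  shows "\<bar>expectation emp_st - g\<bar> \<le>
     (real n / m * (1 / (x * sqrt m) + 1 / (x * m)) + \<bar>real n / m - c\<bar>) / x"
proof -
  let ?G = emp_st
  let ?\<Delta> = "\<lambda>\<omega>. (1 - x * ?G \<omega>) - real n / m * (?G \<omega> / (1 + ?G \<omega>))"
  note intG = empirical_stieltjes_integrable
  have "expectation ?G - g = expectation (\<lambda>\<omega>. ?G \<omega> - g)" using intG by (simp add: prob_space)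
  then have "\<bar>expectation ?G - g\<bar> \<le> expectation (\<lambda>\<omega>. \<bar>?G \<omega> - g\<bar>)" by (metis integral_abs_bound)
  also have "\<dots> \<le> expectation (\<lambda>\<omega>. (\<bar>?\<Delta> \<omega>\<bar> + \<bar>real n / m - c\<bar>) / x)"
  proof (rule integral_mono)
    show "integrable M (\<lambda>\<omega>. \<bar>?G \<omega> - g\<bar>)" using intG by simp
    show "integrable M (\<lambda>\<omega>. (\<bar>?\<Delta> \<omega>\<bar> + \<bar>real n / m - c\<bar>) / x)"
      by (intro integrable_divide Bochner_Integration.integrable_add fixed_point_defect(1) integrable_const)
    show "\<bar>?G \<omega> - g\<bar> \<le> (\<bar>?\<Delta> \<omega>\<bar> + \<bar>real n / m - c\<bar>) / x" for \<omega>
      by (rule fixed_point_distance[OF x _ empirical_stieltjes_bounds(1) g]) simp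
  qed
  also have "\<dots> = (expectation (\<lambda>\<omega>. \<bar>?\<Delta> \<omega>\<bar>) + \<bar>real n / m - c\<bar>) / x"
    using Bochner_Integration.integral_add[OF fixed_point_defect(1) integrable_const[of "\<bar>real n / m - c\<bar>"]]
    by (simp add: prob_space)
  also have "\<dots> \<le> (real n / m * (1 / (x * sqrt m) + 1 / (x * m)) + \<bar>real n / m - c\<bar>) / x"
    using x by (intro divide_right_mono add_right_mono fixed_point_defect(2)) auto
  finally show ?thesis .
qed

text \<open>The independent blocks are the n rows. Replacing one moves the trace by at most 1 / x,
  since both values lie within 1 / x below the trace without that row; thus d = 1 / (x m).\<close>

lemma empirical_stieltjes_tail:
  assumes n: "n > 0" and e: "\<epsilon> > 0"
  shows "prob {\<omega> \<in> space M. \<epsilon> \<le> \<bar>emp_st \<omega> - expectation emp_st\<bar>}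
     \<le> 2 * exp (- \<epsilon>\<^sup>2 * x\<^sup>2 * (real m)\<^sup>2 / (2 * real n))"
proof -
  define N where "N i = PiM ({i} \<times> {..<m}) (\<lambda>_. borel :: complex measure)" for i :: nat
  define R where "R i \<omega> = restrict (\<lambda>p. entry H \<omega> (fst p) (snd p)) ({i} \<times> {..<m})" for i \<omega>
  define f where "f r = resolvent_trace m x {..<n} (\<lambda>i j. r i (i, j)) / m" for r :: "nat \<Rightarrow> nat \<times> nat \<Rightarrow> complex"
  have ind: "indep_vars N R {..<n}"
    unfolding N_def R_def by (rule indep_vars_restrict[OF entries_indep]) (auto simp: disjoint_family_on_def)
  have fm: "f \<in> borel_measurable (PiM {..<n} N)"
  proof -
    have "(\<lambda>r. r i (i, j)) \<in> borel_measurable (PiM {..<n} N)" if "i < n" "j < m" for i j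
    proof -
      have "(\<lambda>r. r i) \<in> measurable (PiM {..<n} N) (N i)" using that by (intro measurable_component_singleton) auto
      moreover have "(\<lambda>u. u (i, j)) \<in> borel_measurable (N i)"
        unfolding N_def using that by (intro measurable_component_singleton) auto
      ultimately show ?thesis by (rule measurable_compose)
    qed
    then have "(\<lambda>r. resolvent_trace m x {..<n} (\<lambda>i j. r i (i, j))) \<in> borel_measurable (PiM {..<n} N)"
      by (intro borel_measurable_resolvent_trace) auto
    then show ?thesis unfolding f_def[abs_def] by simp
  qed
  have bnd: "\<bar>f r\<bar> \<le> 1 / x" for r
    using resolvent_trace_bounds[OF finite_lessThan x, of m n "\<lambda>i j. r i (i, j)"] m
    by (auto simp: f_def field_simps)
  have diff: "\<bar>f r - f (r(i := y))\<bar> \<le> 1 / (x * m)" if i: "i \<in> {..<n}" for r i y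
  proof -
    define T where "T = {..<n} - {i}"
    have T: "finite T" "i \<notin> T" "insert i T = {..<n}" using i by (auto simp: T_def)
    define h where "h = (\<lambda>i j. r i (i, j))"
    define h' where "h' = (\<lambda>k j. (r(i := y)) k (k, j))"
    have same: "resolvent_trace m x T h = resolvent_trace m x T h'"
      by (rule resolvent_cong) (auto simp: T_def h_def h'_def)
    have "\<bar>resolvent_trace m x {..<n} h - resolvent_trace m x {..<n} h'\<bar> \<le> 1 / x"
      using resolvent_trace_insert[OF T(1) x T(2), of m h] resolvent_trace_insert[OF T(1) x T(2), of m h']
      unfolding T(3) same by linarith
    then have "\<bar>resolvent_trace m x {..<n} h - resolvent_trace m x {..<n} h'\<bar> / m \<le> (1 / x) / m"
      by (intro divide_right_mono) auto
    then show ?thesis using m by (simp add: f_def h_def h'_def abs_divide diff_divide_distrib[symmetric])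
  qed
  have F: "(\<lambda>\<omega>. f (\<lambda>i\<in>{..<n}. R i \<omega>)) = emp_st"
    unfolding f_def empirical_stieltjes_def R_def
    by (intro ext arg_cong[where f = "\<lambda>t. t / _"] resolvent_cong(2)) auto
  have "prob {\<omega> \<in> space M. \<epsilon> \<le> \<bar>emp_st \<omega> - expectation emp_st\<bar>}
     \<le> 2 * exp (- \<epsilon>\<^sup>2 / (2 * (1 / (x * m))\<^sup>2 * card {..<n}))"
    unfolding F[symmetric]
  proof (rule bounded_differences_indep_vars(2)[OF ind _ _ _ fm _ _ e])
    show "\<bar>f r\<bar> \<le> 1 / x" for r by (rule bnd)
    show "\<bar>f r - f (r(i := y))\<bar> \<le> 1 / (x * m)" if "i \<in> {..<n}" for r i y by (rule diff[OF that])
    show "{..<n} \<noteq> {}" using n by auto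
  qed (use m x in auto)
  also have "- \<epsilon>\<^sup>2 / (2 * (1 / (x * m))\<^sup>2 * card {..<n}) = - \<epsilon>\<^sup>2 * x\<^sup>2 * (real m)\<^sup>2 / (2 * real n)"
    using n m x by (simp add: field_simps power2_eq_square)
  finally show ?thesis .
qed

end

end

subsection \<open>Almost sure convergence\<close>

text \<open>Half of the exponent absorbs the linear factor, which will come from a union over at
  most K m row numbers.\<close>

lemma summable_linear_times_exp:
  fixes \<kappa> :: real
  assumes \<kappa>: "\<kappa> > 0"
  shows "summable (\<lambda>m::nat. C * real m * exp (- \<kappa> * real m))"
proof -
  have "summable (\<lambda>m::nat. \<bar>C\<bar> * (2 / \<kappa>) * exp (- \<kappa> / 2) ^ m)"
    using \<kappa> by (intro summable_mult summable_geometric) simp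
  then show ?thesis
  proof (rule summable_comparison_test'[where N = 0])
    fix m :: nat
    define t where "t = \<kappa> * real m / 2"
    have "t \<le> exp t" using exp_ge_add_one_self[of t] by linarith
    then have "real m \<le> 2 / \<kappa> * exp t" using \<kappa> by (simp add: t_def field_simps)
    then have "real m * exp (- \<kappa> * real m) \<le> 2 / \<kappa> * exp t * exp (- \<kappa> * real m)"
      by (intro mult_right_mono) auto
    also have "\<dots> = 2 / \<kappa> * exp (t + (- \<kappa> * real m))" unfolding mult.assoc mult_exp_exp ..
    also have "t + (- \<kappa> * real m) = real m * (- \<kappa> / 2)" by (simp add: t_def field_simps)
    also have "exp \<dots> = exp (- \<kappa> / 2) ^ m" by (rule exp_of_nat_mult)
    finally have "\<bar>C\<bar> * (real m * exp (- \<kappa> * real m)) \<le> \<bar>C\<bar> * (2 / \<kappa> * exp (- \<kappa> / 2) ^ m)"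
      by (intro mult_left_mono) auto
    then show "norm (C * real m * exp (- \<kappa> * real m)) \<le> \<bar>C\<bar> * (2 / \<kappa>) * exp (- \<kappa> / 2) ^ m"
      by (simp add: abs_mult mult.assoc)
  qed
qed

text \<open>No joint law of the matrices of different sizes is assumed and the sizes may grow arbitrarily
  slowly, so Borel--Cantelli is applied to the union over all row numbers \<open>n \<le> K * m\<close>.\<close>

lemma (in prob_space) AE_empirical_stieltjes:
  fixes H :: "nat \<Rightarrow> nat \<Rightarrow> 'a \<Rightarrow> complex mat" and rows cols :: "nat \<Rightarrow> nat"
  assumes iid: "\<And>n m. iid_gaussian_matrix M n m (1 / real m) (H n m)"
    and rows: "filterlim rows at_top sequentially" and cols: "filterlim cols at_top sequentially"
    and ratio: "(\<lambda>k. real (rows k) / real (cols k)) \<longlonglongrightarrow> c" and c: "c > 0" and x: "x > 0"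
    and g: "g \<ge> 0" "(1 - x * g) - c * (g / (1 + g)) = 0"
  shows "AE \<omega> in M. (\<lambda>k. empirical_stieltjes (rows k) (cols k) (H (rows k) (cols k)) x \<omega>) \<longlonglongrightarrow> g"
proof -
  define G where "G n m = empirical_stieltjes n m (H n m) x" for n m
  obtain K :: nat where K: "c < real K" using reals_Archimedean2 by blast
  have K0: "K > 0" using K c by (cases K) auto
  \<comment> \<open>The index j encodes the tolerance 1 / (j + 1), so countably many events suffice;
    m = 0, where the entry variance 1 / m is meaningless, is left out.\<close>
  define bad where "bad j m = (if m = 0 then {} else
      \<Union>n\<in>{1..K * m}. {\<omega> \<in> space M. 1 / (real j + 1) \<le> \<bar>G n m \<omega> - expectation (G n m)\<bar>})" for j m :: nat
  have Gm: "G n m \<in> borel_measurable M" if "m > 0" for n m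
    unfolding G_def by (rule empirical_stieltjes_measurable[OF iid that x])
  have cols0: "eventually (\<lambda>k. cols k > 0) sequentially" and rows0: "eventually (\<lambda>k. rows k > 0) sequentially"
    using filterlim_at_top[THEN iffD1, OF cols, rule_format, of 1]
      filterlim_at_top[THEN iffD1, OF rows, rule_format, of 1] by (auto simp: Suc_le_eq)
  have badn: "{\<omega> \<in> space M. 1 / (real j + 1) \<le> \<bar>G n m \<omega> - expectation (G n m)\<bar>} \<in> sets M" if "m > 0" for n m j
    using Gm[OF that, of n] by simp
  have badm: "bad j m \<in> sets M" for j m
    unfolding bad_def using badn by (auto intro!: sets.finite_UN)
  have badp: "prob (bad j m) \<le> (2 * K) * real m * exp (- ((1 / (real j + 1))\<^sup>2 * x\<^sup>2 / (2 * K)) * real m)" for j m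
  proof (cases "m = 0")
    case False
    then have m: "m > 0" by simp
    define \<epsilon> where "\<epsilon> = 1 / (real j + 1)"
    have e: "\<epsilon> > 0" by (simp add: \<epsilon>_def)
    have "prob (bad j m) \<le> (\<Sum>n\<in>{1..K * m}. prob {\<omega> \<in> space M. \<epsilon> \<le> \<bar>G n m \<omega> - expectation (G n m)\<bar>})"
      unfolding bad_def \<epsilon>_def using m badn by (auto intro!: finite_measure_subadditive_finite)
    also have "\<dots> \<le> (\<Sum>n\<in>{1..K * m}. 2 * exp (- (\<epsilon>\<^sup>2 * x\<^sup>2 / (2 * K)) * real m))"
    proof (intro sum_mono)
      fix n assume n: "n \<in> {1..K * m}"
      have "prob {\<omega> \<in> space M. \<epsilon> \<le> \<bar>G n m \<omega> - expectation (G n m)\<bar>} \<le> 2 * exp (- \<epsilon>\<^sup>2 * x\<^sup>2 * (real m)\<^sup>2 / (2 * real n))"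
        unfolding G_def using n by (intro empirical_stieltjes_tail[OF iid m x _ e]) auto
      also have "\<dots> \<le> 2 * exp (- (\<epsilon>\<^sup>2 * x\<^sup>2 / (2 * K)) * real m)"
      proof -
        \<comment> \<open>The restriction n \<le> K m turns m^2 / n into at least m / K, a rate
          depending on m only.\<close>
        have "real n \<le> real K * real m" using n by (simp flip: of_nat_mult)
        then have "\<epsilon>\<^sup>2 * x\<^sup>2 * (real m)\<^sup>2 / (2 * (real K * real m)) \<le> \<epsilon>\<^sup>2 * x\<^sup>2 * (real m)\<^sup>2 / (2 * real n)"
          using n m K0 by (intro divide_left_mono) auto
        moreover have "\<epsilon>\<^sup>2 * x\<^sup>2 * (real m)\<^sup>2 / (2 * (real K * real m)) = \<epsilon>\<^sup>2 * x\<^sup>2 / (2 * K) * real m"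
          using m K0 by (simp add: field_simps power2_eq_square)
        ultimately show ?thesis by simp
      qed
      finally show "prob {\<omega> \<in> space M. \<epsilon> \<le> \<bar>G n m \<omega> - expectation (G n m)\<bar>} \<le> 2 * exp (- (\<epsilon>\<^sup>2 * x\<^sup>2 / (2 * K)) * real m)" .
    qed
    finally show ?thesis by (simp add: \<epsilon>_def mult_ac)
  qed (simp add: bad_def)
  have "AE \<omega> in M. \<forall>j. eventually (\<lambda>m. \<omega> \<in> space M - bad j m) sequentially"
    unfolding AE_all_countable
  proof
    fix j
    have "summable (\<lambda>m. prob (bad j m))"
    proof (rule summable_comparison_test'[where N = 0])
      show "summable (\<lambda>m. (2 * K) * real m * exp (- ((1 / (real j + 1))\<^sup>2 * x\<^sup>2 / (2 * K)) * real m))"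
        using x K0 by (intro summable_linear_times_exp) simp
      show "norm (prob (bad j m)) \<le> (2 * K) * real m * exp (- ((1 / (real j + 1))\<^sup>2 * x\<^sup>2 / (2 * K)) * real m)" for m
        using badp[of j m] by simp
    qed
    then show "AE \<omega> in M. eventually (\<lambda>m. \<omega> \<in> space M - bad j m) sequentially"
      by (intro borel_cantelli_AE1 badm) (auto simp: emeasure_eq_measure)
  qed
  then show ?thesis
  proof eventually_elim
    case (elim \<omega>)
    have EG: "(\<lambda>k. expectation (G (rows k) (cols k))) \<longlonglongrightarrow> g"
    proof (rule LIM_zero_cancel, rule Lim_null_comparison)
      let ?r = "\<lambda>k. real (rows k) / real (cols k)"
      show "eventually (\<lambda>k. norm (expectation (G (rows k) (cols k)) - g) \<le>
          (?r k * (1 / (x * sqrt (cols k)) + 1 / (x * cols k)) + \<bar>?r k - c\<bar>) / x) sequentially"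
        using cols0
      proof eventually_elim
        case (elim k)
        show ?case
          using expectation_empirical_stieltjes[OF iid elim x g, of "rows k"] by (simp add: G_def)
      qed
      have rc: "filterlim (\<lambda>k. real (cols k)) at_top sequentially"
        by (rule filterlim_compose[OF filterlim_real_sequentially cols])
      have "(\<lambda>k. 1 / (x * sqrt (cols k))) \<longlonglongrightarrow> 0"
        by (intro tendsto_divide_0[OF tendsto_const] filterlim_at_top_imp_at_infinity
            filterlim_tendsto_pos_mult_at_top[OF tendsto_const x] filterlim_compose[OF sqrt_at_top rc])
      moreover have "(\<lambda>k. 1 / (x * cols k)) \<longlonglongrightarrow> 0"
        by (intro tendsto_divide_0[OF tendsto_const] filterlim_at_top_imp_at_infinity
            filterlim_tendsto_pos_mult_at_top[OF tendsto_const x] rc)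
      moreover have "(\<lambda>k. \<bar>?r k - c\<bar>) \<longlonglongrightarrow> 0"
        using tendsto_rabs[OF LIM_zero[OF ratio]] by simp
      ultimately have "(\<lambda>k. (?r k * (1 / (x * sqrt (cols k)) + 1 / (x * cols k)) + \<bar>?r k - c\<bar>) / x)
          \<longlonglongrightarrow> (c * (0 + 0) + 0) / x"
        using x by (intro tendsto_intros ratio) auto
      then show "(\<lambda>k. (?r k * (1 / (x * sqrt (cols k)) + 1 / (x * cols k)) + \<bar>?r k - c\<bar>) / x) \<longlonglongrightarrow> 0"
        by simp
    qed
    show ?case
    proof (rule LIMSEQ_I)
      fix r :: real assume r: "r > 0"
      obtain j :: nat where "2 / r < real j" using reals_Archimedean2 by blast
      then have j: "1 / (real j + 1) < r / 2" using r by (simp add: field_simps)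
      \<comment> \<open>An event holding for all large m holds along any \<open>cols\<close> tending
        to infinity, even if sizes repeat.\<close>
      have "eventually (\<lambda>k. \<omega> \<in> space M - bad j (cols k)) sequentially"
        by (rule eventually_compose_filterlim[OF elim[rule_format] cols])
      moreover have "eventually (\<lambda>k. \<bar>expectation (G (rows k) (cols k)) - g\<bar> < r / 2) sequentially"
        using tendstoD[OF EG, of "r / 2"] r by (simp add: dist_real_def)
      moreover have "eventually (\<lambda>k. real (rows k) / real (cols k) < K) sequentially"
        by (rule order_tendstoD(2)[OF ratio K])
      moreover note cols0 rows0
      ultimately have "eventually (\<lambda>k. norm (G (rows k) (cols k) \<omega> - g) < r) sequentially"
      proof eventually_elim
        case (elim k)
        have "real (rows k) < real K * real (cols k)" using elim(3,4) by (simp add: field_simps)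
        then have "rows k \<in> {1..K * cols k}" using elim(5) by (simp flip: of_nat_mult)
        then have "\<bar>G (rows k) (cols k) \<omega> - expectation (G (rows k) (cols k))\<bar> < 1 / (real j + 1)"
          using elim(1,4) unfolding bad_def by (auto simp: not_le)
        then show ?case unfolding real_norm_def using elim(2) j by linarith
      qed
      then show "\<exists>no. \<forall>k\<ge>no. norm (empirical_stieltjes (rows k) (cols k) (H (rows k) (cols k)) x \<omega> - g) < r"
        unfolding eventually_sequentially G_def .
    qed
  qed
qed

text \<open>For m = 0 the quotient is 0 and the axioms still hold, so every index of the sequence
  yields a mean functional.\<close>

lemma mean_functional_multiset:
  assumes "\<And>l. l \<in># X \<Longrightarrow> l \<ge> 0" "size X = m"
  shows "mean_functional (\<lambda>f. (\<Sum>l\<in>#X. f l) / real m)"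
  unfolding mean_functional_def
proof (intro conjI ballI allI impI)
  show "(\<Sum>l\<in>#X. f l + g l) / real m = (\<Sum>l\<in>#X. f l) / real m + (\<Sum>l\<in>#X. g l) / real m" for f g
    by (simp add: sum_mset.distrib add_divide_distrib)
  show "(\<Sum>l\<in>#X. k * f l) / real m = k * ((\<Sum>l\<in>#X. f l) / real m)" for f k
    unfolding sum_mset_distrib_left[of k f X, symmetric] by simp
  fix f :: "real \<Rightarrow> real" and e assume e: "\<forall>x\<ge>0. \<bar>f x\<bar> \<le> e"
  have "\<bar>f 0\<bar> \<le> e" using e by simp
  then have e0: "e \<ge> 0" by linarith
  have "\<bar>\<Sum>l\<in>#X. f l\<bar> \<le> size X * e"
    using assms(1)
  proof (induction X)
    case (add l X)
    have "\<bar>f l\<bar> \<le> e" "\<bar>\<Sum>l\<in>#X. f l\<bar> \<le> size X * e" using e add by auto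
    then show ?case using abs_triangle_ineq[of "f l" "\<Sum>l\<in>#X. f l"] by (simp add: algebra_simps)
  qed simp
  then have "\<bar>\<Sum>l\<in>#X. f l\<bar> \<le> m * e" using assms(2) by simp
  then show "\<bar>(\<Sum>l\<in>#X. f l) / real m\<bar> \<le> e"
    using e0 by (cases "m = 0") (auto simp: field_simps)
qed

theorem mainTheorem3:
  fixes P :: "'w measure"
    and H :: "nat \<Rightarrow> nat \<Rightarrow> 'w \<Rightarrow> complex mat"
    and N M :: "nat \<Rightarrow> nat"
    and \<alpha> \<sigma> pmax a b :: real
  assumes "prob_space P"
    and "\<And>n m. iid_gaussian_matrix P n m (1 / real m) (H n m)"
    and "filterlim N at_top sequentially"
    and "filterlim M at_top sequentially"
    and "(\<lambda>k. real (M k) / real (N k)) \<longlonglongrightarrow> \<alpha>"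
    and "\<alpha> > 0"
    and "\<sigma>\<^sup>2 > 0"
    and "pmax > 0"
    and a: "a = (1 - 1 / sqrt \<alpha>)\<^sup>2"
    and b: "b = (1 + 1 / sqrt \<alpha>)\<^sup>2"
  defines "is_limit_level \<equiv> \<lambda>\<beta>. \<beta> > \<sigma>\<^sup>2 / b \<and>
      (LBINT l:{max (\<sigma>\<^sup>2 / \<beta>) a..b}.
         (\<beta> - \<sigma>\<^sup>2 / l) * (sqrt ((l - a) * (b - l)) / (2 * pi * l))) - pmax = 0"
  shows "(\<exists>!\<beta>. is_limit_level \<beta>) \<and>
    (\<forall>\<beta>. is_limit_level \<beta> \<longrightarrow>
      (AE \<omega> in P.
        (\<lambda>k. real_of_int (transmit_opportunities (\<sigma>\<^sup>2) pmax (H (N k) (M k) \<omega>)) / real (M k))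
          \<longlonglongrightarrow> 1 / \<alpha> - (LBINT l:{max a (\<sigma>\<^sup>2 / \<beta>)..b}. sqrt ((l - a) * (b - l)) / (2 * pi * l))))"
proof -
  interpret prob_space P by (rule assms(1))
  note iid = assms(2)
  \<comment> \<open>The limit of rows per column, the natural parameter of the limit law when the
    variance is 1 / columns.\<close>
  define c where "c = 1 / \<alpha>"
  have c: "c > 0" using assms(6) by (simp add: c_def)
  have "sqrt c = 1 / sqrt \<alpha>" by (simp add: c_def real_sqrt_divide)
  then have ac: "a = (1 - sqrt c)\<^sup>2" and bc: "b = (1 + sqrt c)\<^sup>2" using a b by simp_all
  define s where "s = \<sigma>\<^sup>2"
  have s: "s > 0" using assms(7) by (simp add: s_def)
  note mp = c ac bc s
  have level: "is_limit_level = (\<lambda>\<beta>. \<beta> > s / b \<and> mp_power a b s \<beta> = pmax)"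
    unfolding is_limit_level_def s_def[symmetric] mp_power_def[OF mp] mp_density_def right_minus_eq ..
  have used: "(LBINT l:{max a (s / \<beta>)..b}. sqrt ((l - a) * (b - l)) / (2 * pi * l)) = mp_used a b s \<beta>" for \<beta>
    unfolding mp_used_def[OF mp] mp_density_def ..
  have "\<exists>!\<beta>. is_limit_level \<beta>" unfolding level by (rule ex1_mp_power[OF mp assms(8)])
  moreover have "AE \<omega> in P.
        (\<lambda>k. real_of_int (transmit_opportunities s pmax (H (N k) (M k) \<omega>)) / real (M k)) \<longlonglongrightarrow> 1 / \<alpha> - mp_used a b s \<beta>"
    if lev: "is_limit_level \<beta>" for \<beta>
  proof -
    have \<beta>: "\<beta> > s / b" "mp_power a b s \<beta> = pmax" using lev by (simp_all add: level)
    have "(\<lambda>k. inverse (real (M k) / real (N k))) \<longlonglongrightarrow> inverse \<alpha>"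
      using assms(5,6) by (intro tendsto_inverse) auto
    then have ratio: "(\<lambda>k. real (N k) / real (M k)) \<longlonglongrightarrow> c" by (simp add: c_def inverse_eq_divide)
    define x where "x j = 1 + 1 / (real j + 1)" for j :: nat
    have x: "x j > 0" for j by (simp add: x_def add_pos_pos)
    have "AE \<omega> in P. (\<lambda>k. empirical_stieltjes (N k) (M k) (H (N k) (M k)) (x j) \<omega>) \<longlonglongrightarrow> mp_mean c a b (\<lambda>l. 1 / (l + x j))" for j
      by (rule AE_empirical_stieltjes[OF iid assms(3,4) ratio c x mp_mean_stieltjes[OF c ac bc x]])
    \<comment> \<open>A single null set serves all x j; on its complement the rest of the argument
      is deterministic.\<close>
    then have "AE \<omega> in P. \<forall>j. (\<lambda>k. empirical_stieltjes (N k) (M k) (H (N k) (M k)) (x j) \<omega>) \<longlonglongrightarrow> mp_mean c a b (\<lambda>l. 1 / (l + x j))"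
      unfolding AE_all_countable by simp
    then show ?thesis
    proof (rule AE_mp, intro AE_I2 impI)
      fix \<omega> assume \<omega>: "\<omega> \<in> space P"
        and conv: "\<forall>j. (\<lambda>k. empirical_stieltjes (N k) (M k) (H (N k) (M k)) (x j) \<omega>) \<longlonglongrightarrow> mp_mean c a b (\<lambda>l. 1 / (l + x j))"
      have Hc: "H n m \<omega> \<in> carrier_mat n m" for n m using iid[of n m] \<omega> by (simp add: iid_gaussian_matrix_def)
      define X where "X k = gram_eigenvalues (H (N k) (M k) \<omega>)" for k
      note ge = gram_eigenvalues_properties[OF Hc]
      have gp: "size (X k) = M k" "\<And>l. l \<in># X k \<Longrightarrow> l \<ge> 0"
        "\<And>y. y > 0 \<Longrightarrow> (\<Sum>l\<in>#X k. 1 / (l + y)) =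
           resolvent_trace (M k) y {..<N k} (\<lambda>i j. H (N k) (M k) \<omega> $$ (i, j))" for k
        unfolding X_def by (rule ge(1), erule ge(2), erule ge(3))
      define \<Lambda>s where "\<Lambda>s k f = (\<Sum>l\<in>#X k. f l) / real (M k)" for k and f :: "real \<Rightarrow> real"
      have mf: "mean_functional (\<Lambda>s k)" for k
        unfolding \<Lambda>s_def by (rule mean_functional_multiset[OF gp(2) gp(1)])
      note mfs = mf mean_functional_mp_mean[OF c ac bc]
      have Mpos: "eventually (\<lambda>k. M k > 0) sequentially"
        using filterlim_at_top[THEN iffD1, OF assms(4), rule_format, of 1] by (simp add: Suc_le_eq)
      have one: "means_converge \<Lambda>s (mp_mean c a b) (\<lambda>_. 1)"
        unfolding means_converge_def
      proof
        show "(\<lambda>_. 1) \<in> bcont" by (rule bcontI[of _ 1]) auto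
        have "eventually (\<lambda>k. \<Lambda>s k (\<lambda>_. 1) = 1) sequentially"
          using Mpos by eventually_elim (simp add: \<Lambda>s_def gp(1))
        then show "(\<lambda>k. \<Lambda>s k (\<lambda>_. 1)) \<longlonglongrightarrow> mp_mean c a b (\<lambda>_. 1)"
          unfolding mp_mean_one[OF c ac bc] by (rule tendsto_eventually)
      qed
      have res: "means_converge \<Lambda>s (mp_mean c a b) (\<lambda>l. 1 / (l + (1 + 1 / (real j + 1))))" for j :: nat
        unfolding means_converge_def x_def[symmetric]
      proof
        show "(\<lambda>l. 1 / (l + x j)) \<in> bcont"
        proof (rule bcontI[of _ "1 / x j"])
          show "continuous_on {0..} (\<lambda>l. 1 / (l + x j))"
          proof (intro continuous_intros ballI)
            fix l :: real assume "l \<in> {0..}"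
            then show "l + x j \<noteq> 0" using x[of j] by auto
          qed
          show "\<bar>1 / (l + x j)\<bar> \<le> 1 / x j" if "l \<ge> 0" for l
            using that x[of j] by (simp add: frac_le)
        qed
        have "\<Lambda>s k (\<lambda>l. 1 / (l + x j)) = empirical_stieltjes (N k) (M k) (H (N k) (M k)) (x j) \<omega>" for k
          unfolding \<Lambda>s_def gp(3)[OF x] empirical_stieltjes_def entry_def ..
        then show "(\<lambda>k. \<Lambda>s k (\<lambda>l. 1 / (l + x j))) \<longlonglongrightarrow> mp_mean c a b (\<lambda>l. 1 / (l + x j))"
          using conv by simp
      qed
      have power: "(\<lambda>k. total_power s (X k) \<gamma> / M k) \<longlonglongrightarrow> mp_power a b s \<gamma>" if "\<gamma> > s / b" for \<gamma>
      proof -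
        have \<gamma>: "\<gamma> > 0" using water_level_cutoff[OF mp that] by simp
        \<comment> \<open>The formula in 1 / (1 + l) agrees with \<open>wf_power\<close> for l \<ge>
          0 only, so the two are not equal as functions; an approximation with zero error on that
          half-line bridges the gap.\<close>
        have "means_converge \<Lambda>s (mp_mean c a b) (wf_power s \<gamma>)"
        proof (rule means_converge_limit[OF mfs wf_power_bcont[OF s \<gamma>]])
          fix e :: real assume "e > 0"
          then show "\<exists>g. means_converge \<Lambda>s (mp_mean c a b) g \<and> (\<forall>l\<ge>0. \<bar>wf_power s \<gamma> l - g l\<bar> \<le> e)"
            using means_converge_comp_inverse[OF mfs one res continuous_on_wf_inverse[OF s \<gamma>]] wf_power_inverse_comp[OF s \<gamma>]
            by (intro exI conjI) (assumption, simp)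
        qed
        then show ?thesis
          unfolding means_converge_def mp_power_eq_mp_mean[OF mp \<gamma>] by (simp add: \<Lambda>s_def total_power_def)
      qed
      have inc: "(\<gamma>' - \<gamma>) * mp_used a b s \<gamma> \<le> mp_power a b s \<gamma>' - mp_power a b s \<gamma> \<and>
          mp_power a b s \<gamma>' - mp_power a b s \<gamma> \<le> (\<gamma>' - \<gamma>) * mp_used a b s \<gamma>'" if "s / b < \<gamma>" "\<gamma> < \<gamma>'" for \<gamma> \<gamma>'
        using mp_power_increment[OF mp, of \<gamma> \<gamma>'] water_level_cutoff[OF mp that(1)] that(2) by simp
      have "(\<lambda>k. num_used s (X k) (THE \<beta>. total_power s (X k) \<beta> = real (M k) * pmax) / M k) \<longlonglongrightarrow> mp_used a b s \<beta>"
        by (rule num_used_tendsto[OF s assms(8) Mpos power inc mp_used_pos[OF mp] isCont_mp_used[OF mp \<beta>(1)] \<beta>])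
      moreover have "used_dimensions s pmax (H (N k) (M k) \<omega>) = num_used s (X k) (THE \<beta>. total_power s (X k) \<beta> = real (M k) * pmax)" for k
        using Hc[of "N k" "M k"] by (simp add: used_dimensions_def water_level_def num_used_def total_power_def X_def)
      ultimately have "(\<lambda>k. used_dimensions s pmax (H (N k) (M k) \<omega>) / M k) \<longlonglongrightarrow> mp_used a b s \<beta>" by simp
      \<comment> \<open>S / M is the difference of rows per column and used dimensions per column,
        each with its own limit.\<close>
      from tendsto_diff[OF ratio this]
      show "(\<lambda>k. real_of_int (transmit_opportunities s pmax (H (N k) (M k) \<omega>)) / real (M k)) \<longlonglongrightarrow> 1 / \<alpha> - mp_used a b s \<beta>"
        by (simp add: transmit_opportunities_def c_def diff_divide_distrib carrier_matD(1)[OF Hc])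
    qed
  qed
  ultimately show ?thesis unfolding s_def[symmetric] used by (intro conjI allI impI)
qed

end
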